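(* Assume that (A1) $\bar A_k$ is invertible for every $k\in[\![0,N-1]\!]$, and (A2) there exists $k_{\mathrm r}\in[\![1,N]\!]$ such that $\mathcal R(k,0)$ is invertible for every $k\in[\![k_{\mathrm r},N]\!]$ and $\mathcal R(N,k)$ is invertible for every $k\in[\![0,k_{\mathrm r}]\!]$. For $\varepsilon>0$ let $$\pi_k^{*}(u|x_k)=\mathcal N\bigl(u\,\big|\,-(R_k+B_k^\top\Pi_{k+1}^{(\varepsilon)}B_k)^{-1}(B_k^\top\Pi_{k+1}^{(\varepsilon)}A_k+S_k^\top)x_k,\ \varepsilon(R_k+B_k^\top\Pi_{k+1}^{(\varepsilon)}B_k)^{-1}\bigr),$$ where $\{\Pi_k^{(\varepsilon)}\}$ is the solution to the Riccati equation $$\Pi_k=\bar A_k^\top\Pi_{k+1}\bar A_k-\bar A_k^\top\Pi_{k+1}B_k(R_k+B_k^\top\Pi_{k+1}B_k)^{-1}B_k^\top\Pi_{k+1}\bar A_k+\bar Q_k,\quad k\in[\![0,N-1]\!],\qquad(\mathrm R)$$ with terminal value $$\Pi_N=-\varphi_{R,12}^{-1}\varphi_{R,11}+\tfrac{\varepsilon}{2}\bar\Sigma_N^{-1}+\bar\Sigma_N^{-1/2}\Bigl(\tfrac{\varepsilon^2}{4}I+\bar\Sigma_N^{1/2}\varphi_{R,12}^{-1}\bar\Sigma_0\varphi_{R,12}^{-\top}\bar\Sigma_N^{1/2}\Bigr)^{1/2}\bar\Sigma_N^{-1/2}.$$ Then, as $\varepsilon\searrow0$, the policy $\pi_k^*$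 converges to the unique optimal control law of the unregularized density control problem described in the context, which is given by $$u_k=-(R_k+B_k^\top\Pi_{k+1}^{(0)}B_k)^{-1}(B_k^\top\Pi_{k+1}^{(0)}A_k+S_k^\top)x_k,\quad k\in[\![0,N-1]\!],\ x_k\in\mathbb R^n,$$ where $\{\Pi_k^{(0)}\}$ is the solution to $(\mathrm R)$ with terminal value $$\Pi_N=-\varphi_{R,12}^{-1}\varphi_{R,11}+\bar\Sigma_N^{-1/2}\Bigl(\bar\Sigma_N^{1/2}\varphi_{R,12}^{-1}\bar\Sigma_0\varphi_{R,12}^{-\top}\bar\Sigma_N^{1/2}\Bigr)^{1/2}\bar\Sigma_N^{-1/2}.$$ That is, as $\varepsilon\searrow0$, the mean and the covariance of $\pi_k^*(\cdot|x_k)$ converge to $-(R_k+B_k^\top\Pi_{k+1}^{(0)}B_k)^{-1}(B_k^\top\Pi_{k+1}^{(0)}A_k+S_k^\top)x_k$ and to $0$, respectively.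
   Context: Notation: $n,m,N$ are positive integers; $[\![k,l]\!]=\{k,k+1,\dots,l\}$; $\mathcal S^n$ is the set of real symmetric $n\times n$ matrices; $\succ,\succeq$ denote the positive (semi)definite order; $X^{1/2}$ is the positive semidefinite square root of $X\succeq0$; $X^{-\top}$ is the transpose of the inverse; $\mathcal N(\cdot|\mu,\Sigma)$ is the Gaussian density with mean $\mu$ and covariance $\Sigma\succ0$. Data: for $k\in[\![0,N-1]\!]$, $A_k\in\mathbb R^{n\times n}$, $B_k\in\mathbb R^{n\times m}$, $S_k\in\mathbb R^{n\times m}$, $Q_k\in\mathcal S^n$, $R_k\in\mathcal S^m$ with $R_k\succ0$; $\bar A_k:=A_k-B_kR_k^{-1}S_k^\top$, $\bar Q_k:=Q_k-S_kR_k^{-1}S_k^\top$, with $\bar Q_k\succeq0$; $\bar\Sigma_0,\bar\Sigma_N\in\mathcal S^n$ are positive definite. Unregularized density control problem: find a control process $u=\{u_k\}_{k=0}^{N-1}$ minimizing over $u\in\mathcal U$ $$\mathbb E\Bigl[\sum_{k=0}^{N-1}\tfrac12\begin{bmatrix}x_k\\ u_k\end{bmatrix}^\top\begin{bmatrix}Q_k&S_k\\ S_k^\top&R_k\end{bmatrix}\begin{bmatrix}x_k\\ u_k\end{bmatrix}\Bigr]$$ subject to $x_{k+1}=A_kx_k+B_ku_k$, $x_0\sim\mathcal N(0,\bar\Sigma_0)$, $x_N\sim\mathcal N(0,\bar\Sigma_N)$, where $\mathcal U$ is the set of all square-summable $\mathbb R^m$-valued control processes adapted to $\{x_k\}$.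 Transition matrices: for invertible $\bar A_k$, $$M_k(R_k):=\begin{bmatrix}\bar A_k+B_kR_k^{-1}B_k^\top\bar A_k^{-\top}\bar Q_k&-B_kR_k^{-1}B_k^\top\bar A_k^{-\top}\\ -\bar A_k^{-\top}\bar Q_k&\bar A_k^{-\top}\end{bmatrix},$$ which is invertible; $\Phi_{M(R)}(k,l):=M_{k-1}(R_{k-1})\cdots M_l(R_l)$ if $k>l$, $I$ if $k=l$, and $M_k(R_k)^{-1}M_{k+1}(R_{k+1})^{-1}\cdots M_{l-1}(R_{l-1})^{-1}$ if $k<l$. $\Phi_{R,ij}(k,l)$ are its $n\times n$ blocks and $\varphi_{R,ij}:=\Phi_{R,ij}(0,N)$. $\Phi_{\bar A}(k,l)$ is defined in the same way from $\{\bar A_k\}$. Reachability Gramian: $\mathcal R(k_1,k_0):=\sum_{k=k_0}^{k_1-1}\Phi_{\bar A}(k_1,k+1)B_kB_k^\top\Phi_{\bar A}(k_1,k+1)^\top$ (empty sum $=0$ if $k_1=k_0$). Under (A1) and (A2), $\varphi_{R,12}$ is invertible. *)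

theory Defs
  imports "HOL-Probability.Probability"
begin

section \<open>Matrices\<close>

definition pos_semidef :: "real^'n^'n \<Rightarrow> bool" where
  "pos_semidef X \<longleftrightarrow> transpose X = X \<and> (\<forall>x. 0 \<le> x \<bullet> (X *v x))"

definition pos_def :: "real^'n^'n \<Rightarrow> bool" where
  "pos_def X \<longleftrightarrow> transpose X = X \<and> (\<forall>x. x \<noteq> 0 \<longrightarrow> 0 < x \<bullet> (X *v x))"

definition psd_sqrt :: "real^'n^'n \<Rightarrow> real^'n^'n" where
  "psd_sqrt X = (THE Y. pos_semidef Y \<and> Y ** Y = X)"

text \<open>Block vectors and block matrices are indexed by the sum type \<open>'a + 'b\<close>: the constructor
  \<open>Inl\<close> selects the first block and \<open>Inr\<close> the second.\<close>

definition block_vec :: "real^'a \<Rightarrow> real^'b \<Rightarrow> real^('a + 'b)" where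
  "block_vec x y = (\<chi> i. case i of Inl a \<Rightarrow> x $ a | Inr b \<Rightarrow> y $ b)"

definition block_mat ::
  "real^'a^'a \<Rightarrow> real^'b^'a \<Rightarrow> real^'a^'b \<Rightarrow> real^'b^'b \<Rightarrow> real^('a + 'b)^('a + 'b)" where
  "block_mat X11 X12 X21 X22 =
     (\<chi> i j. case i of
         Inl a \<Rightarrow> (case j of Inl a' \<Rightarrow> X11 $ a $ a' | Inr b' \<Rightarrow> X12 $ a $ b')
       | Inr b \<Rightarrow> (case j of Inl a' \<Rightarrow> X21 $ b $ a' | Inr b' \<Rightarrow> X22 $ b $ b'))"

definition block11 :: "real^('a + 'b::finite)^('a + 'b) \<Rightarrow> real^'a^'a" where
  "block11 X = (\<chi> i j. X $ Inl i $ Inl j)"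

definition block12 :: "real^('a + 'b)^('a + 'b) \<Rightarrow> real^'b^'a" where
  "block12 X = (\<chi> i j. X $ Inl i $ Inr j)"

text \<open>The value is \<open>F (k - 1) ** \<dots> ** F l\<close> for \<open>k > l\<close>, the identity for \<open>k = l\<close>, and
  \<open>matrix_inv (F k) ** \<dots> ** matrix_inv (F (l - 1))\<close> for \<open>k < l\<close>.\<close>

definition transition :: "(nat \<Rightarrow> real^'k^'k) \<Rightarrow> nat \<Rightarrow> nat \<Rightarrow> real^'k^'k" where
  "transition F k l =
     (if l \<le> k then foldr (\<lambda>i P. F i ** P) (rev [l..<k]) (mat 1)
      else foldr (\<lambda>i P. matrix_inv (F i) ** P) [k..<l] (mat 1))"

section \<open>System data\<close>

text \<open>Time-indexed data are total functions on the naturals; only the indices below the horizon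
  \<open>N\<close> are ever used.\<close>

definition A_bar ::
  "(nat \<Rightarrow> real^'n^'n) \<Rightarrow> (nat \<Rightarrow> real^'m^'n) \<Rightarrow> (nat \<Rightarrow> real^'m^'n) \<Rightarrow> (nat \<Rightarrow> real^'m^'m)
    \<Rightarrow> nat \<Rightarrow> real^'n^'n" where
  "A_bar A B S R k = A k - B k ** matrix_inv (R k) ** transpose (S k)"

definition Q_bar ::
  "(nat \<Rightarrow> real^'m^'n) \<Rightarrow> (nat \<Rightarrow> real^'n^'n) \<Rightarrow> (nat \<Rightarrow> real^'m^'m) \<Rightarrow> nat \<Rightarrow> real^'n^'n" where
  "Q_bar S Q R k = Q k - S k ** matrix_inv (R k) ** transpose (S k)"

definition M_mat ::
  "(nat \<Rightarrow> real^'n^'n) \<Rightarrow> (nat \<Rightarrow> real^'m^'n) \<Rightarrow> (nat \<Rightarrow> real^'m^'n) \<Rightarrow> (nat \<Rightarrow> real^'n^'n)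
    \<Rightarrow> (nat \<Rightarrow> real^'m^'m) \<Rightarrow> nat \<Rightarrow> real^('n + 'n)^('n + 'n)" where
  "M_mat A B S Q R k =
     (let Ab = A_bar A B S R k;
          Qb = Q_bar S Q R k;
          G = B k ** matrix_inv (R k) ** transpose (B k);
          F = transpose (matrix_inv Ab)
      in block_mat (Ab + G ** F ** Qb) (- (G ** F)) (- (F ** Qb)) F)"

definition phi11 ::
  "nat \<Rightarrow> (nat \<Rightarrow> real^'n^'n) \<Rightarrow> (nat \<Rightarrow> real^'m^'n) \<Rightarrow> (nat \<Rightarrow> real^'m^'n) \<Rightarrow> (nat \<Rightarrow> real^'n^'n)
    \<Rightarrow> (nat \<Rightarrow> real^'m^'m) \<Rightarrow> real^'n^'n" where
  "phi11 N A B S Q R = block11 (transition (M_mat A B S Q R) 0 N)"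

definition phi12 ::
  "nat \<Rightarrow> (nat \<Rightarrow> real^'n^'n) \<Rightarrow> (nat \<Rightarrow> real^'m^'n) \<Rightarrow> (nat \<Rightarrow> real^'m^'n) \<Rightarrow> (nat \<Rightarrow> real^'n^'n)
    \<Rightarrow> (nat \<Rightarrow> real^'m^'m) \<Rightarrow> real^'n^'n" where
  "phi12 N A B S Q R = block12 (transition (M_mat A B S Q R) 0 N)"

definition reach_gramian ::
  "(nat \<Rightarrow> real^'n^'n) \<Rightarrow> (nat \<Rightarrow> real^'m^'n) \<Rightarrow> (nat \<Rightarrow> real^'m^'n) \<Rightarrow> (nat \<Rightarrow> real^'m^'m)
    \<Rightarrow> nat \<Rightarrow> nat \<Rightarrow> real^'n^'n" where
  "reach_gramian A B S R k1 k0 =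
     (\<Sum>k\<in>{k0..<k1}.
        transition (A_bar A B S R) k1 (k + 1) ** B k ** transpose (B k)
          ** transpose (transition (A_bar A B S R) k1 (k + 1)))"

section \<open>Riccati equation and feedback gains\<close>

definition control_weight ::
  "(nat \<Rightarrow> real^'m^'n) \<Rightarrow> (nat \<Rightarrow> real^'m^'m) \<Rightarrow> (nat \<Rightarrow> real^'n^'n) \<Rightarrow> nat \<Rightarrow> real^'m^'m" where
  "control_weight B R P k = R k + transpose (B k) ** P (k + 1) ** B k"

definition riccati_solution ::
  "nat \<Rightarrow> (nat \<Rightarrow> real^'n^'n) \<Rightarrow> (nat \<Rightarrow> real^'m^'n) \<Rightarrow> (nat \<Rightarrow> real^'m^'n) \<Rightarrow> (nat \<Rightarrow> real^'n^'n)
    \<Rightarrow> (nat \<Rightarrow> real^'m^'m) \<Rightarrow> (nat \<Rightarrow> real^'n^'n) \<Rightarrow> bool" where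
  "riccati_solution N A B S Q R P \<longleftrightarrow>
     (\<forall>k<N. P k =
        transpose (A_bar A B S R k) ** P (k + 1) ** A_bar A B S R k
        - transpose (A_bar A B S R k) ** P (k + 1) ** B k ** matrix_inv (control_weight B R P k)
            ** transpose (B k) ** P (k + 1) ** A_bar A B S R k
        + Q_bar S Q R k)"

text \<open>Since \<^const>\<open>matrix_inv\<close> is total, the equation together with a terminal value is a backward
  recursion: a solution always exists and is determined on \<open>{0..N}\<close>. That the inverses occurring
  in it are genuine is a separate matter.\<close>

lemma riccati_solution_exists:
  "\<exists>P. riccati_solution N A B S Q R P \<and> P N = T"
proof -
  define step where "step k X =
        transpose (A_bar A B S R k) ** X ** A_bar A B S R k
        - transpose (A_bar A B S R k) ** X ** B k
            ** matrix_inv (R k + transpose (B k) ** X ** B k)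
            ** transpose (B k) ** X ** A_bar A B S R k
        + Q_bar S Q R k" for k X
  define W where "W = rec_nat T (\<lambda>j X. step (N - Suc j) X)"
  have W0: "W 0 = T" and WS: "W (Suc j) = step (N - Suc j) (W j)" for j
    by (simp_all add: W_def)
  have "W (N - k) = step k (W (N - (k + 1)))" if "k < N" for k
  proof -
    have "N - k = Suc (N - (k + 1))" and "N - Suc (N - (k + 1)) = k"
      using that by auto
    then show ?thesis
      using WS[of "N - (k + 1)"] by metis
  qed
  then have "riccati_solution N A B S Q R (\<lambda>k. W (N - k))"
    unfolding riccati_solution_def control_weight_def step_def by blast
  then show ?thesis
    using W0 by (intro exI[of _ "\<lambda>k. W (N - k)"]) simp
qed

definition terminal_value ::
  "nat \<Rightarrow> (nat \<Rightarrow> real^'n^'n) \<Rightarrow> (nat \<Rightarrow> real^'m^'n) \<Rightarrow> (nat \<Rightarrow> real^'m^'n) \<Rightarrow> (nat \<Rightarrow> real^'n^'n)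
    \<Rightarrow> (nat \<Rightarrow> real^'m^'m) \<Rightarrow> real^'n^'n \<Rightarrow> real^'n^'n \<Rightarrow> real \<Rightarrow> real^'n^'n" where
  "terminal_value N A B S Q R \<Sigma>0 \<Sigma>N \<epsilon> =
     (let p11 = phi11 N A B S Q R;
          p12 = phi12 N A B S Q R;
          H = psd_sqrt \<Sigma>N;
          Hi = matrix_inv H
      in - (matrix_inv p12 ** p11) + (\<epsilon> / 2) *\<^sub>R matrix_inv \<Sigma>N
         + Hi ** psd_sqrt ((\<epsilon>\<^sup>2 / 4) *\<^sub>R mat 1
               + H ** matrix_inv p12 ** \<Sigma>0 ** transpose (matrix_inv p12) ** H) ** Hi)"

text \<open>The unregularized terminal value, with no \<open>\<epsilon>\<close>-terms.\<close>

definition terminal_value0 ::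
  "nat \<Rightarrow> (nat \<Rightarrow> real^'n^'n) \<Rightarrow> (nat \<Rightarrow> real^'m^'n) \<Rightarrow> (nat \<Rightarrow> real^'m^'n) \<Rightarrow> (nat \<Rightarrow> real^'n^'n)
    \<Rightarrow> (nat \<Rightarrow> real^'m^'m) \<Rightarrow> real^'n^'n \<Rightarrow> real^'n^'n \<Rightarrow> real^'n^'n" where
  "terminal_value0 N A B S Q R \<Sigma>0 \<Sigma>N =
     (let p11 = phi11 N A B S Q R;
          p12 = phi12 N A B S Q R;
          H = psd_sqrt \<Sigma>N;
          Hi = matrix_inv H
      in - (matrix_inv p12 ** p11)
         + Hi ** psd_sqrt (H ** matrix_inv p12 ** \<Sigma>0 ** transpose (matrix_inv p12) ** H) ** Hi)"

text \<open>The control law associated with \<open>P\<close> is \<open>u = - gain P k *v x\<close>.\<close>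

definition gain ::
  "(nat \<Rightarrow> real^'n^'n) \<Rightarrow> (nat \<Rightarrow> real^'m^'n) \<Rightarrow> (nat \<Rightarrow> real^'m^'n) \<Rightarrow> (nat \<Rightarrow> real^'m^'m)
    \<Rightarrow> (nat \<Rightarrow> real^'n^'n) \<Rightarrow> nat \<Rightarrow> real^'n^'m" where
  "gain A B S R P k =
     matrix_inv (control_weight B R P k)
       ** (transpose (B k) ** P (k + 1) ** A k + transpose (S k))"

section \<open>Gaussian policies\<close>

definition gaussian_density :: "real^'d \<Rightarrow> real^'d^'d \<Rightarrow> real^'d \<Rightarrow> real" where
  "gaussian_density \<mu> \<Sigma> x =
     exp (- ((x - \<mu>) \<bullet> (matrix_inv \<Sigma> *v (x - \<mu>))) / 2) / sqrt ((2 * pi) ^ CARD('d) * det \<Sigma>)"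

definition density_mean :: "(real^'d \<Rightarrow> real) \<Rightarrow> real^'d" where
  "density_mean f = (LINT x|lborel. f x *\<^sub>R x)"

definition density_cov :: "(real^'d \<Rightarrow> real) \<Rightarrow> real^'d^'d" where
  "density_cov f =
     (\<chi> i j. LINT x|lborel. f x * ((x - density_mean f) $ i * (x - density_mean f) $ j))"

text \<open>The density in \<open>u\<close> of the control at time \<open>k\<close>, given the state \<open>x\<close>.\<close>

definition policy ::
  "(nat \<Rightarrow> real^'n^'n) \<Rightarrow> (nat \<Rightarrow> real^'m^'n) \<Rightarrow> (nat \<Rightarrow> real^'m^'n) \<Rightarrow> (nat \<Rightarrow> real^'m^'m)
    \<Rightarrow> (nat \<Rightarrow> real^'n^'n) \<Rightarrow> real \<Rightarrow> nat \<Rightarrow> real^'n \<Rightarrow> real^'m \<Rightarrow> real" where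
  "policy A B S R P \<epsilon> k x =
     gaussian_density (- (gain A B S R P k *v x)) (\<epsilon> *\<^sub>R matrix_inv (control_weight B R P k))"

section \<open>Unregularized density control problem\<close>

primrec state ::
  "(nat \<Rightarrow> real^'n^'n) \<Rightarrow> (nat \<Rightarrow> real^'m^'n) \<Rightarrow> ('w \<Rightarrow> real^'n) \<Rightarrow> (nat \<Rightarrow> 'w \<Rightarrow> real^'m)
    \<Rightarrow> nat \<Rightarrow> 'w \<Rightarrow> real^'n" where
  "state A B x0 u 0 = x0"
| "state A B x0 u (Suc k) = (\<lambda>\<omega>. A k *v state A B x0 u k \<omega> + B k *v u k \<omega>)"

text \<open>The \<open>\<sigma>\<close>-algebra on the sample space generated by the states \<open>x 0, \<dots>, x k\<close>.\<close>

definition state_sigma :: "'w measure \<Rightarrow> (nat \<Rightarrow> 'w \<Rightarrow> real^'n) \<Rightarrow> nat \<Rightarrow> 'w measure" where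
  "state_sigma \<Omega> x k = sigma (space \<Omega>) (\<Union>i\<le>k. {x i -` E \<inter> space \<Omega> | E. E \<in> sets borel})"

definition admissible ::
  "'w measure \<Rightarrow> nat \<Rightarrow> (nat \<Rightarrow> real^'n^'n) \<Rightarrow> (nat \<Rightarrow> real^'m^'n) \<Rightarrow> ('w \<Rightarrow> real^'n)
    \<Rightarrow> (nat \<Rightarrow> 'w \<Rightarrow> real^'m) \<Rightarrow> bool" where
  "admissible \<Omega> N A B x0 u \<longleftrightarrow>
     (\<forall>k<N. u k \<in> borel_measurable (state_sigma \<Omega> (state A B x0 u) k)
          \<and> integrable \<Omega> (\<lambda>\<omega>. (norm (u k \<omega>))\<^sup>2))"

text \<open>The constraint on the initial state is a property of \<open>x0\<close> alone and is not repeated here.\<close>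

definition feasible ::
  "'w measure \<Rightarrow> nat \<Rightarrow> (nat \<Rightarrow> real^'n^'n) \<Rightarrow> (nat \<Rightarrow> real^'m^'n) \<Rightarrow> real^'n^'n
    \<Rightarrow> ('w \<Rightarrow> real^'n) \<Rightarrow> (nat \<Rightarrow> 'w \<Rightarrow> real^'m) \<Rightarrow> bool" where
  "feasible \<Omega> N A B \<Sigma>N x0 u \<longleftrightarrow>
     admissible \<Omega> N A B x0 u
     \<and> distributed \<Omega> lborel (state A B x0 u N) (\<lambda>x. ennreal (gaussian_density 0 \<Sigma>N x))"

definition cost ::
  "'w measure \<Rightarrow> nat \<Rightarrow> (nat \<Rightarrow> real^'n^'n) \<Rightarrow> (nat \<Rightarrow> real^'m^'n) \<Rightarrow> (nat \<Rightarrow> real^'m^'n)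
    \<Rightarrow> (nat \<Rightarrow> real^'n^'n) \<Rightarrow> (nat \<Rightarrow> real^'m^'m) \<Rightarrow> ('w \<Rightarrow> real^'n) \<Rightarrow> (nat \<Rightarrow> 'w \<Rightarrow> real^'m)
    \<Rightarrow> real" where
  "cost \<Omega> N A B S Q R x0 u =
     (LINT \<omega>|\<Omega>. (\<Sum>k<N.
        (let z = block_vec (state A B x0 u k \<omega>) (u k \<omega>)
         in 1 / 2 * (z \<bullet> (block_mat (Q k) (S k) (transpose (S k)) (R k) *v z)))))"

definition optimal_control ::
  "'w measure \<Rightarrow> nat \<Rightarrow> (nat \<Rightarrow> real^'n^'n) \<Rightarrow> (nat \<Rightarrow> real^'m^'n) \<Rightarrow> (nat \<Rightarrow> real^'m^'n)
    \<Rightarrow> (nat \<Rightarrow> real^'n^'n) \<Rightarrow> (nat \<Rightarrow> real^'m^'m) \<Rightarrow> real^'n^'n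
    \<Rightarrow> ('w \<Rightarrow> real^'n) \<Rightarrow> (nat \<Rightarrow> 'w \<Rightarrow> real^'m) \<Rightarrow> bool" where
  "optimal_control \<Omega> N A B S Q R \<Sigma>N x0 u \<longleftrightarrow>
     feasible \<Omega> N A B \<Sigma>N x0 u
     \<and> (\<forall>v. feasible \<Omega> N A B \<Sigma>N x0 v \<longrightarrow> cost \<Omega> N A B S Q R x0 u \<le> cost \<Omega> N A B S Q R x0 v)"

end

theory Submission
  imports Defs
begin

text \<open>
Shifting the control to \<open>w = u + R\<^sup>-\<^sup>1 S\<^sup>T x\<close> turns the dynamics into \<open>x' = Ab x + B w\<close> and the stage
cost into half of \<open>x \<bullet> Qb x + w \<bullet> R w\<close>, where \<open>Ab\<close> and \<open>Qb\<close> are the barred matrices; the factor \<open>1/2\<close> is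
omitted from all costs below. The block matrices
\<^const>\<open>M_mat\<close> propagate the pairs of a state \<open>x\<close> and a costate \<open>l\<close> of this linear-quadratic
problem forward in time, so every such Hamiltonian trajectory satisfies
\<open>x 0 = \<phi>11 x N + \<phi>12 l N\<close> (\<open>hamiltonian_trajectory_initial\<close>). A trajectory from \<open>0\<close> to \<open>0\<close> has cost
\<open>0\<close>, hence input \<open>0\<close>, and reachability then forces its costate to vanish; this is the
invertibility of \<open>\<phi>12\<close> (\<open>phi12_invertible\<close>). With \<open>V = \<phi>12\<^sup>-\<^sup>1 \<phi>11\<close>, the trajectory ending in the pair
\<open>(z, - V z)\<close> starts in the origin, and \<open>z \<bullet> V z\<close> is the least cost of steering the origin to \<open>z\<close>.
Both terminal values have the form \<open>- V + Y\<close> with \<open>Y\<close> positive definite.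

\<^emph>\<open>Positive control weights.\<close> Started in the origin, the cost with terminal weight \<open>- V + Y\<close> is at
least \<open>x N \<bullet> Y x N\<close>, and it is positive for every nonzero input (\<open>cost_from_origin_pos\<close>). The
input that is \<open>0\<close> before time \<open>k\<close>, equal to \<open>v\<close> at time \<open>k\<close> and the Riccati feedback afterwards has
cost exactly \<open>v \<bullet> W v\<close>, where \<open>W\<close> is the control weight at time \<open>k\<close>. Backward induction on \<open>k\<close>
shows that all control weights are positive definite (\<open>riccati_control_weight_pos_def\<close>).

\<^emph>\<open>Optimality.\<close> For every control, the Riccati equation completes the square: the cost is a constant
determined by the laws of \<open>x 0\<close> and \<open>x N\<close>, which are prescribed, plus the expected weighted squared
deviations of \<open>u k\<close> from the feedback \<open>- gain x k\<close> (\<open>cost_decomposition\<close>). The feedback is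
therefore the unique optimum as soon as it is feasible. Along the closed loop
\<open>P k x k\<close> is a costate, so \<open>x 0 = \<phi>12 Y x N\<close>; the square root in the terminal value is chosen exactly
to make \<open>(\<phi>12 Y) \<Sigma>N (\<phi>12 Y)\<^sup>T = \<Sigma>0\<close>, so the closed loop maps the initial Gaussian to the terminal one
(\<open>closed_loop_transports\<close>, \<open>gaussian_linear_image\<close>).

\<^emph>\<open>The limit.\<close> The square root of \<open>c I + Z\<close> can be computed in one eigenbasis of \<open>Z\<close> for all \<open>c\<close>,
so the terminal value is continuous in \<open>\<epsilon>\<close>; since the control weights of the limit are invertible,
the convergence propagates backwards through the Riccati equation (\<open>riccati_tendsto\<close>). A Gaussian
density has the mean and covariance it is labelled with, which here are \<open>- gain x\<close> and \<open>\<epsilon> W\<^sup>-\<^sup>1\<close>.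

The analytic tools are the diagonalization of symmetric matrices, for the existence and uniqueness
of positive semidefinite square roots, and the behaviour of Lebesgue measure under linear maps,
for Gaussian densities.
\<close>

section \<open>Matrices, inverses and definiteness\<close>

lemma inner_matrix_vector_transpose:
  fixes A :: "real^'n^'m"
  shows "(A *v x) \<bullet> y = x \<bullet> (transpose A *v y)"
  by (simp add: dot_lmul_matrix[symmetric] inner_commute)

lemma matrix_vector_mult_minus_left: "(- A) *v x = - (A *v (x::real^'n))" for A :: "real^'n^'m"
  by (simp add: vec_eq_iff matrix_vector_mult_def sum_negf)

lemma matrix_vector_mult_minus_right: "A *v (- x) = - (A *v (x::real^'n))" for A :: "real^'n^'m"
  by (simp add: vec_eq_iff matrix_vector_mult_def sum_negf)

lemma transpose_add: "transpose (A + B) = transpose A + transpose B" for A :: "real^'n^'m"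
  by (simp add: transpose_def vec_eq_iff)

lemma transpose_minus: "transpose (A - B) = transpose A - transpose B" for A :: "real^'n^'m"
  by (simp add: transpose_def vec_eq_iff)

lemma transpose_uminus: "transpose (- A) = - transpose A" for A :: "real^'n^'m"
  by (simp add: transpose_def vec_eq_iff)

lemma matrix_mult_add_rdistrib: "(A + B) ** C = A ** C + B ** C" for A B :: "real^'n^'m"
  by (simp add: matrix_matrix_mult_def vec_eq_iff sum.distrib distrib_right)

lemma symmetric_matrix_iff:
  fixes X :: "real^'n^'n"
  shows "transpose X = X \<longleftrightarrow> (\<forall>x y. (X *v x) \<bullet> y = x \<bullet> (X *v y))"
proof
  assume r: "\<forall>x y. (X *v x) \<bullet> y = x \<bullet> (X *v y)"
  have "transpose X *v y = X *v y" for y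
    by (rule vector_eq_ldot[THEN iffD1]) (use r in \<open>simp add: inner_matrix_vector_transpose\<close>)
  then show "transpose X = X" by (simp add: matrix_eq)
qed (simp add: inner_matrix_vector_transpose)

lemma matrix_inv_inverse:
  fixes A :: "real^'n^'n"
  assumes "invertible A"
  shows "A ** matrix_inv A = mat 1" "matrix_inv A ** A = mat 1"
  using someI_ex[OF assms[unfolded invertible_def]] by (auto simp: matrix_inv_def)

lemma matrix_inv_mult_vec:
  fixes A :: "real^'n^'n"
  assumes "invertible A"
  shows "A *v (matrix_inv A *v x) = x" "matrix_inv A *v (A *v x) = x"
  using matrix_inv_inverse[OF assms] by (simp_all add: matrix_vector_mul_assoc)

lemma matrix_inv_unique:
  fixes A :: "real^'n^'n"
  assumes "A ** B = mat 1"
  shows "matrix_inv A = B"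
proof -
  have "invertible A" using assms invertible_right_inverse by blast
  then show ?thesis
    by (metis assms matrix_inv_inverse(2) matrix_mul_assoc matrix_mul_lid matrix_mul_rid)
qed

lemma invertible_matrix_inv: "invertible A \<Longrightarrow> invertible (matrix_inv A)" for A :: "real^'n^'n"
  using matrix_inv_inverse invertible_def by metis

lemma invertible_iff_ker:
  fixes A :: "real^'n^'n"
  shows "invertible A \<longleftrightarrow> (\<forall>x. A *v x = 0 \<longrightarrow> x = 0)"
  by (simp add: invertible_left_inverse matrix_left_invertible_ker)

lemma transpose_matrix_inv:
  fixes A :: "real^'n^'n"
  assumes "invertible A"
  shows "transpose (matrix_inv A) = matrix_inv (transpose A)"
  by (rule matrix_inv_unique[symmetric])
    (metis assms matrix_inv_inverse(2) matrix_transpose_mul transpose_mat)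

lemma pos_def_invertible: "pos_def X \<Longrightarrow> invertible X"
  unfolding pos_def_def invertible_iff_ker by (metis inner_zero_right less_irrefl)

lemma pos_def_imp_pos_semidef: "pos_def X \<Longrightarrow> pos_semidef X"
  unfolding pos_def_def pos_semidef_def
  by (metis inner_zero_left less_eq_real_def)

lemma pos_def_matrix_inv:
  assumes "pos_def X"
  shows "pos_def (matrix_inv X)"
  unfolding pos_def_def
proof (intro conjI allI impI)
  note inv = pos_def_invertible[OF assms]
  show "transpose (matrix_inv X) = matrix_inv X"
    using assms transpose_matrix_inv[OF inv] by (simp add: pos_def_def)
  fix x :: "real^'a" assume "x \<noteq> 0"
  define y where "y = matrix_inv X *v x"
  have x: "x = X *v y" by (simp add: y_def matrix_inv_mult_vec inv)
  then have "y \<noteq> 0" using \<open>x \<noteq> 0\<close> by auto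
  then show "0 < x \<bullet> (matrix_inv X *v x)"
    using assms by (simp add: x matrix_inv_mult_vec inv pos_def_def inner_commute)
qed

lemma pos_def_congruence:
  fixes X C :: "real^'n^'n"
  assumes "pos_def X" "invertible C"
  shows "pos_def (transpose C ** X ** C)"
  unfolding pos_def_def
proof (intro conjI allI impI)
  show "transpose (transpose C ** X ** C) = transpose C ** X ** C"
    using assms(1) by (simp add: pos_def_def matrix_transpose_mul matrix_mul_assoc)
  fix x :: "real^'n" assume "x \<noteq> 0"
  then have "C *v x \<noteq> 0" using assms(2) invertible_iff_ker by blast
  then have "0 < (C *v x) \<bullet> (X *v (C *v x))" using assms(1) by (simp add: pos_def_def)
  then show "0 < x \<bullet> ((transpose C ** X ** C) *v x)"
    by (simp add: inner_matrix_vector_transpose matrix_vector_mul_assoc matrix_mul_assoc)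
qed

lemma pos_semidef_congruence:
  fixes X :: "real^'n^'n" and C :: "real^'m^'n"
  assumes "pos_semidef X"
  shows "pos_semidef (transpose C ** X ** C)"
  unfolding pos_semidef_def
proof (intro conjI allI impI)
  show "transpose (transpose C ** X ** C) = transpose C ** X ** C"
    using assms(1) by (simp add: pos_semidef_def matrix_transpose_mul matrix_mul_assoc)
  fix x :: "real^'m"
  have "0 \<le> (C *v x) \<bullet> (X *v (C *v x))" using assms(1) by (simp add: pos_semidef_def)
  then show "0 \<le> x \<bullet> ((transpose C ** X ** C) *v x)"
    by (simp add: inner_matrix_vector_transpose matrix_vector_mul_assoc matrix_mul_assoc)
qed

lemma pos_def_add:
  assumes "pos_def X" "pos_semidef Y" shows "pos_def (X + Y)"
  using assms unfolding pos_def_def pos_semidef_def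
  by (auto simp: transpose_add matrix_vector_mult_add_rdistrib inner_add_right intro: add_pos_nonneg)

lemma pos_def_scaleR:
  assumes "pos_def X" "0 < c" shows "pos_def (c *\<^sub>R X)"
  using assms unfolding pos_def_def
  by (auto simp: transpose_scalar scaleR_matrix_vector_assoc[symmetric])

lemma pos_def_mat_1: "pos_def (mat 1 :: real^'n^'n)"
  by (simp add: pos_def_def transpose_mat)

section \<open>Diagonalization of symmetric matrices\<close>

lemma quadratic_nonneg_imp_linear_zero:
  fixes b c :: real
  assumes "\<And>t. 0 \<le> 2 * t * b + t\<^sup>2 * c"
  shows "b = 0"
proof (cases "c = 0")
  case True
  from assms[of 1] assms[of "-1"] True show ?thesis by simp
next
  case False
  have c: "0 \<le> c" using assms[of 1] assms[of "-1"] by simp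
  \<comment> \<open>the minimum of the quadratic is at \<open>t = - b / c\<close>\<close>
  have "0 \<le> 2 * (- b / c) * b + (- b / c)\<^sup>2 * c" by (rule assms)
  also have "\<dots> = - (b\<^sup>2 / c)" using False by (simp add: power2_eq_square field_simps)
  finally have "b\<^sup>2 / c \<le> 0" by simp
  moreover have "0 < c" using c False by simp
  ultimately show ?thesis by (simp add: divide_le_0_iff)
qed

text \<open>A maximizer of \<open>x \<bullet> X x\<close> on the unit sphere of the invariant subspace is an eigenvector.\<close>

lemma symmetric_eigenvector_in_subspace:
  fixes X :: "real^'n^'n"
  assumes sym: "transpose X = X" and S: "subspace S" "S \<noteq> {0}"
    and inv: "\<And>x. x \<in> S \<Longrightarrow> X *v x \<in> S"
  obtains v \<mu> where "v \<in> S" "norm v = 1" "X *v v = \<mu> *\<^sub>R v"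
proof -
  let ?K = "S \<inter> sphere 0 1"
  have symx: "x \<bullet> (X *v y) = y \<bullet> (X *v x)" for x y
    using sym by (metis inner_commute inner_matrix_vector_transpose)
  have c1: "compact ?K"
    by (intro closed_Int_compact closed_subspace S compact_sphere)
  have c2: "?K \<noteq> {}"
  proof -
    obtain s where "s \<in> S" "s \<noteq> 0" using S subspace_0 by fastforce
    then have "(1 / norm s) *\<^sub>R s \<in> ?K" using S by (simp add: subspace_mul)
    then show ?thesis by blast
  qed
  have c3: "continuous_on ?K (\<lambda>x. x \<bullet> (X *v x))"
    by (intro continuous_intros linear_continuous_on matrix_vector_mul_bounded_linear)
  obtain v where v: "v \<in> ?K" and max: "\<And>y. y \<in> ?K \<Longrightarrow> y \<bullet> (X *v y) \<le> v \<bullet> (X *v v)"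
    using continuous_attains_sup[OF c1 c2 c3] by blast
  define \<mu> where "\<mu> = v \<bullet> (X *v v)"
  have vv: "v \<bullet> v = 1" using v by (simp add: dot_square_norm)
  have bound: "w \<bullet> (X *v w) \<le> \<mu> * (w \<bullet> w)" if "w \<in> S" for w
  proof (cases "w = 0")
    case False
    then have "(1 / norm w) *\<^sub>R w \<in> ?K" using that S by (simp add: subspace_mul)
    from max[OF this] False show ?thesis
      by (simp add: \<mu>_def matrix_vector_mult_scaleR divide_simps dot_square_norm power2_eq_square)
  qed simp
  define w where "w = \<mu> *\<^sub>R v - X *v v"
  have wS: "w \<in> S" using v inv S by (simp add: w_def subspace_diff subspace_mul)
  \<comment> \<open>The form \<open>\<mu> \<bar>\<cdot>\<bar>\<^sup>2 - (\<cdot>) \<bullet> X (\<cdot>)\<close> is nonnegative on \<open>S\<close> and vanishes at \<open>v\<close>,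
      so its first variation at \<open>v\<close> vanishes in every direction of \<open>S\<close>.\<close>
  have "0 \<le> 2 * t * (w \<bullet> w) + t\<^sup>2 * (\<mu> * (w \<bullet> w) - w \<bullet> (X *v w))" for t
  proof -
    have "v + t *\<^sub>R w \<in> S" using v wS S by (simp add: subspace_add subspace_mul)
    note bnd = bound[OF this]
    have e1: "(v + t *\<^sub>R w) \<bullet> (v + t *\<^sub>R w) = 1 + 2 * t * (w \<bullet> v) + t\<^sup>2 * (w \<bullet> w)"
      by (simp add: inner_add_left inner_add_right vv power2_eq_square inner_commute[of v w] algebra_simps)
    have e2: "(v + t *\<^sub>R w) \<bullet> (X *v (v + t *\<^sub>R w))
        = \<mu> + 2 * t * (w \<bullet> (X *v v)) + t\<^sup>2 * (w \<bullet> (X *v w))"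
      using symx[of v w]
      by (simp add: inner_add_left inner_add_right matrix_vector_right_distrib
          matrix_vector_mult_scaleR \<mu>_def power2_eq_square algebra_simps)
    have "w \<bullet> w = \<mu> * (w \<bullet> v) - w \<bullet> (X *v v)"
      unfolding w_def by (simp add: inner_diff_right)
    then have e3: "2 * t * (w \<bullet> w) = 2 * t * (\<mu> * (w \<bullet> v)) - 2 * t * (w \<bullet> (X *v v))"
      by (simp only: right_diff_distrib)
    show ?thesis using bnd unfolding e1 e2 e3 by (simp add: algebra_simps)
  qed
  then have "w \<bullet> w = 0" by (rule quadratic_nonneg_imp_linear_zero)
  then have "X *v v = \<mu> *\<^sub>R v" by (simp add: w_def)
  then show thesis using that v by auto
qed

definition diag_mat :: "real^'n \<Rightarrow> real^'n^'n" where
  "diag_mat d = (\<chi> i j. if i = j then d $ i else 0)"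

lemma diag_mat_mult_vec: "diag_mat d *v x = (\<chi> i. d $ i * x $ i)"
  by (simp add: diag_mat_def matrix_vector_mult_def vec_eq_iff if_distrib[of "\<lambda>a. a * b" for b] cong: if_cong)

lemma diag_mat_mult: "diag_mat d ** diag_mat e = diag_mat (\<chi> i. d $ i * e $ i)"
  by (simp add: matrix_eq matrix_vector_mul_assoc[symmetric] diag_mat_mult_vec vec_eq_iff mult.assoc)

lemma transpose_diag_mat: "transpose (diag_mat d) = diag_mat d"
  by (simp add: diag_mat_def transpose_def vec_eq_iff)

lemma mult_axis_column: "A *v axis j 1 = column j (A::real^'n^'m)"
  by (simp add: matrix_vector_mult_basis)

text \<open>An orthonormal set of eigenvectors of maximal size spans the whole space: its orthogonal complement
is invariant under \<open>X\<close>, so a nonzero complement would contain one more eigenvector.\<close>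

lemma symmetric_diagonalization:
  fixes X :: "real^'n^'n"
  assumes sym: "transpose X = X"
  obtains U d where "orthogonal_matrix U" "X = U ** diag_mat d ** transpose U"
proof -
  define eig where "eig B \<longleftrightarrow> pairwise orthogonal B \<and> (\<forall>v\<in>B. norm v = 1 \<and> (\<exists>\<mu>. X *v v = \<mu> *\<^sub>R v))"
    for B :: "(real^'n) set"
  have indep: "independent B" if "eig B" for B
    using that unfolding eig_def
    by (intro pairwise_orthogonal_independent) auto
  have fin: "finite B \<and> card B \<le> CARD('n)" if "eig B" for B
    using independent_bound[OF indep[OF that]] by simp
  have "eig {}" by (simp add: eig_def)
  then obtain B where B: "eig B" and Bmax: "\<And>C. eig C \<Longrightarrow> card C \<le> card B"
    using ex_has_greatest_nat[of eig "{}" card "Suc CARD('n)"] fin by (auto simp: less_Suc_eq_le)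
  define S where "S = {x. \<forall>b\<in>B. b \<bullet> x = 0}"
  have S: "subspace S" unfolding S_def by (auto simp: subspace_def inner_add_right)
  have "S = {0}"
  proof (rule ccontr)
    assume ne: "S \<noteq> {0}"
    have "X *v x \<in> S" if "x \<in> S" for x
      unfolding S_def
    proof safe
      fix b assume b: "b \<in> B"
      then obtain \<mu> where "X *v b = \<mu> *\<^sub>R b" using B by (auto simp: eig_def)
      then have "b \<bullet> (X *v x) = \<mu> * (b \<bullet> x)"
        by (metis sym inner_matrix_vector_transpose inner_scaleR_left)
      then show "b \<bullet> (X *v x) = 0" using that b by (simp add: S_def)
    qed
    from symmetric_eigenvector_in_subspace[OF sym S ne this]
    obtain v \<mu> where v: "v \<in> S" "norm v = 1" "X *v v = \<mu> *\<^sub>R v" by blast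
    have "v \<notin> B" using v by (auto simp: S_def)
    moreover have "eig (insert v B)"
      using B v unfolding eig_def
      by (auto simp: pairwise_insert orthogonal_def S_def inner_commute)
    ultimately show False using Bmax[of "insert v B"] fin[OF B] by simp
  qed
  have "span B = UNIV"
  proof (rule ccontr)
    assume "span B \<noteq> UNIV"
    then have "span B \<subset> UNIV" by blast
    from orthogonal_to_subspace_exists_gen[of B UNIV] this
    obtain x where "x \<noteq> 0" "\<And>y. y \<in> span B \<Longrightarrow> orthogonal x y" by auto
    then have "x \<in> S" by (auto simp: S_def orthogonal_def inner_commute span_base)
    then show False using \<open>S = {0}\<close> \<open>x \<noteq> 0\<close> by simp
  qed
  then have "card B = CARD('n)"
    using indep[OF B] by (metis dim_UNIV dim_span_eq_card_independent DIM_cart DIM_real mult.right_neutral)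
  then obtain f where f: "bij_betw f (UNIV :: 'n set) B"
    using fin[OF B] finite_same_card_bij[of "UNIV::'n set" B] by auto
  have fB: "f j \<in> B" for j using f by (auto simp: bij_betw_def)
  then have "\<forall>j. \<exists>\<mu>. X *v f j = \<mu> *\<^sub>R f j" using B by (auto simp: eig_def)
  then obtain \<mu> where \<mu>: "\<And>j. X *v f j = \<mu> j *\<^sub>R f j" by metis
  define U where "U = (\<chi> i j. f j $ i)"
  have col: "column j U = f j" for j by (simp add: U_def column_def vec_eq_iff)
  have inner: "f i \<bullet> f j = (if i = j then 1 else 0)" for i j
  proof (cases "i = j")
    case True then show ?thesis using B fB by (auto simp: eig_def dot_square_norm)
  next
    case False
    then have "f i \<noteq> f j" using f by (auto simp: bij_betw_def inj_on_def)
    then show ?thesis using False B fB[of i] fB[of j] by (auto simp: eig_def pairwise_def orthogonal_def)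
  qed
  have UU: "transpose U ** U = mat 1"
    by (simp add: vec_eq_iff matrix_matrix_mult_def U_def transpose_def mat_def
        inner[unfolded inner_vec_def, simplified])
  then have ortho: "orthogonal_matrix U" by (simp add: orthogonal_matrix)
  have "X ** U = U ** diag_mat (\<chi> j. \<mu> j)"
  proof -
    have "(X ** U) $ i $ j = (U ** diag_mat (\<chi> j. \<mu> j)) $ i $ j" for i j
    proof -
      have "(X ** U) $ i $ j = (X *v f j) $ i"
        by (simp add: matrix_matrix_mult_def matrix_vector_mult_def U_def)
      also have "\<dots> = (U ** diag_mat (\<chi> j. \<mu> j)) $ i $ j"
        by (simp add: \<mu> matrix_matrix_mult_def diag_mat_def U_def if_distrib[of "\<lambda>a. b * a" for b] cong: if_cong)
      finally show ?thesis .
    qed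
    then show ?thesis by (simp add: vec_eq_iff)
  qed
  then have "X = U ** diag_mat (\<chi> j. \<mu> j) ** transpose U"
    using ortho by (metis matrix_mul_assoc matrix_mul_rid orthogonal_matrix_def)
  then show thesis using that ortho by blast
qed


section \<open>Positive semidefinite square roots\<close>

lemma pos_semidef_diag_mat: "(\<And>i. 0 \<le> d $ i) \<Longrightarrow> pos_semidef (diag_mat d)"
  by (auto simp: pos_semidef_def transpose_diag_mat diag_mat_mult_vec inner_vec_def
      mult.left_commute[of _ "d $ _"] intro!: sum_nonneg)

lemma orthogonal_conj_mult:
  fixes U :: "real^'n^'n"
  assumes "orthogonal_matrix U"
  shows "(U ** X ** transpose U) ** (U ** Y ** transpose U) = U ** (X ** Y) ** transpose U"
proof -
  have "transpose U ** U = mat 1" using assms by (simp add: orthogonal_matrix_def)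
  then have "U ** X ** (transpose U ** U) ** Y ** transpose U = U ** (X ** Y) ** transpose U"
    by (simp add: matrix_mul_assoc)
  then show ?thesis by (simp only: matrix_mul_assoc)
qed

lemma pos_semidef_diagonalization:
  fixes X :: "real^'n^'n"
  assumes "pos_semidef X"
  obtains U d where "orthogonal_matrix U" "\<And>i. 0 \<le> d $ i" "X = U ** diag_mat d ** transpose U"
proof -
  obtain U d where U: "orthogonal_matrix U" and X: "X = U ** diag_mat d ** transpose U"
    using symmetric_diagonalization assms by (metis pos_semidef_def)
  have UU: "transpose U ** U = mat 1" using U by (simp add: orthogonal_matrix_def)
  have "transpose U ** X ** U = (transpose U ** U) ** diag_mat d ** (transpose U ** U)"
    unfolding X by (simp only: matrix_mul_assoc)
  then have "pos_semidef (diag_mat d)"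
    using pos_semidef_congruence[OF assms, of U] by (simp add: UU)
  then have "0 \<le> axis i 1 \<bullet> (diag_mat d *v axis i 1)" for i
    by (simp add: pos_semidef_def)
  then have "0 \<le> d $ i" for i
    unfolding inner_axis' by (simp add: diag_mat_mult_vec)
  then show thesis using that U X by blast
qed

text \<open>A positive semidefinite root \<open>Y\<close> has no choice on an eigenvector \<open>u\<close> of \<open>Y\<^sup>2\<close> with eigenvalue
\<open>s\<^sup>2\<close>, \<open>s \<ge> 0\<close>: it must multiply \<open>u\<close> by \<open>s\<close>.\<close>

lemma pos_semidef_root_unique:
  fixes Y :: "real^'n^'n"
  assumes U: "orthogonal_matrix U" and d: "\<And>i. 0 \<le> d $ i"
    and Y: "pos_semidef Y" and YY: "Y ** Y = U ** diag_mat d ** transpose U"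
  shows "Y = U ** diag_mat (\<chi> i. sqrt (d $ i)) ** transpose U"
proof -
  let ?s = "\<chi> i. sqrt (d $ i)"
  have UU: "transpose U ** U = mat 1" using U by (simp add: orthogonal_matrix_def)
  have YYU: "Y ** Y ** U = U ** diag_mat d"
    unfolding YY using UU by (metis matrix_mul_assoc matrix_mul_rid)
  have "Y *v (U *v axis j 1) = sqrt (d $ j) *\<^sub>R (U *v axis j 1)" for j
  proof -
    define u where "u = U *v axis j 1"
    define s where "s = sqrt (d $ j)"
    define w where "w = Y *v u - s *\<^sub>R u"
    have "Y *v (Y *v u) = (Y ** Y ** U) *v axis j 1"
      by (simp add: u_def matrix_vector_mul_assoc matrix_mul_assoc)
    also have "\<dots> = U *v (diag_mat d *v axis j 1)"
      by (simp only: YYU matrix_vector_mul_assoc)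
    also have "diag_mat d *v axis j 1 = (s * s) *\<^sub>R axis j 1"
      using d[of j] by (simp add: diag_mat_mult_vec s_def vec_eq_iff axis_def)
    finally have YYu: "Y *v (Y *v u) = (s * s) *\<^sub>R u"
      by (simp add: matrix_vector_mult_scaleR u_def)
    have s: "0 \<le> s" using d by (simp add: s_def)
    \<comment> \<open>\<open>(Y + s)(Y - s) u = 0\<close>, and \<open>Y + s\<close> is injective if \<open>s > 0\<close>.\<close>
    have Yw: "Y *v w = - s *\<^sub>R w"
      by (simp add: w_def matrix_vector_mult_diff_distrib matrix_vector_mult_scaleR YYu algebra_simps)
    have "0 \<le> w \<bullet> (Y *v w)" using Y by (simp add: pos_semidef_def)
    then have "s * (w \<bullet> w) \<le> 0" by (simp add: Yw)
    then have "s = 0 \<or> w \<bullet> w = 0"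
      using s by (metis inner_ge_zero mult_nonneg_nonneg mult_eq_0_iff order_antisym)
    moreover have "w \<bullet> w = 0" if "s = 0"
    proof -
      have "w = Y *v u" "Y *v w = 0" using that Yw by (simp_all add: w_def)
      then have "w \<bullet> w = u \<bullet> (Y *v w)"
        using Y by (metis inner_matrix_vector_transpose pos_semidef_def)
      then show ?thesis using \<open>Y *v w = 0\<close> by simp
    qed
    ultimately have "w = 0" by auto
    then show ?thesis by (simp add: w_def u_def s_def)
  qed
  then have "(Y ** U) *v axis j 1 = (U ** diag_mat ?s) *v axis j 1" for j
  proof -
    assume "\<And>j. Y *v (U *v axis j 1) = sqrt (d $ j) *\<^sub>R (U *v axis j 1)"
    then have "(Y ** U) *v axis j 1 = U *v (sqrt (d $ j) *\<^sub>R axis j 1)"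
      by (simp add: matrix_vector_mul_assoc[symmetric] matrix_vector_mult_scaleR)
    also have "sqrt (d $ j) *\<^sub>R axis j 1 = diag_mat ?s *v axis j 1"
      by (simp add: diag_mat_mult_vec vec_eq_iff axis_def)
    finally show ?thesis by (simp add: matrix_vector_mul_assoc)
  qed
  then have "Y ** U = U ** diag_mat ?s"
    by (simp add: mult_axis_column column_def vec_eq_iff)
  then show ?thesis
    by (metis U matrix_mul_assoc matrix_mul_rid orthogonal_matrix_def)
qed

lemma psd_sqrt_diagonalization:
  fixes U :: "real^'n^'n"
  assumes U: "orthogonal_matrix U" and d: "\<And>i. 0 \<le> d $ i"
  shows "psd_sqrt (U ** diag_mat d ** transpose U) = U ** diag_mat (\<chi> i. sqrt (d $ i)) ** transpose U"
  unfolding psd_sqrt_def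
proof (rule the_equality)
  have "pos_semidef (U ** diag_mat (\<chi> i. sqrt (d $ i)) ** transpose U)"
    using pos_semidef_congruence[of "diag_mat (\<chi> i. sqrt (d $ i))" "transpose U"] d
    by (simp add: pos_semidef_diag_mat)
  then show "pos_semidef (U ** diag_mat (\<chi> i. sqrt (d $ i)) ** transpose U) \<and>
      U ** diag_mat (\<chi> i. sqrt (d $ i)) ** transpose U ** (U ** diag_mat (\<chi> i. sqrt (d $ i)) ** transpose U)
      = U ** diag_mat d ** transpose U"
    using d by (simp add: orthogonal_conj_mult[OF U] diag_mat_mult)
qed (use pos_semidef_root_unique[OF U d] in blast)

lemma
  fixes X :: "real^'n^'n"
  assumes "pos_semidef X"
  shows pos_semidef_psd_sqrt: "pos_semidef (psd_sqrt X)"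
    and psd_sqrt_square: "psd_sqrt X ** psd_sqrt X = X"
proof -
  obtain U d where U: "orthogonal_matrix U" and d: "\<And>i. 0 \<le> d $ i"
    and X: "X = U ** diag_mat d ** transpose U"
    using pos_semidef_diagonalization[OF assms] by blast
  let ?s = "\<chi> i. sqrt (d $ i)"
  have r: "psd_sqrt X = U ** diag_mat ?s ** transpose U"
    unfolding X by (rule psd_sqrt_diagonalization[OF U d])
  show "pos_semidef (psd_sqrt X)"
    unfolding r using pos_semidef_congruence[of "diag_mat ?s" "transpose U"] d
    by (simp add: pos_semidef_diag_mat)
  show "psd_sqrt X ** psd_sqrt X = X"
    unfolding r orthogonal_conj_mult[OF U] diag_mat_mult by (simp add: X d)
qed

text \<open>With \<open>Y\<close> the square root of \<open>X\<close>, \<open>x \<bullet> X x\<close> is the squared norm of \<open>Y x\<close>, and \<open>Y x = 0\<close> implies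
\<open>X x = 0\<close>.\<close>

lemma pos_semidef_invertible_imp_pos_def:
  fixes X :: "real^'n^'n"
  assumes X: "pos_semidef X" "invertible X"
  shows "pos_def X"
proof -
  let ?Y = "psd_sqrt X"
  have sq: "X *v x = ?Y *v (?Y *v x)" for x
    by (simp add: matrix_vector_mul_assoc psd_sqrt_square[OF X(1)])
  have "x \<bullet> (X *v x) = (?Y *v x) \<bullet> (?Y *v x)" for x
    using pos_semidef_psd_sqrt[OF X(1)] unfolding sq
    by (metis inner_matrix_vector_transpose pos_semidef_def)
  moreover have "?Y *v x \<noteq> 0" if "x \<noteq> 0" for x
    using that X(2) sq by (metis invertible_iff_ker matrix_vector_mult_0_right)
  ultimately show ?thesis using X(1) by (auto simp: pos_def_def pos_semidef_def)
qed

lemma pos_def_psd_sqrt: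
  fixes X :: "real^'n^'n"
  assumes "pos_def X"
  shows "pos_def (psd_sqrt X)"
proof (rule pos_semidef_invertible_imp_pos_def)
  note sd = pos_def_imp_pos_semidef[OF assms]
  show "pos_semidef (psd_sqrt X)" by (rule pos_semidef_psd_sqrt[OF sd])
  have "psd_sqrt X ** (psd_sqrt X ** matrix_inv X) = mat 1"
    by (simp add: matrix_mul_assoc psd_sqrt_square[OF sd] matrix_inv_inverse pos_def_invertible assms)
  then show "invertible (psd_sqrt X)" using invertible_right_inverse by blast
qed

section \<open>Continuity of matrix operations\<close>

lemma tendsto_matrix_mult:
  fixes F :: "'a \<Rightarrow> real^'n^'m" and G :: "'a \<Rightarrow> real^'k^'n"
  assumes "(F \<longlongrightarrow> A) net" "(G \<longlongrightarrow> B) net"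
  shows "((\<lambda>t. F t ** G t) \<longlongrightarrow> A ** B) net"
  unfolding matrix_matrix_mult_def
  by (intro vec_tendstoI) (auto intro!: tendsto_sum tendsto_mult tendsto_vec_nth assms)

lemma tendsto_det:
  fixes F :: "'a \<Rightarrow> real^'n^'n"
  assumes "(F \<longlongrightarrow> A) net"
  shows "((\<lambda>t. det (F t)) \<longlongrightarrow> det A) net"
  unfolding det_def by (intro tendsto_sum tendsto_mult tendsto_prod tendsto_vec_nth assms tendsto_const)

text \<open>This form of the inverse makes its continuity a consequence of that of the determinant.\<close>

lemma matrix_inv_cramer:
  fixes A :: "real^'n^'n"
  assumes "invertible A"
  shows "matrix_inv A $ k $ l = det (\<chi> i j. if j = k then axis l 1 $ i else A $ i $ j) / det A"
proof -
  have "det A \<noteq> 0" using assms invertible_det_nz by blast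
  moreover have "A *v (matrix_inv A *v axis l 1) = axis l 1"
    using assms by (simp add: matrix_inv_mult_vec)
  ultimately have "matrix_inv A *v axis l 1
      = (\<chi> k. det (\<chi> i j. if j = k then axis l 1 $ i else A $ i $ j) / det A)"
    by (rule cramer[THEN iffD1])
  then show ?thesis by (simp add: mult_axis_column column_def vec_eq_iff)
qed

lemma tendsto_matrix_inv:
  fixes F :: "'a \<Rightarrow> real^'n^'n"
  assumes F: "(F \<longlongrightarrow> A) net" and A: "invertible A" and inv: "\<forall>\<^sub>F t in net. invertible (F t)"
  shows "((\<lambda>t. matrix_inv (F t)) \<longlongrightarrow> matrix_inv A) net"
proof (intro vec_tendstoI)
  fix k l
  let ?C = "\<lambda>X :: real^'n^'n. (\<chi> i j. if j = k then axis l 1 $ i else X $ i $ j) :: real^'n^'n"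
  have "((\<lambda>t. ?C (F t)) \<longlongrightarrow> ?C A) net"
    by (intro vec_tendstoI) (auto intro!: tendsto_vec_nth F)
  then have "((\<lambda>t. det (?C (F t)) / det (F t)) \<longlongrightarrow> det (?C A) / det A) net"
    using A by (intro tendsto_divide tendsto_det F) (auto simp: invertible_det_nz)
  then have "((\<lambda>t. det (?C (F t)) / det (F t)) \<longlongrightarrow> matrix_inv A $ k $ l) net"
    by (simp add: matrix_inv_cramer[OF A])
  moreover have "\<forall>\<^sub>F t in net. det (?C (F t)) / det (F t) = matrix_inv (F t) $ k $ l"
    using inv by eventually_elim (simp add: matrix_inv_cramer)
  ultimately show "((\<lambda>t. matrix_inv (F t) $ k $ l) \<longlongrightarrow> matrix_inv A $ k $ l) net"
    by (rule Lim_transform_eventually)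
qed

text \<open>Adding a multiple of the identity shifts the eigenvalues and keeps the eigenvectors, so the roots
along the limit are all diagonal in the same basis and only continuity of the real square root is
needed.\<close>

lemma psd_sqrt_shift_continuous:
  fixes X :: "real^'n^'n"
  assumes X: "pos_semidef X" and c: "(c \<longlongrightarrow> 0) net" and c0: "\<And>t. 0 \<le> c t"
  shows "((\<lambda>t. psd_sqrt (c t *\<^sub>R mat 1 + X)) \<longlongrightarrow> psd_sqrt X) net"
proof -
  obtain U d where U: "orthogonal_matrix U" and d: "\<And>i. 0 \<le> d $ i"
    and XU: "X = U ** diag_mat d ** transpose U"
    using pos_semidef_diagonalization[OF X] by blast
  have UU: "U ** transpose U = mat 1" using U by (simp add: orthogonal_matrix_def)
  have "c t *\<^sub>R mat 1 + X = U ** diag_mat (\<chi> i. c t + d $ i) ** transpose U" for t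
  proof -
    have "diag_mat (\<chi> i. c t + d $ i) = c t *\<^sub>R mat 1 + diag_mat d"
      by (simp add: diag_mat_def mat_def vec_eq_iff)
    then show ?thesis
      by (simp add: XU matrix_add_ldistrib matrix_mult_add_rdistrib UU scalar_matrix_assoc[symmetric]
          matrix_scalar_ac)
  qed
  then have "psd_sqrt (c t *\<^sub>R mat 1 + X) = U ** diag_mat (\<chi> i. sqrt (c t + d $ i)) ** transpose U" for t
    using psd_sqrt_diagonalization[OF U, of "\<chi> i. c t + d $ i"] c0[of t] d by simp
  moreover have "((\<lambda>t. diag_mat (\<chi> i. sqrt (c t + d $ i))) \<longlongrightarrow> diag_mat (\<chi> i. sqrt (0 + d $ i))) net"
    unfolding diag_mat_def by (intro vec_tendstoI) (auto intro!: tendsto_real_sqrt tendsto_add[OF c tendsto_const, simplified])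
  ultimately show ?thesis
    using psd_sqrt_diagonalization[OF U d]
    by (auto simp: XU intro!: tendsto_matrix_mult tendsto_const)
qed

section \<open>Lebesgue measure under linear maps\<close>

lemma Basis_cart: "(Basis :: (real^'n) set) = range (\<lambda>i. axis i 1)"
  by (auto simp: Basis_vec_def)

lemma inj_axis: "inj (\<lambda>i. axis i (1::real))"
  by (auto simp: inj_def axis_eq_axis)

lemma axis_nth: "axis i 1 $ j = (if i = j then 1 else 0 :: real)"
  by (simp add: axis_def)

lemma sum_Basis_cart: "(\<Sum>b\<in>(Basis :: (real^'n) set). h b) = (\<Sum>i\<in>UNIV. h (axis i 1))"
  by (simp add: Basis_cart sum.reindex[OF inj_axis])

lemma prod_Basis_cart: "(\<Prod>b\<in>(Basis :: (real^'n) set). h b) = (\<Prod>i\<in>UNIV. h (axis i 1))"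
  by (simp add: Basis_cart prod.reindex[OF inj_axis])

lemma matrix_vector_mult_measurable [measurable]:
  "(*v) A \<in> borel_measurable borel" for A :: "real^'n^'m"
  by (intro borel_measurable_continuous_onI linear_continuous_on matrix_vector_mul_bounded_linear)

lemma nn_integral_lborel_diagonal:
  fixes A :: "real^'n^'n"
  assumes A: "\<And>i j. i \<noteq> j \<Longrightarrow> A $ i $ j = 0" "det A \<noteq> 0" and [measurable]: "f \<in> borel_measurable borel"
  shows "(\<integral>\<^sup>+x. f x \<partial>lborel) = ennreal \<bar>det A\<bar> * (\<integral>\<^sup>+x. f (A *v x) \<partial>lborel)"
proof -
  have det: "det A = (\<Prod>i\<in>UNIV. A $ i $ i)" by (rule det_diagonal) (rule A)
  define c where "c j = (A *v j) \<bullet> j" for j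
  have c: "c (axis i 1) = A $ i $ i" for i
    by (simp add: c_def inner_axis matrix_vector_mult_basis column_def)
  have T: "0 + (\<Sum>j\<in>Basis. (c j * (x \<bullet> j)) *\<^sub>R j) = A *v x" for x
  proof -
    have "(A *v x) $ i = A $ i $ i * x $ i" for i
    proof -
      have "(A *v x) $ i = (\<Sum>j\<in>UNIV. if j = i then A $ i $ i * x $ i else 0)"
        unfolding matrix_vector_mult_def vec_lambda_beta by (rule sum.cong) (use A(1) in auto)
      then show ?thesis by simp
    qed
    then show ?thesis
      unfolding sum_Basis_cart c inner_axis
      by (simp add: vec_eq_iff axis_nth if_distrib[of "\<lambda>a. b * a" for b] cong: if_cong)
  qed
  have "lborel = density (distr lborel borel (\<lambda>x. 0 + (\<Sum>j\<in>Basis. (c j * (x \<bullet> j)) *\<^sub>R j))) (\<lambda>_. \<Prod>j\<in>Basis. \<bar>c j\<bar>)"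
    by (rule lborel_affine_euclidean) (use A(2) in \<open>auto simp: Basis_cart c det\<close>)
  also have "(\<Prod>j\<in>Basis. \<bar>c j\<bar>) = \<bar>det A\<bar>"
    by (simp add: prod_Basis_cart c det abs_prod)
  finally have *: "lborel = density (distr lborel borel ((*v) A)) (\<lambda>_. ennreal \<bar>det A\<bar>)"
    by (simp only: T)
  show ?thesis
    by (subst *) (simp add: nn_integral_density nn_integral_distr nn_integral_cmult)
qed

text \<open>The preimage of a box under the exchange of two coordinates is the box with exchanged sides.\<close>

lemma nn_integral_lborel_swap:
  fixes m n :: "'n::finite"
  defines "A \<equiv> (\<chi> i j. mat 1 $ i $ Transposition.transpose m n j) :: real^'n^'n"
  assumes mn: "m \<noteq> n" and [measurable]: "f \<in> borel_measurable borel"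
  shows "(\<integral>\<^sup>+x. f x \<partial>lborel) = ennreal \<bar>det A\<bar> * (\<integral>\<^sup>+x. f (A *v x) \<partial>lborel)"
proof -
  let ?\<tau> = "Transposition.transpose m n"
  have \<tau>: "?\<tau> permutes UNIV" by (rule permutes_swap_id) auto
  have det: "\<bar>det A\<bar> = 1"
    using mn by (simp add: A_def det_permute_columns[OF \<tau>] sign_swap_id)
  have Av: "(A *v x) $ i = x $ ?\<tau> i" for x i
  proof -
    have "(A *v x) $ i = (\<Sum>j\<in>UNIV. if j = ?\<tau> i then x $ j else 0)"
      unfolding matrix_vector_mult_def A_def mat_def vec_lambda_beta
      by (rule sum.cong) (auto simp: transpose_eq_iff)
    then show ?thesis by simp
  qed
  have "lborel = distr lborel borel ((*v) A)"
  proof (rule lborel_eqI)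
    fix l u :: "real^'n" assume le: "\<And>b. b \<in> Basis \<Longrightarrow> l \<bullet> b \<le> u \<bullet> b"
    have "(*v) A -` box l u = box (A *v l) (A *v u)"
      by (auto simp: mem_box_cart Av) (metis transpose_involutory)+
    moreover have "(A *v l) $ i \<le> (A *v u) $ i" for i
      using le[of "axis (?\<tau> i) 1"] by (simp add: Av inner_axis Basis_cart)
    then have "emeasure lborel (box (A *v l) (A *v u)) = ennreal (\<Prod>b\<in>Basis. (A *v u - A *v l) \<bullet> b)"
      by (intro emeasure_lborel_box) (auto simp: Basis_cart inner_axis)
    ultimately have "emeasure (distr lborel borel ((*v) A)) (box l u)
        = ennreal (\<Prod>b\<in>Basis. (A *v u - A *v l) \<bullet> b)"
      by (subst emeasure_distr) auto
    also have "(\<Prod>b\<in>Basis. (A *v u - A *v l) \<bullet> b) = (\<Prod>i\<in>UNIV. (u - l) $ ?\<tau> i)"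
      by (simp add: prod_Basis_cart inner_axis Av)
    also have "\<dots> = (\<Prod>b\<in>Basis. (u - l) \<bullet> b)"
      using prod.permute[OF \<tau>, of "\<lambda>i. (u - l) $ i"] by (simp add: prod_Basis_cart inner_axis o_def)
    finally show "emeasure (distr lborel borel ((*v) A)) (box l u) = (\<Prod>b\<in>Basis. (u - l) \<bullet> b)" .
  qed simp
  then have "(\<integral>\<^sup>+x. f x \<partial>lborel) = (\<integral>\<^sup>+x. f x \<partial>distr lborel borel ((*v) A))" by simp
  then show ?thesis by (simp add: nn_integral_distr det)
qed

text \<open>Integrating first over the coordinate that the shear changes, the shear is a translation of that
coordinate by an amount depending on the others only (Fubini).\<close>

lemma nn_integral_lborel_shear:
  fixes m n :: "'n::finite" and c :: real
  defines "A \<equiv> (\<chi> i j. if i = m \<and> j = n then c else of_bool (i = j)) :: real^'n^'n"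
  assumes mn: "m \<noteq> n" and [measurable]: "f \<in> borel_measurable borel"
  shows "(\<integral>\<^sup>+x. f x \<partial>lborel) = ennreal \<bar>det A\<bar> * (\<integral>\<^sup>+x. f (A *v x) \<partial>lborel)"
proof -
  have "A = (\<chi> k. if k = m then row m (mat 1) + c *s row n (mat 1) else row k (mat 1))"
    using mn by (auto simp: A_def vec_eq_iff row_def mat_def)
  then have det: "det A = 1" using mn by (simp add: det_row_operation)
  let ?e = "\<lambda>i. axis i 1 :: real^'n"
  let ?I = "Basis - {?e m}"
  let ?T = "\<lambda>g. \<Sum>b\<in>Basis. g b *\<^sub>R (b :: real^'n)"
  interpret product_sigma_finite "\<lambda>b::real^'n. lborel :: real measure" ..
  have B: "Basis = insert (?e m) ?I" by (auto simp: Basis_cart)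
  have I: "finite ?I" "?e m \<notin> ?I" "?e n \<in> ?I" using mn by (auto simp: Basis_cart axis_eq_axis)
  have Tm [measurable]: "?T \<in> borel_measurable (Pi\<^sub>M Basis (\<lambda>b. lborel))"
    by measurable
  have Av: "A *v x = x + (c * x $ n) *\<^sub>R ?e m" for x
  proof -
    have "(A *v x) $ i = (\<Sum>j\<in>UNIV. (if j = i then x $ i else 0) + (if j = n then (if i = m then c * x $ n else 0) else 0))" for i
      unfolding matrix_vector_mult_def A_def using mn by (auto intro!: sum.cong)
    then show ?thesis by (simp add: vec_eq_iff sum.distrib axis_def)
  qed
  have Tn: "?T g $ i = g (?e i)" for g i
    by (simp add: sum_Basis_cart axis_def if_distrib[of "\<lambda>a. b * a" for b] cong: if_cong)
  have AT: "A *v ?T (g(?e m := y)) = ?T (g(?e m := y + c * g (?e n)))" for g y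
    unfolding Av vec_eq_iff vector_add_component vector_scaleR_component Tn
    using mn by (auto simp: axis_eq_axis) (auto simp: axis_def)
  have F: "(\<integral>\<^sup>+x. h x \<partial>lborel) = (\<integral>\<^sup>+g. (\<integral>\<^sup>+y. h (?T (g(?e m := y))) \<partial>lborel) \<partial>Pi\<^sub>M ?I (\<lambda>b. lborel))"
    if [measurable]: "h \<in> borel_measurable borel" for h :: "real^'n \<Rightarrow> ennreal"
  proof -
    have "(\<integral>\<^sup>+x. h x \<partial>lborel) = (\<integral>\<^sup>+g. h (?T g) \<partial>Pi\<^sub>M Basis (\<lambda>b. lborel))"
      by (subst lborel_eq) (simp add: nn_integral_distr)
    also have "\<dots> = (\<integral>\<^sup>+g. h (?T g) \<partial>Pi\<^sub>M (insert (?e m) ?I) (\<lambda>b. lborel))"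
      using B by simp
    also have "\<dots> = (\<integral>\<^sup>+g. (\<integral>\<^sup>+y. h (?T (g(?e m := y))) \<partial>lborel) \<partial>Pi\<^sub>M ?I (\<lambda>b. lborel))"
    proof (rule product_nn_integral_insert)
      show "(\<lambda>g. h (?T g)) \<in> borel_measurable (Pi\<^sub>M (insert (?e m) ?I) (\<lambda>b. lborel))"
        unfolding B[symmetric] by measurable
    qed (use I in auto)
    finally show ?thesis .
  qed
  have "(\<integral>\<^sup>+x. f (A *v x) \<partial>lborel)
      = (\<integral>\<^sup>+g. (\<integral>\<^sup>+y. f (?T (g(?e m := y + c * g (?e n)))) \<partial>lborel) \<partial>Pi\<^sub>M ?I (\<lambda>b. lborel))"
    by (subst F) (simp_all only: AT, measurable)
  also have "\<dots> = (\<integral>\<^sup>+g. (\<integral>\<^sup>+y. f (?T (g(?e m := y))) \<partial>lborel) \<partial>Pi\<^sub>M ?I (\<lambda>b. lborel))"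
  proof (rule nn_integral_cong)
    fix g
    have "(\<lambda>y. f (?T (g(?e m := y)))) \<in> borel_measurable borel"
      by (auto intro!: measurable_compose[OF _ \<open>f \<in> borel_measurable borel\<close>] borel_measurable_sum
          borel_measurable_scaleR simp: fun_upd_def)
    from nn_integral_real_affine[OF this, of 1 "c * g (?e n)"]
    show "(\<integral>\<^sup>+y. f (?T (g(?e m := y + c * g (?e n)))) \<partial>lborel) = (\<integral>\<^sup>+y. f (?T (g(?e m := y))) \<partial>lborel)"
      by (simp add: add.commute)
  qed
  also have "\<dots> = (\<integral>\<^sup>+x. f x \<partial>lborel)" by (rule F[symmetric]) fact
  finally show ?thesis by (simp add: det)
qed

text \<open>The scaling factors of two maps multiply under composition, as determinants do, so elementary
matrices suffice; the singular ones among them, with a zero row, are excluded by \<open>det A \<noteq> 0\<close>.\<close>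

lemma nn_integral_lborel_linear:
  fixes A :: "real^'n^'n"
  assumes "det A \<noteq> 0" "f \<in> borel_measurable borel"
  shows "(\<integral>\<^sup>+x. f x \<partial>lborel) = ennreal \<bar>det A\<bar> * (\<integral>\<^sup>+x. f (A *v x) \<partial>lborel)"
proof -
  have "det A \<noteq> 0 \<longrightarrow> (\<forall>f\<in>borel_measurable borel.
      (\<integral>\<^sup>+x. f x \<partial>lborel) = ennreal \<bar>det A\<bar> * (\<integral>\<^sup>+x. f (A *v x) \<partial>lborel))"
  proof (rule induct_matrix_elementary[of _ A], goal_cases)
    case (1 A B)
    show ?case
    proof (intro impI ballI)
      assume "det (A ** B) \<noteq> 0"
      then have A: "det A \<noteq> 0" and B: "det B \<noteq> 0" by (auto simp: det_mul)
      fix f :: "real^'n \<Rightarrow> ennreal" assume [measurable]: "f \<in> borel_measurable borel"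
      have m: "(\<lambda>x. f (A *v x)) \<in> borel_measurable borel" by measurable
      show "(\<integral>\<^sup>+x. f x \<partial>lborel) = ennreal \<bar>det (A ** B)\<bar> * (\<integral>\<^sup>+x. f ((A ** B) *v x) \<partial>lborel)"
        using 1(1)[rule_format, OF A, of f] 1(2)[rule_format, OF B m]
        by (simp add: det_mul abs_mult ennreal_mult mult.assoc matrix_vector_mul_assoc)
    qed
  next
    case (2 A i)
    then show ?case by (simp add: det_zero_row)
  next
    case (3 A)
    then show ?case by (auto intro: nn_integral_lborel_diagonal)
  next
    case (4 m n)
    then show ?case by (auto intro: nn_integral_lborel_swap)
  next
    case (5 m n c)
    then show ?case by (auto intro: nn_integral_lborel_shear)
  qed
  then show ?thesis using assms by blast
qed

lemma lborel_linear:
  fixes A :: "real^'n^'n"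
  assumes "det A \<noteq> 0"
  shows "lborel = density (distr lborel borel ((*v) A)) (\<lambda>_. ennreal \<bar>det A\<bar>)"
proof (rule measure_eqI)
  fix X :: "(real^'n) set" assume "X \<in> sets lborel"
  then have [measurable]: "X \<in> sets borel" by simp
  have "emeasure lborel X = (\<integral>\<^sup>+x. indicator X x \<partial>lborel)" by simp
  also have "\<dots> = ennreal \<bar>det A\<bar> * (\<integral>\<^sup>+x. indicator X (A *v x) \<partial>lborel)"
    by (rule nn_integral_lborel_linear) (use assms in auto)
  also have "\<dots> = emeasure (density (distr lborel borel ((*v) A)) (\<lambda>_. ennreal \<bar>det A\<bar>)) X"
    using nn_integral_distr[of "(*v) A" lborel borel "indicator X"]
    by (simp add: emeasure_density nn_integral_cmult)
  finally show "emeasure lborel X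
      = emeasure (density (distr lborel borel ((*v) A)) (\<lambda>_. ennreal \<bar>det A\<bar>)) X" .
qed simp


section \<open>The standard Gaussian density\<close>

lemma has_bochner_integral_lborel_prod:
  fixes h :: "'n::finite \<Rightarrow> real \<Rightarrow> real"
  assumes h: "\<And>i. has_bochner_integral lborel (h i) (c i)"
  shows "has_bochner_integral lborel (\<lambda>x::real^'n. \<Prod>i\<in>UNIV. h i (x $ i)) (\<Prod>i\<in>UNIV. c i)"
proof -
  let ?e = "\<lambda>i. axis i 1 :: real^'n"
  interpret product_sigma_finite "\<lambda>b::real^'n. lborel :: real measure" ..
  define k where "k b = h (inv_into UNIV ?e b)" for b
  have k: "k (?e i) = h i" for i by (simp add: k_def inv_into_f_f[OF inj_axis])
  have int: "integrable lborel (h i)" "integral\<^sup>L lborel (h i) = c i" and meas: "h i \<in> borel_measurable borel" for i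
    using h[of i] by (auto simp: has_bochner_integral_iff)
  let ?T = "\<lambda>g. \<Sum>b\<in>Basis. g b *\<^sub>R (b :: real^'n)"
  have Tm: "?T \<in> borel_measurable (Pi\<^sub>M Basis (\<lambda>b. lborel))" by measurable
  have Tn: "?T g $ i = g (?e i)" for g i
    by (simp add: sum_Basis_cart axis_def if_distrib[of "\<lambda>a. b * a" for b] cong: if_cong)
  have kint: "integrable lborel (k b)" if "b \<in> Basis" for b
    using that int by (auto simp: Basis_cart k)
  have eq: "(\<Prod>i\<in>UNIV. h i (?T g $ i)) = (\<Prod>b\<in>Basis. k b (g b))" for g
    by (simp only: Tn) (simp add: prod_Basis_cart k)
  have *: "has_bochner_integral (Pi\<^sub>M Basis (\<lambda>b. lborel)) (\<lambda>g. \<Prod>i\<in>UNIV. h i (?T g $ i)) (\<Prod>i\<in>UNIV. c i)"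
    unfolding eq has_bochner_integral_iff
    using product_integrable_prod[of Basis k, OF finite_Basis kint] product_integral_prod[of Basis k, OF finite_Basis kint]
    by (simp add: prod_Basis_cart k int)
  show ?thesis
    unfolding lborel_eq[where 'a="real^'n"]
    by (rule has_bochner_integral_distr[OF _ Tm *])
       (intro borel_measurable_prod measurable_compose[OF _ meas], measurable)
qed

definition std_gaussian :: "real^'d \<Rightarrow> real" where
  "std_gaussian z = (\<Prod>i\<in>UNIV. std_normal_density (z $ i))"

lemma std_gaussian_moment:
  fixes p :: "'d::finite \<Rightarrow> nat" and m :: "nat \<Rightarrow> real"
  assumes "\<And>k. k \<in> range p \<Longrightarrow> has_bochner_integral lborel (\<lambda>t. std_normal_density t * t ^ k) (m k)"
  shows "has_bochner_integral lborel (\<lambda>z::real^'d. std_gaussian z * (\<Prod>i\<in>UNIV. z $ i ^ p i)) (\<Prod>i\<in>UNIV. m (p i))"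
  using has_bochner_integral_lborel_prod[of "\<lambda>i t. std_normal_density t * t ^ p i" "\<lambda>i. m (p i)"] assms
  by (simp add: std_gaussian_def prod.distrib)

lemma std_normal_moments:
  "has_bochner_integral lborel (\<lambda>t. std_normal_density t * t ^ 0) 1"
  "has_bochner_integral lborel (\<lambda>t. std_normal_density t * t ^ 1) 0"
  "has_bochner_integral lborel (\<lambda>t. std_normal_density t * t ^ 2) 1"
  using std_normal_moment_even[of 0] std_normal_moment_odd[of 0] std_normal_moment_even[of 1]
  by (simp_all add: fact_numeral)

lemma std_gaussian_moments:
  fixes a b :: "'d::finite"
  shows "has_bochner_integral lborel (std_gaussian :: real^'d \<Rightarrow> real) 1"
    and "has_bochner_integral lborel (\<lambda>z::real^'d. std_gaussian z * z $ a) 0"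
    and "has_bochner_integral lborel (\<lambda>z::real^'d. std_gaussian z * (z $ a * z $ b)) (of_bool (a = b))"
proof -
  \<comment> \<open>the moments of order \<open>0\<close>, \<open>1\<close> and \<open>2\<close> of the standard normal distribution\<close>
  define m :: "nat \<Rightarrow> real" where "m k = (if k = 1 then 0 else 1)" for k
  have M: "has_bochner_integral lborel (\<lambda>z::real^'d. std_gaussian z * (\<Prod>i\<in>UNIV. z $ i ^ p i)) (\<Prod>i\<in>UNIV. m (p i))"
    if "\<And>i. p i \<le> 2" for p :: "'d \<Rightarrow> nat"
  proof (rule std_gaussian_moment)
    fix k assume "k \<in> range p"
    then have "k = 0 \<or> k = 1 \<or> k = 2" using that by (force simp: le_Suc_eq numeral_2_eq_2)
    then show "has_bochner_integral lborel (\<lambda>t. std_normal_density t * t ^ k) (m k)"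
      using std_normal_moments by (auto simp: m_def)
  qed
  show "has_bochner_integral lborel (std_gaussian :: real^'d \<Rightarrow> real) 1"
    using M[of "\<lambda>_. 0"] by (simp add: m_def)
  have pow: "(\<Prod>i\<in>UNIV. z $ i ^ (if i = a then 1 else 0)) = z $ a" for z :: "real^'d" and a
    by (subst prod.remove[of _ a]) auto
  have zero: "(\<Prod>i\<in>UNIV. m (if i = a then 1 else 0)) = 0"
    by (rule prod_zero) (auto simp: m_def)
  show "has_bochner_integral lborel (\<lambda>z::real^'d. std_gaussian z * z $ a) 0"
    by (rule M[of "\<lambda>i. if i = a then 1 else 0", unfolded pow zero]) auto
  define q where "q i = (if i = a then 1 else 0) + (if i = b then 1 else 0 :: nat)" for i
  have "(\<Prod>i\<in>UNIV. m (q i)) = of_bool (a = b)"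
  proof (cases "a = b")
    case True
    then have "m (q i) = 1" for i by (simp add: m_def q_def)
    then show ?thesis using True by simp
  next
    case False
    then have "m (q a) = 0" by (simp add: m_def q_def)
    then have "(\<Prod>i\<in>UNIV. m (q i)) = 0" by (intro prod_zero) auto
    then show ?thesis using False by simp
  qed
  moreover have "(\<Prod>i\<in>UNIV. z $ i ^ q i) = z $ a * z $ b" for z :: "real^'d"
    unfolding q_def power_add prod.distrib pow ..
  moreover have "q i \<le> 2" for i by (simp add: q_def)
  ultimately show "has_bochner_integral lborel (\<lambda>z::real^'d. std_gaussian z * (z $ a * z $ b)) (of_bool (a = b))"
    using M[of q] by simp
qed

lemma std_gaussian_eq: "std_gaussian z = exp (- (z \<bullet> z) / 2) / sqrt ((2 * pi) ^ CARD('d))" for z :: "real^'d"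
  by (simp add: std_gaussian_def std_normal_density_def prod_dividef exp_sum[symmetric] inner_vec_def
      real_sqrt_mult real_sqrt_power power_mult_distrib sum_negf sum_divide_distrib power2_eq_square power_divide
      flip: exp_sum) 


section \<open>Gaussian densities and their moments\<close>

lemma gaussian_density_nonneg: "0 \<le> det \<Sigma> \<Longrightarrow> 0 \<le> gaussian_density \<mu> \<Sigma> x"
  by (simp add: gaussian_density_def)

lemma gaussian_density_measurable [measurable]: "gaussian_density \<mu> \<Sigma> \<in> borel_measurable borel"
  unfolding gaussian_density_def by measurable

text \<open>An invertible linear map carries a Gaussian density to the one with transformed mean and covariance,
up to the Jacobian; this one identity yields both the moments of an arbitrary Gaussian and the law
of the closed-loop terminal state.\<close>

lemma gaussian_density_linear:
  fixes C \<Sigma> :: "real^'d^'d"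
  assumes C: "invertible C" and \<Sigma>: "invertible \<Sigma>"
  shows "\<bar>det C\<bar> * gaussian_density (\<mu> + C *v \<nu>) (C ** \<Sigma> ** transpose C) (\<mu> + C *v x) = gaussian_density \<nu> \<Sigma> x"
proof -
  have inv: "matrix_inv (C ** \<Sigma> ** transpose C) = transpose (matrix_inv C) ** matrix_inv \<Sigma> ** matrix_inv C"
  proof (rule matrix_inv_unique)
    have "(C ** \<Sigma> ** transpose C) ** (transpose (matrix_inv C) ** matrix_inv \<Sigma> ** matrix_inv C)
      = C ** \<Sigma> ** transpose (matrix_inv C ** C) ** matrix_inv \<Sigma> ** matrix_inv C"
      by (simp only: matrix_transpose_mul matrix_mul_assoc)
    also have "\<dots> = C ** (\<Sigma> ** matrix_inv \<Sigma>) ** matrix_inv C"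
      by (simp add: matrix_inv_inverse C transpose_mat matrix_mul_assoc)
    also have "\<dots> = mat 1" by (simp add: matrix_inv_inverse C \<Sigma>)
    finally show "(C ** \<Sigma> ** transpose C) ** (transpose (matrix_inv C) ** matrix_inv \<Sigma> ** matrix_inv C) = mat 1" .
  qed
  define y where "y = x - \<nu>"
  have d: "\<mu> + C *v x - (\<mu> + C *v \<nu>) = C *v y"
    by (simp add: y_def matrix_vector_mult_diff_distrib)
  have q: "(C *v y) \<bullet> (matrix_inv (C ** \<Sigma> ** transpose C) *v (C *v y)) = y \<bullet> (matrix_inv \<Sigma> *v y)"
    unfolding inv matrix_vector_mul_assoc[symmetric] matrix_inv_mult_vec(2)[OF C]
    by (simp only: inner_matrix_vector_transpose[of "matrix_inv C", symmetric] matrix_inv_mult_vec(2)[OF C])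
  have "det C \<noteq> 0" using C invertible_det_nz by blast
  moreover have "sqrt ((2 * pi) ^ CARD('d) * det (C ** \<Sigma> ** transpose C)) = \<bar>det C\<bar> * sqrt ((2 * pi) ^ CARD('d) * det \<Sigma>)"
    by (simp add: det_mul det_transpose real_sqrt_mult)
  ultimately show ?thesis
    unfolding gaussian_density_def d q y_def[symmetric] by simp
qed

lemma std_gaussian_density: "gaussian_density 0 (mat 1) z = std_gaussian z" for z :: "real^'d"
proof -
  have "matrix_inv (mat 1 :: real^'d^'d) = mat 1" by (rule matrix_inv_unique) simp
  then show ?thesis by (simp add: gaussian_density_def std_gaussian_eq)
qed

text \<open>Substituting \<open>x = \<mu> + \<Sigma>\<^sup>1\<^sup>/\<^sup>2 z\<close> reduces integrals against a Gaussian density to the standard one.\<close>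

lemma has_bochner_integral_gaussian:
  fixes \<Sigma> :: "real^'d^'d" and g :: "real^'d \<Rightarrow> 'b::{banach, second_countable_topology}"
  assumes \<Sigma>: "pos_def \<Sigma>" and [measurable]: "g \<in> borel_measurable borel"
    and int: "has_bochner_integral lborel (\<lambda>z. std_gaussian z *\<^sub>R g (\<mu> + psd_sqrt \<Sigma> *v z)) c"
  shows "has_bochner_integral lborel (\<lambda>x. gaussian_density \<mu> \<Sigma> x *\<^sub>R g x) c"
proof -
  let ?H = "psd_sqrt \<Sigma>"
  have H: "invertible ?H" "transpose ?H = ?H" "?H ** ?H = \<Sigma>"
    using pos_def_psd_sqrt[OF \<Sigma>] psd_sqrt_square[OF pos_def_imp_pos_semidef[OF \<Sigma>]]
    by (auto simp: pos_def_invertible pos_def_def)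
  have "invertible (mat 1 :: real^'d^'d)" unfolding invertible_def by (metis matrix_mul_lid)
  then have dens: "\<bar>det ?H\<bar> * gaussian_density \<mu> \<Sigma> (\<mu> + ?H *v z) = std_gaussian z" for z
    using gaussian_density_linear[OF H(1), of "mat 1" \<mu> 0 z] by (simp add: H std_gaussian_density)
  let ?f = "\<lambda>x. gaussian_density \<mu> \<Sigma> x *\<^sub>R g x"
  have shift: "lborel = distr lborel borel (\<lambda>x. \<mu> + x)" by (simp add: lborel_distr_plus)
  have lin: "(lborel :: (real^'d) measure) = density (distr lborel borel ((*v) ?H)) (\<lambda>_. ennreal \<bar>det ?H\<bar>)"
    by (rule lborel_linear) (use H invertible_det_nz in blast)
  have *: "lborel = distr (density (distr lborel borel ((*v) ?H)) (\<lambda>_. ennreal \<bar>det ?H\<bar>)) borel (\<lambda>x. \<mu> + x)"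
    by (rule trans[OF shift arg_cong[where f="\<lambda>M. distr M borel (\<lambda>x. \<mu> + x)", OF lin]])
  show ?thesis
    apply (subst *)
    apply (rule has_bochner_integral_distr)
      apply measurable
    apply (rule has_bochner_integral_density)
       apply measurable
     apply simp
    apply (rule has_bochner_integral_distr)
      apply measurable
    using int by (simp add: dens[symmetric])
qed

lemma gaussian_density_mean:
  fixes \<Sigma> :: "real^'d^'d"
  assumes \<Sigma>: "pos_def \<Sigma>"
  shows "density_mean (gaussian_density \<mu> \<Sigma>) = \<mu>"
proof -
  let ?H = "psd_sqrt \<Sigma>"
  have eq: "std_gaussian z *\<^sub>R (\<mu> + ?H *v z)
      = std_gaussian z *\<^sub>R \<mu> + (\<Sum>a\<in>UNIV. (std_gaussian z * z $ a) *\<^sub>R column a ?H)" for z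
    by (simp add: matrix_mult_sum[of ?H z] scalar_mult_eq_scaleR scaleR_right_distrib scaleR_sum_right)
  have "has_bochner_integral lborel (\<lambda>z. std_gaussian z *\<^sub>R (\<mu> + ?H *v z))
      (1 *\<^sub>R \<mu> + (\<Sum>a\<in>UNIV. 0 *\<^sub>R column a ?H))"
    unfolding eq
    by (intro has_bochner_integral_add has_bochner_integral_sum has_bochner_integral_scaleR_left
        std_gaussian_moments)
  then have "has_bochner_integral lborel (\<lambda>x. gaussian_density \<mu> \<Sigma> x *\<^sub>R x) \<mu>"
    by (intro has_bochner_integral_gaussian[OF \<Sigma>]) auto
  then show ?thesis unfolding density_mean_def by (rule has_bochner_integral_integral_eq)
qed

text \<open>After the substitution the integrand is a quadratic form in \<open>z\<close> whose coordinates are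
uncorrelated with variance \<open>1\<close>, so the value is the entry of \<open>H H\<^sup>T = \<Sigma>\<close> with \<open>H = \<Sigma>\<^sup>1\<^sup>/\<^sup>2\<close>.\<close>

lemma gaussian_density_second_moment:
  fixes \<Sigma> :: "real^'d^'d"
  assumes \<Sigma>: "pos_def \<Sigma>"
  shows "has_bochner_integral lborel (\<lambda>x. gaussian_density \<mu> \<Sigma> x * ((x - \<mu>) $ i * (x - \<mu>) $ j)) (\<Sigma> $ i $ j)"
proof -
  let ?H = "psd_sqrt \<Sigma>"
  have H: "transpose ?H = ?H" "?H ** ?H = \<Sigma>"
    using pos_def_psd_sqrt[OF \<Sigma>] psd_sqrt_square[OF pos_def_imp_pos_semidef[OF \<Sigma>]]
    by (auto simp: pos_def_def)
  have eq: "std_gaussian z * ((?H *v z) $ i * (?H *v z) $ j)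
      = (\<Sum>a\<in>UNIV. \<Sum>b\<in>UNIV. (?H $ i $ a * ?H $ j $ b) * (std_gaussian z * (z $ a * z $ b)))" for z
  proof -
    have "(?H *v z) $ i * (?H *v z) $ j
        = (\<Sum>a\<in>UNIV. \<Sum>b\<in>UNIV. (?H $ i $ a * z $ a) * (?H $ j $ b * z $ b))"
      by (simp only: matrix_vector_mult_def vec_lambda_beta sum_product)
    then show ?thesis by (simp add: sum_distrib_left mult_ac)
  qed
  have "has_bochner_integral lborel (\<lambda>z. std_gaussian z * ((?H *v z) $ i * (?H *v z) $ j))
      (\<Sum>a\<in>UNIV. \<Sum>b\<in>UNIV. (?H $ i $ a * ?H $ j $ b) * of_bool (a = b))"
    unfolding eq
    by (intro has_bochner_integral_sum has_bochner_integral_mult_right std_gaussian_moments)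
  also have "(\<Sum>a\<in>UNIV. \<Sum>b\<in>UNIV. (?H $ i $ a * ?H $ j $ b) * of_bool (a = b)) = (?H ** transpose ?H) $ i $ j"
    by (simp add: matrix_matrix_mult_def transpose_def of_bool_def if_distrib[of "\<lambda>a. b * a" for b] cong: if_cong)
  finally show ?thesis
    using has_bochner_integral_gaussian[OF \<Sigma>, of "\<lambda>x. (x - \<mu>) $ i * (x - \<mu>) $ j" \<mu> "\<Sigma> $ i $ j"]
    by (simp add: H)
qed

lemma gaussian_density_cov:
  fixes \<Sigma> :: "real^'d^'d"
  assumes \<Sigma>: "pos_def \<Sigma>"
  shows "density_cov (gaussian_density \<mu> \<Sigma>) = \<Sigma>"
  unfolding density_cov_def gaussian_density_mean[OF \<Sigma>]
  using gaussian_density_second_moment[OF \<Sigma>, THEN has_bochner_integral_integral_eq]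
  by (simp add: vec_eq_iff)

lemma pos_def_det_pos:
  fixes \<Sigma> :: "real^'d^'d"
  assumes \<Sigma>: "pos_def \<Sigma>"
  shows "0 < det \<Sigma>"
proof -
  have "det \<Sigma> = (det (psd_sqrt \<Sigma>))\<^sup>2"
    by (metis psd_sqrt_square[OF pos_def_imp_pos_semidef[OF \<Sigma>]] det_mul power2_eq_square)
  then show ?thesis
    using pos_def_invertible[OF pos_def_psd_sqrt[OF \<Sigma>]] by (simp add: invertible_det_nz)
qed

lemma gaussian_square_integrable:
  fixes X :: "'w \<Rightarrow> real^'d"
  assumes \<Sigma>: "pos_def \<Sigma>" and X: "distributed \<Omega> lborel X (\<lambda>x. ennreal (gaussian_density 0 \<Sigma> x))"
  shows "integrable \<Omega> (\<lambda>\<omega>. (norm (X \<omega>))\<^sup>2)"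
proof -
  have "(norm x)\<^sup>2 = (\<Sum>i\<in>UNIV. x $ i * x $ i)" for x :: "real^'d"
    by (simp add: dot_square_norm[symmetric] inner_vec_def)
  then have "integrable lborel (\<lambda>x. gaussian_density 0 \<Sigma> x * (norm x)\<^sup>2)"
    using gaussian_density_second_moment[OF \<Sigma>, of 0, THEN integrable.intros]
    by (simp add: sum_distrib_left)
  then show ?thesis
    using distributed_integrable[OF X, of "\<lambda>x. (norm x)\<^sup>2"] pos_def_det_pos[OF \<Sigma>]
    by (simp add: gaussian_density_nonneg)
qed

lemma gaussian_linear_image:
  fixes X :: "'w \<Rightarrow> real^'d" and C :: "real^'d^'d"
  assumes \<Sigma>: "invertible \<Sigma>" and C: "invertible C"
    and X: "distributed \<Omega> lborel X (\<lambda>x. ennreal (gaussian_density 0 \<Sigma> x))"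
  shows "distributed \<Omega> lborel (\<lambda>\<omega>. C *v X \<omega>) (\<lambda>x. ennreal (gaussian_density 0 (C ** \<Sigma> ** transpose C) x))"
proof -
  let ?g = "\<lambda>x. ennreal (gaussian_density 0 \<Sigma> x)"
  let ?h = "\<lambda>x. ennreal (gaussian_density 0 (C ** \<Sigma> ** transpose C) x)"
  have X_m [measurable]: "X \<in> borel_measurable \<Omega>" using distributed_measurable[OF X] by simp
  have det: "det C \<noteq> 0" using C invertible_det_nz by blast
  have "distr \<Omega> lborel (\<lambda>\<omega>. C *v X \<omega>) = density lborel ?h"
  proof (rule measure_eqI)
    fix E assume "E \<in> sets (distr \<Omega> lborel (\<lambda>\<omega>. C *v X \<omega>))"
    then have [measurable]: "E \<in> sets borel" by simp
    have "emeasure (distr \<Omega> lborel (\<lambda>\<omega>. C *v X \<omega>)) E = emeasure \<Omega> (X -` ((*v) C -` E) \<inter> space \<Omega>)"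
      by (subst emeasure_distr) (auto simp: vimage_def)
    also have "\<dots> = (\<integral>\<^sup>+x. ?g x * indicator ((*v) C -` E) x \<partial>lborel)"
      by (rule distributed_emeasure[OF X]) (use measurable_sets[of "(*v) C" borel borel E] in simp)
    also have "\<dots> = (\<integral>\<^sup>+x. ennreal \<bar>det C\<bar> * (?h (C *v x) * indicator E (C *v x)) \<partial>lborel)"
      using gaussian_density_linear[OF C \<Sigma>, of 0 0]
      by (intro nn_integral_cong) (simp add: ennreal_mult'[symmetric] mult.assoc[symmetric] indicator_def)
    also have "\<dots> = ennreal \<bar>det C\<bar> * (\<integral>\<^sup>+x. ?h (C *v x) * indicator E (C *v x) \<partial>lborel)"
      by (rule nn_integral_cmult) measurable
    also have "\<dots> = (\<integral>\<^sup>+x. ?h x * indicator E x \<partial>lborel)"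
      by (rule nn_integral_lborel_linear[symmetric]) (use det in auto)
    also have "\<dots> = emeasure (density lborel ?h) E"
      by (simp add: emeasure_density)
    finally show "emeasure (distr \<Omega> lborel (\<lambda>\<omega>. C *v X \<omega>)) E = emeasure (density lborel ?h) E" .
  qed simp
  then show ?thesis unfolding distributed_def by simp
qed

section \<open>Block matrices and transition matrices\<close>

lemma invertible_transpose: "invertible A \<Longrightarrow> invertible (transpose A)" for A :: "real^'n^'n"
  by (metis invertible_def matrix_transpose_mul transpose_mat)

lemma matrix_vector_mult_sum_left: "(\<Sum>k\<in>I. F k) *v x = (\<Sum>k\<in>I. F k *v x)" for F :: "'i \<Rightarrow> real^'n^'m"
  by (induction I rule: infinite_finite_induct) (simp_all add: matrix_vector_mult_add_rdistrib)

lemma block_mat_mult_vec: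
  "block_mat X11 X12 X21 X22 *v block_vec x y = block_vec (X11 *v x + X12 *v y) (X21 *v x + X22 *v y)"
  unfolding vec_eq_iff
proof
  fix i
  show "(block_mat X11 X12 X21 X22 *v block_vec x y) $ i
      = block_vec (X11 *v x + X12 *v y) (X21 *v x + X22 *v y) $ i"
    by (cases i) (simp_all add: block_mat_def block_vec_def matrix_vector_mult_def UNIV_Plus_UNIV[symmetric]
        sum.Plus del: UNIV_Plus_UNIV)
qed

lemma block_vec_eq_iff: "block_vec x y = block_vec x' y' \<longleftrightarrow> x = x' \<and> y = y'"
proof
  assume eq: "block_vec x y = block_vec x' y'"
  have "x $ a = x' $ a" "y $ b = y' $ b" for a b
    using arg_cong[OF eq, of "\<lambda>v. v $ Inl a"] arg_cong[OF eq, of "\<lambda>v. v $ Inr b"]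
    by (simp_all add: block_vec_def)
  then show "x = x' \<and> y = y'" by (simp add: vec_eq_iff)
qed simp

lemma block_vec_inner: "block_vec x y \<bullet> block_vec x' y' = x \<bullet> x' + y \<bullet> y'"
  by (simp add: inner_vec_def block_vec_def UNIV_Plus_UNIV[symmetric] sum.Plus del: UNIV_Plus_UNIV)

lemma block_vec_cases: "\<exists>x y. z = block_vec x y"
  by (rule exI[of _ "\<chi> a. z $ Inl a"], rule exI[of _ "\<chi> b. z $ Inr b"])
     (auto simp: vec_eq_iff block_vec_def split: sum.splits)

lemma block11_block12_mult_vec:
  assumes "X *v block_vec x y = block_vec x' y'"
  shows "x' = block11 X *v x + block12 X *v y"
proof -
  have "x' $ a = (block11 X *v x + block12 X *v y) $ a" for a
    using arg_cong[OF assms, of "\<lambda>v. v $ Inl a"]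
    by (simp add: block_vec_def block11_def block12_def matrix_vector_mult_def UNIV_Plus_UNIV[symmetric]
        sum.Plus del: UNIV_Plus_UNIV)
  then show ?thesis by (simp add: vec_eq_iff)
qed

lemma foldr_matrix_mult:
  fixes G :: "nat \<Rightarrow> real^'k^'k"
  shows "foldr (\<lambda>i P. G i ** P) xs X = foldr (\<lambda>i P. G i ** P) xs (mat 1) ** X"
  by (induction xs) (simp_all add: matrix_mul_assoc)

text \<open>The second branch of \<^const>\<open>transition\<close>, a product of inverses, undoes the recursion
\<open>z (k + 1) = F k z k\<close> from time \<open>N\<close> to time \<open>0\<close>.\<close>

lemma transition_backward:
  assumes "\<And>k. k < N \<Longrightarrow> invertible (F k)" "\<And>k. k < N \<Longrightarrow> z (Suc k) = F k *v z k" "0 < N"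
  shows "transition F 0 N *v z N = z 0"
proof -
  have "foldr (\<lambda>i P. matrix_inv (F i) ** P) [0..<j] (mat 1) *v z j = z 0" if "j \<le> N" for j
    using that
  proof (induction j)
    case (Suc j)
    have "foldr (\<lambda>i P. matrix_inv (F i) ** P) [0..<Suc j] (mat 1) *v z (Suc j)
      = foldr (\<lambda>i P. matrix_inv (F i) ** P) [0..<j] (mat 1) *v (matrix_inv (F j) *v z (Suc j))"
      by (simp add: foldr_matrix_mult[where X="matrix_inv (F j)"] matrix_vector_mul_assoc)
    also have "\<dots> = z 0" using Suc assms by (simp add: matrix_inv_mult_vec)
    finally show ?case .
  qed simp
  then show ?thesis using assms(3) by (simp add: transition_def)
qed

lemma transition_self: "transition F k k = mat 1"
  by (simp add: transition_def)

lemma transition_step_right: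
  assumes "k < n" shows "transition F n k = transition F n (Suc k) ** F k"
proof -
  have "rev [k..<n] = rev [Suc k..<n] @ [k]" using assms by (simp add: upt_conv_Cons)
  then show ?thesis using assms
    by (simp add: transition_def foldr_matrix_mult[where X="F k"])
qed

section \<open>The Hamiltonian system\<close>

locale lq_system =
  fixes N :: nat
    and A :: "nat \<Rightarrow> real^'n^'n" and B S :: "nat \<Rightarrow> real^'m^'n"
    and Q :: "nat \<Rightarrow> real^'n^'n" and R :: "nat \<Rightarrow> real^'m^'m"
  assumes N_pos: "0 < N"
    and R_pos_def: "\<And>k. k < N \<Longrightarrow> pos_def (R k)"
    and Q_bar_psd: "\<And>k. k < N \<Longrightarrow> pos_semidef (Q_bar S Q R k)"
    and A_bar_inv: "\<And>k. k < N \<Longrightarrow> invertible (A_bar A B S R k)"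
    and reachable: "invertible (reach_gramian A B S R N 0)"
begin

abbreviation "Ab \<equiv> A_bar A B S R"
abbreviation "Qb \<equiv> Q_bar S Q R"
abbreviation "Ri k \<equiv> matrix_inv (R k)"
abbreviation "\<phi>11 \<equiv> phi11 N A B S Q R"
abbreviation "\<phi>12 \<equiv> phi12 N A B S Q R"

text \<open>The minimizer over \<open>w\<close> of \<open>w \<bullet> R w / 2 + l \<bullet> B w\<close>, for \<open>l\<close> the costate at time \<open>k + 1\<close>.\<close>

definition optimal_input :: "nat \<Rightarrow> real^'n \<Rightarrow> real^'m" where
  "optimal_input k l = - (Ri k *v (transpose (B k) *v l))"

text \<open>The second component is the costate (adjoint variable): these are the first-order optimality
conditions for half of \<open>\<Sum> x \<bullet> Qb x + w \<bullet> R w\<close>, with the costate \<open>l N\<close> at the horizon left free.\<close>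

definition hamiltonian_trajectory :: "(nat \<Rightarrow> real^'n) \<Rightarrow> (nat \<Rightarrow> real^'n) \<Rightarrow> bool" where
  "hamiltonian_trajectory x l \<longleftrightarrow> (\<forall>k<N.
     x (Suc k) = Ab k *v x k + B k *v optimal_input k (l (Suc k)) \<and>
     l k = transpose (Ab k) *v l (Suc k) + Qb k *v x k)"

text \<open>Since \<open>Ab k\<close> is invertible, the Hamiltonian system can be run backwards from any terminal pair.\<close>

lemma hamiltonian_trajectory_exists:
  "\<exists>x l. hamiltonian_trajectory x l \<and> x N = z \<and> l N = p"
proof -
  \<comment> \<open>one step backwards; the state must be recovered before the costate\<close>
  define step where "step k = (\<lambda>(x', l').
     let x = matrix_inv (Ab k) *v (x' - B k *v optimal_input k l')
     in (x, transpose (Ab k) *v l' + Qb k *v x))" for k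
  define orbit where "orbit = rec_nat (z, p) (\<lambda>j v. step (N - Suc j) v)"
  have orbit0: "orbit 0 = (z, p)" and orbitS: "orbit (Suc j) = step (N - Suc j) (orbit j)" for j
    by (simp_all add: orbit_def)
  define x l where "x k = fst (orbit (N - k))" and "l k = snd (orbit (N - k))" for k
  have "hamiltonian_trajectory x l"
    unfolding hamiltonian_trajectory_def
  proof (intro allI impI)
    fix k assume k: "k < N"
    have "orbit (N - k) = step k (orbit (N - Suc k))"
      using orbitS[of "N - Suc k"] k by (simp add: Suc_diff_Suc)
    then have "(x k, l k) = step k (x (Suc k), l (Suc k))"
      by (simp add: x_def l_def)
    then have xk: "x k = matrix_inv (Ab k) *v (x (Suc k) - B k *v optimal_input k (l (Suc k)))"
      and lk: "l k = transpose (Ab k) *v l (Suc k) + Qb k *v x k"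
      by (simp_all add: step_def Let_def)
    have "Ab k *v x k = x (Suc k) - B k *v optimal_input k (l (Suc k))"
      unfolding xk by (rule matrix_inv_mult_vec(1)[OF A_bar_inv[OF k]])
    then show "x (Suc k) = Ab k *v x k + B k *v optimal_input k (l (Suc k)) \<and>
     l k = transpose (Ab k) *v l (Suc k) + Qb k *v x k"
      using lk by simp
  qed
  then show ?thesis by (intro exI[of _ x] exI[of _ l]) (simp add: x_def l_def orbit0)
qed

lemma M_mat_mult_vec:
  "M_mat A B S Q R k *v block_vec x l =
    (let l' = transpose (matrix_inv (Ab k)) *v (l - Qb k *v x)
     in block_vec (Ab k *v x + B k *v optimal_input k l') l')"
  by (simp add: M_mat_def Let_def block_mat_mult_vec block_vec_eq_iff optimal_input_def
      matrix_vector_mult_add_rdistrib matrix_vector_mult_minus_left matrix_vector_mult_minus_right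
      matrix_vector_mult_diff_distrib matrix_vector_mul_assoc matrix_mul_assoc del: transpose_matrix_vector)

lemma M_mat_invertible:
  assumes k: "k < N" shows "invertible (M_mat A B S Q R k)"
  unfolding invertible_iff_ker
proof (intro allI impI)
  fix z assume z: "M_mat A B S Q R k *v z = 0"
  obtain x l where zz: "z = block_vec x l" using block_vec_cases by blast
  have zero: "(0 :: real^('n + 'n)) = block_vec 0 0"
    by (auto simp: block_vec_def vec_eq_iff split: sum.splits)
  define l' where "l' = transpose (matrix_inv (Ab k)) *v (l - Qb k *v x)"
  have "l' = 0" "Ab k *v x + B k *v optimal_input k l' = 0"
    using z unfolding zz zero M_mat_mult_vec Let_def l'_def[symmetric] by (auto simp: block_vec_eq_iff)
  then have "l' = 0" "Ab k *v x = 0" by (auto simp: optimal_input_def)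
  moreover have "x = 0" using \<open>Ab k *v x = 0\<close> A_bar_inv[OF k] invertible_iff_ker by blast
  moreover have "transpose (Ab k) *v l' = l - Qb k *v x"
    unfolding l'_def transpose_matrix_inv[OF A_bar_inv[OF k]]
    by (rule matrix_inv_mult_vec) (metis A_bar_inv[OF k] invertible_transpose)
  ultimately show "z = 0" by (simp add: zz zero block_vec_eq_iff)
qed

text \<open>A Hamiltonian trajectory is an orbit of the matrices \<^const>\<open>M_mat\<close>.\<close>

lemma hamiltonian_trajectory_initial:
  assumes traj: "hamiltonian_trajectory x l"
  shows "x 0 = \<phi>11 *v x N + \<phi>12 *v l N"
proof -
  have "transition (M_mat A B S Q R) 0 N *v block_vec (x N) (l N) = block_vec (x 0) (l 0)"
  proof (rule transition_backward)
    fix k assume k: "k < N"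
    then have "transpose (matrix_inv (Ab k)) *v (l k - Qb k *v x k)
        = transpose (matrix_inv (Ab k)) *v (transpose (Ab k) *v l (Suc k))"
      using traj by (simp add: hamiltonian_trajectory_def)
    also have "\<dots> = l (Suc k)"
      unfolding transpose_matrix_inv[OF A_bar_inv[OF k]]
      by (rule matrix_inv_mult_vec) (metis A_bar_inv[OF k] invertible_transpose)
    finally have l: "transpose (matrix_inv (Ab k)) *v (l k - Qb k *v x k) = l (Suc k)" .
    have x: "x (Suc k) = Ab k *v x k + B k *v optimal_input k (l (Suc k))"
      using traj k by (simp add: hamiltonian_trajectory_def)
    show "block_vec (x (Suc k)) (l (Suc k)) = M_mat A B S Q R k *v block_vec (x k) (l k)"
      unfolding M_mat_mult_vec Let_def l x[symmetric] ..
  qed (simp_all add: M_mat_invertible N_pos)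
  then show ?thesis unfolding phi11_def phi12_def by (rule block11_block12_mult_vec)
qed

lemma R_optimal_input: "k < N \<Longrightarrow> R k *v optimal_input k l = - (transpose (B k) *v l)"
  by (simp add: optimal_input_def matrix_vector_mult_minus_right matrix_inv_mult_vec
      pos_def_invertible R_pos_def del: transpose_matrix_vector)

lemma Qb_sym: "k < N \<Longrightarrow> (Qb k *v x) \<bullet> y = x \<bullet> (Qb k *v y)"
  using Q_bar_psd by (metis inner_matrix_vector_transpose pos_semidef_def)

lemma R_sym: "k < N \<Longrightarrow> (R k *v x) \<bullet> y = x \<bullet> (R k *v y)"
  using R_pos_def by (metis inner_matrix_vector_transpose pos_def_def)

text \<open>The basic identity of the Hamiltonian system: along any controlled path \<open>x\<close>, the pairing \<open>l k \<bullet> x k\<close>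
with the costate of a Hamiltonian trajectory \<open>\<xi>\<close> decreases in each step by the polarized stage cost
of \<open>\<xi>\<close> and \<open>x\<close>.\<close>

lemma costate_telescope:
  assumes traj: "hamiltonian_trajectory \<xi> l"
    and x: "\<And>k. k < N \<Longrightarrow> x (Suc k) = Ab k *v x k + B k *v w k"
  shows "(\<Sum>k<N. \<xi> k \<bullet> (Qb k *v x k) + optimal_input k (l (Suc k)) \<bullet> (R k *v w k))
    = l 0 \<bullet> x 0 - l N \<bullet> x N"
proof -
  have "\<xi> k \<bullet> (Qb k *v x k) + optimal_input k (l (Suc k)) \<bullet> (R k *v w k)
      = l k \<bullet> x k - l (Suc k) \<bullet> x (Suc k)" if k: "k < N" for k
  proof -
    have l: "l k = transpose (Ab k) *v l (Suc k) + Qb k *v \<xi> k"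
      using traj k by (simp add: hamiltonian_trajectory_def)
    have "optimal_input k (l (Suc k)) \<bullet> (R k *v w k) = - (l (Suc k) \<bullet> (B k *v w k))"
      unfolding R_sym[OF k, symmetric] R_optimal_input[OF k]
      using inner_matrix_vector_transpose[of "transpose (B k)" "l (Suc k)" "w k"] by simp
    moreover have "(transpose (Ab k) *v l (Suc k)) \<bullet> x k = l (Suc k) \<bullet> (Ab k *v x k)"
      using inner_matrix_vector_transpose[of "transpose (Ab k)" "l (Suc k)" "x k"] by simp
    ultimately show ?thesis
      using Qb_sym[OF k, of "\<xi> k" "x k"] unfolding l x[OF k] inner_add_left inner_add_right by linarith
  qed
  then have "(\<Sum>k<N. \<xi> k \<bullet> (Qb k *v x k) + optimal_input k (l (Suc k)) \<bullet> (R k *v w k))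
      = (\<Sum>k<N. l k \<bullet> x k - l (Suc k) \<bullet> x (Suc k))" by (intro sum.cong) auto
  also have "\<dots> = l 0 \<bullet> x 0 - l N \<bullet> x N" by (rule sum_lessThan_telescope')
  finally show ?thesis .
qed

text \<open>A free costate that is invisible to the input at all times lies in the kernel of the reachability
Gramian.\<close>

lemma reach_gramian_kernel:
  assumes "\<And>k. k < N \<Longrightarrow> l k = transpose (Ab k) *v l (Suc k)"
    and "\<And>k. k < N \<Longrightarrow> transpose (B k) *v l (Suc k) = 0"
  shows "l N = 0"
proof -
  have l: "l k = transpose (transition Ab N k) *v l N" if "k \<le> N" for k
    using that
  proof (induction rule: inc_induct)
    case base then show ?case by (simp add: transition_self transpose_mat)
  next
    case (step k)
    then show ?case
      by (simp add: assms(1) transition_step_right matrix_transpose_mul matrix_vector_mul_assoc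
          del: transpose_matrix_vector)
  qed
  have "reach_gramian A B S R N 0 *v l N = (\<Sum>k\<in>{0..<N}. transition Ab N (k + 1) *v (B k *v (transpose (B k) *v
      (transpose (transition Ab N (k + 1)) *v l N))))"
    by (simp add: reach_gramian_def matrix_vector_mult_sum_left matrix_vector_mul_assoc matrix_mul_assoc
        del: transpose_matrix_vector)
  also have "\<dots> = 0"
    using l[of "Suc _"] assms(2) by (intro sum.neutral) (simp del: transpose_matrix_vector)
  finally show ?thesis using reachable invertible_iff_ker by blast
qed


lemma optimal_input_eq_0_iff:
  assumes "k < N"
  shows "optimal_input k l = 0 \<longleftrightarrow> transpose (B k) *v l = 0"
  using R_optimal_input[OF assms, of l] by (auto simp: optimal_input_def simp del: transpose_matrix_vector)

lemma stage_nonneg: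
  assumes "k < N" shows "0 \<le> x \<bullet> (Qb k *v x)" "0 \<le> w \<bullet> (R k *v w)"
  using Q_bar_psd[OF assms] pos_def_imp_pos_semidef[OF R_pos_def[OF assms]]
  by (auto simp: pos_semidef_def)

text \<open>If \<open>\<phi>12 p = 0\<close>, the trajectory ending in \<open>(0, p)\<close> also starts in the origin, so by
\<open>costate_telescope\<close> its total cost is \<open>0\<close>. Then its input vanishes, hence its state does, and the
costate is free and unseen by the input.\<close>

lemma phi12_invertible: "invertible \<phi>12"
  unfolding invertible_iff_ker
proof (intro allI impI)
  fix p assume p: "\<phi>12 *v p = 0"
  obtain x l where traj: "hamiltonian_trajectory x l" and fin: "x N = 0" "l N = p"
    using hamiltonian_trajectory_exists by blast
  have x0: "x 0 = 0" using hamiltonian_trajectory_initial[OF traj] fin p by simp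
  have dyn: "x (Suc k) = Ab k *v x k + B k *v optimal_input k (l (Suc k))" if "k < N" for k
    using traj that by (simp add: hamiltonian_trajectory_def)
  let ?f = "\<lambda>k. x k \<bullet> (Qb k *v x k) + optimal_input k (l (Suc k)) \<bullet> (R k *v optimal_input k (l (Suc k)))"
  have "(\<Sum>k<N. ?f k) = 0" using costate_telescope[OF traj dyn] fin x0 by simp
  then have "?f k = 0" if "k < N" for k
    using that sum_nonneg_eq_0_iff[of "{..<N}" ?f] by (simp add: add_nonneg_nonneg stage_nonneg)
  then have "optimal_input k (l (Suc k)) \<bullet> (R k *v optimal_input k (l (Suc k))) = 0" if "k < N" for k
    using that stage_nonneg[OF that] by (metis add_nonneg_eq_0_iff)
  then have zero: "optimal_input k (l (Suc k)) = 0" if "k < N" for k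
    using R_pos_def[OF that] that unfolding pos_def_def by (metis less_irrefl)
  have x: "x k = 0" if "k \<le> N" for k
    using that by (induction k) (simp_all add: x0 dyn zero)
  have "l N = 0"
  proof (rule reach_gramian_kernel)
    fix k assume k: "k < N"
    then show "l k = transpose (Ab k) *v l (Suc k)"
      using traj x[of k] by (simp add: hamiltonian_trajectory_def)
    show "transpose (B k) *v l (Suc k) = 0"
      using zero[OF k] optimal_input_eq_0_iff[OF k] by blast
  qed
  then show "p = 0" using fin by simp
qed

section \<open>The cost of reaching a state from the origin\<close>

text \<open>The quadratic form \<open>z \<bullet> reach_cost z\<close> is the least cost of a path from the origin to \<open>z\<close> over the
whole horizon.\<close>

definition reach_cost :: "real^'n^'n" where
  "reach_cost = matrix_inv \<phi>12 ** \<phi>11"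

text \<open>The terminal costate \<open>- V z\<close>, with \<open>V\<close> the matrix \<open>reach_cost\<close>, is the one for which
\<open>\<phi>11 z + \<phi>12 l N = 0\<close>.\<close>

lemma trajectory_from_origin:
  obtains \<xi> l where "hamiltonian_trajectory \<xi> l" "\<xi> 0 = 0" "\<xi> N = z" "l N = - (reach_cost *v z)"
proof -
  obtain \<xi> l where traj: "hamiltonian_trajectory \<xi> l" and fin: "\<xi> N = z" "l N = - (reach_cost *v z)"
    using hamiltonian_trajectory_exists by blast
  have "\<phi>12 *v (reach_cost *v z) = \<phi>11 *v z"
    by (simp add: reach_cost_def matrix_vector_mul_assoc[symmetric] matrix_inv_mult_vec phi12_invertible)
  then have "\<xi> 0 = 0"
    using hamiltonian_trajectory_initial[OF traj] fin by (simp add: matrix_vector_mult_minus_right)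
  then show thesis using that traj fin by blast
qed

text \<open>For two trajectories from the origin, \<open>costate_telescope\<close> expresses \<open>V z \<bullet> z'\<close> by the polarized cost,
which is symmetric in the two trajectories.\<close>

lemma reach_cost_symmetric: "transpose reach_cost = reach_cost"
  unfolding symmetric_matrix_iff
proof (intro allI)
  fix z z'
  obtain \<xi> l where \<xi>: "hamiltonian_trajectory \<xi> l" "\<xi> 0 = 0" "\<xi> N = z" "l N = - (reach_cost *v z)"
    by (rule trajectory_from_origin)
  obtain \<xi>' l' where \<xi>': "hamiltonian_trajectory \<xi>' l'" "\<xi>' 0 = 0" "\<xi>' N = z'" "l' N = - (reach_cost *v z')"
    by (rule trajectory_from_origin)
  have dyn: "x (Suc k) = Ab k *v x k + B k *v optimal_input k (p (Suc k))"
    if "hamiltonian_trajectory x p" "k < N" for x p k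
    using that by (simp add: hamiltonian_trajectory_def)
  have "(reach_cost *v z) \<bullet> z' = (\<Sum>k<N. \<xi> k \<bullet> (Qb k *v \<xi>' k) + optimal_input k (l (Suc k)) \<bullet> (R k *v optimal_input k (l' (Suc k))))"
    using costate_telescope[OF \<xi>(1) dyn[OF \<xi>'(1)]] \<xi> \<xi>' by simp
  also have "\<dots> = (\<Sum>k<N. \<xi>' k \<bullet> (Qb k *v \<xi> k) + optimal_input k (l' (Suc k)) \<bullet> (R k *v optimal_input k (l (Suc k))))"
  proof (rule sum.cong)
    fix k assume "k \<in> {..<N}"
    then have "k < N" by simp
    from Qb_sym[OF this, of "\<xi> k" "\<xi>' k"] R_sym[OF this, of "optimal_input k (l (Suc k))" "optimal_input k (l' (Suc k))"]
    show "\<xi> k \<bullet> (Qb k *v \<xi>' k) + optimal_input k (l (Suc k)) \<bullet> (R k *v optimal_input k (l' (Suc k)))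
      = \<xi>' k \<bullet> (Qb k *v \<xi> k) + optimal_input k (l' (Suc k)) \<bullet> (R k *v optimal_input k (l (Suc k)))"
      by (simp add: inner_commute)
  qed simp
  also have "\<dots> = (reach_cost *v z') \<bullet> z"
    using costate_telescope[OF \<xi>'(1) dyn[OF \<xi>(1)]] \<xi> \<xi>' by simp
  finally show "(reach_cost *v z) \<bullet> z' = z \<bullet> (reach_cost *v z')" by (simp add: inner_commute)
qed

lemma hamiltonian_trajectory_zero:
  assumes traj: "hamiltonian_trajectory x l" and "x N = 0" "l N = 0" and "k \<le> N"
  shows "x k = 0 \<and> l k = 0"
  using \<open>k \<le> N\<close>
proof (induction rule: inc_induct)
  case (step k)
  then have "x (Suc k) = 0" "l (Suc k) = 0" "k < N" by auto
  then have "Ab k *v x k = 0" "l k = Qb k *v x k"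
    using traj by (simp_all add: hamiltonian_trajectory_def optimal_input_def)
  moreover from this have "x k = 0" using A_bar_inv[OF \<open>k < N\<close>] invertible_iff_ker by blast
  ultimately show ?case by simp
qed (simp add: assms)

text \<open>Compare the path with the Hamiltonian trajectory \<open>\<xi>\<close> from the origin to the same end point. The
cross terms vanish by \<open>costate_telescope\<close>, since the difference of the two paths starts and ends in
the origin; the cost of \<open>\<xi>\<close> cancels the term \<open>- reach_cost\<close>. What remains is the cost of the
difference plus \<open>x N \<bullet> Y x N\<close>.\<close>

lemma cost_from_origin_pos:
  assumes x0: "x 0 = 0" and dyn: "\<And>k. k < N \<Longrightarrow> x (Suc k) = Ab k *v x k + B k *v w k"
    and Y: "pos_def Y" and w: "i < N" "w i \<noteq> 0"
  shows "0 < (\<Sum>k<N. x k \<bullet> (Qb k *v x k) + w k \<bullet> (R k *v w k)) + x N \<bullet> ((- reach_cost + Y) *v x N)"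
proof -
  obtain \<xi> l where \<xi>: "hamiltonian_trajectory \<xi> l" "\<xi> 0 = 0" "\<xi> N = x N" "l N = - (reach_cost *v x N)"
    by (rule trajectory_from_origin)
  define ws where "ws k = optimal_input k (l (Suc k))" for k
  define d v where "d k = x k - \<xi> k" and "v k = w k - ws k" for k
  have dyn\<xi>: "\<xi> (Suc k) = Ab k *v \<xi> k + B k *v ws k" if "k < N" for k
    using \<xi>(1) that by (simp add: hamiltonian_trajectory_def ws_def)
  have dynd: "d (Suc k) = Ab k *v d k + B k *v v k" if "k < N" for k
    using dyn[OF that] dyn\<xi>[OF that] by (simp add: d_def v_def matrix_vector_mult_diff_distrib)
  have t1: "(\<Sum>k<N. \<xi> k \<bullet> (Qb k *v \<xi> k) + ws k \<bullet> (R k *v ws k)) = x N \<bullet> (reach_cost *v x N)"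
    using costate_telescope[OF \<xi>(1) dyn\<xi>] \<xi> by (simp add: ws_def inner_commute)
  have t2: "(\<Sum>k<N. \<xi> k \<bullet> (Qb k *v d k) + ws k \<bullet> (R k *v v k)) = 0"
    using costate_telescope[OF \<xi>(1) dynd] \<xi> x0 by (simp add: ws_def d_def)
  have sq: "(\<Sum>k<N. x k \<bullet> (Qb k *v x k) + w k \<bullet> (R k *v w k))
     = (\<Sum>k<N. \<xi> k \<bullet> (Qb k *v \<xi> k) + ws k \<bullet> (R k *v ws k))
       + 2 * (\<Sum>k<N. \<xi> k \<bullet> (Qb k *v d k) + ws k \<bullet> (R k *v v k))
       + (\<Sum>k<N. d k \<bullet> (Qb k *v d k) + v k \<bullet> (R k *v v k))"
    unfolding sum_distrib_left sum.distrib[symmetric]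
  proof (rule sum.cong)
    fix k assume "k \<in> {..<N}"
    then have k: "k < N" by simp
    have x: "x k = \<xi> k + d k" and w: "w k = ws k + v k" by (simp_all add: d_def v_def)
    have "d k \<bullet> (Qb k *v \<xi> k) = \<xi> k \<bullet> (Qb k *v d k)" "v k \<bullet> (R k *v ws k) = ws k \<bullet> (R k *v v k)"
      by (metis Qb_sym[OF k] inner_commute, metis R_sym[OF k] inner_commute)
    then show "x k \<bullet> (Qb k *v x k) + w k \<bullet> (R k *v w k)
       = \<xi> k \<bullet> (Qb k *v \<xi> k) + ws k \<bullet> (R k *v ws k)
       + 2 * (\<xi> k \<bullet> (Qb k *v d k) + ws k \<bullet> (R k *v v k))
       + (d k \<bullet> (Qb k *v d k) + v k \<bullet> (R k *v v k))"
      unfolding x w by (simp add: matrix_vector_right_distrib inner_add_left inner_add_right)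
  qed simp
  have total: "(\<Sum>k<N. x k \<bullet> (Qb k *v x k) + w k \<bullet> (R k *v w k)) + x N \<bullet> ((- reach_cost + Y) *v x N)
     = (\<Sum>k<N. d k \<bullet> (Qb k *v d k) + v k \<bullet> (R k *v v k)) + x N \<bullet> (Y *v x N)"
    unfolding sq t1 t2
    by (simp add: matrix_vector_mult_add_rdistrib matrix_vector_mult_diff_rdistrib
        matrix_vector_mult_minus_left inner_add_right inner_diff_right)
  have nn: "0 \<le> (\<Sum>k<N. d k \<bullet> (Qb k *v d k) + v k \<bullet> (R k *v v k))"
    by (intro sum_nonneg add_nonneg_nonneg stage_nonneg) auto
  show ?thesis
  proof (cases "x N = 0")
    case False
    then show ?thesis using Y nn unfolding total by (simp add: pos_def_def add_nonneg_pos)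
  next
    case True
    \<comment> \<open>the comparison trajectory is then the zero trajectory\<close>
    then have "l (Suc i) = 0"
      using hamiltonian_trajectory_zero[OF \<xi>(1), of "Suc i"] \<xi> w by simp
    then have "v i = w i" by (simp add: v_def ws_def optimal_input_def)
    then have "0 < v i \<bullet> (R i *v v i)" using R_pos_def[OF w(1)] w(2) by (simp add: pos_def_def)
    then have "0 < (\<Sum>k<N. d k \<bullet> (Qb k *v d k) + v k \<bullet> (R k *v v k))"
      by (intro sum_pos2[of _ i]) (auto simp: w(1) intro!: add_nonneg_pos add_nonneg_nonneg stage_nonneg)
    then show ?thesis using True unfolding total by simp
  qed
qed

section \<open>The Riccati equation\<close>

definition feedback :: "(nat \<Rightarrow> real^'n^'n) \<Rightarrow> nat \<Rightarrow> real^'n^'m" where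
  "feedback P k = matrix_inv (control_weight B R P k) ** transpose (B k) ** P (k + 1) ** Ab k"


lemma control_weight_symmetric:
  assumes "k < N" "transpose (P (Suc k)) = P (Suc k)"
  shows "transpose (control_weight B R P k) = control_weight B R P k"
  using assms R_pos_def[OF assms(1)]
  by (simp add: control_weight_def transpose_add matrix_transpose_mul matrix_mul_assoc pos_def_def)

lemma feedback_equation:
  assumes "invertible (control_weight B R P k)"
  shows "control_weight B R P k *v (feedback P k *v x) = transpose (B k) *v (P (Suc k) *v (Ab k *v x))"
proof -
  have "control_weight B R P k ** feedback P k
      = (control_weight B R P k ** matrix_inv (control_weight B R P k)) ** transpose (B k) ** P (Suc k) ** Ab k"
    by (simp add: feedback_def matrix_mul_assoc)
  then show ?thesis
    by (simp add: matrix_inv_inverse assms matrix_vector_mul_assoc matrix_mul_assoc del: transpose_matrix_vector)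
qed

lemma control_weight_mult_vec:
  "control_weight B R P k *v w = R k *v w + transpose (B k) *v (P (Suc k) *v (B k *v w))"
  by (simp add: control_weight_def matrix_vector_mult_add_rdistrib matrix_vector_mul_assoc matrix_mul_assoc del: transpose_matrix_vector)

lemma riccati_mult_vec:
  assumes "riccati_solution N A B S Q R P" "k < N"
  shows "P k *v x = transpose (Ab k) *v (P (Suc k) *v (Ab k *v x - B k *v (feedback P k *v x))) + Qb k *v x"
proof -
  have "P k = transpose (Ab k) ** P (Suc k) ** Ab k - transpose (Ab k) ** P (Suc k) ** B k ** feedback P k + Qb k"
    using assms by (simp add: riccati_solution_def feedback_def matrix_mul_assoc)
  then show ?thesis
    by (simp add: matrix_vector_mult_add_rdistrib matrix_vector_mult_diff_rdistrib matrix_vector_mult_diff_distrib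
        matrix_vector_mul_assoc matrix_mul_assoc del: transpose_matrix_vector)
qed

lemma riccati_symmetric_step:
  assumes "riccati_solution N A B S Q R P" "k < N" "transpose (P (Suc k)) = P (Suc k)"
    and inv: "invertible (control_weight B R P k)"
  shows "transpose (P k) = P k"
proof -
  have "transpose (matrix_inv (control_weight B R P k)) = matrix_inv (control_weight B R P k)"
    using transpose_matrix_inv[OF inv] control_weight_symmetric[of k P] assms by simp
  moreover have "transpose (Qb k) = Qb k" using Q_bar_psd[OF assms(2)] by (simp add: pos_semidef_def)
  moreover have "P k = transpose (Ab k) ** P (Suc k) ** Ab k
      - transpose (Ab k) ** P (Suc k) ** B k ** matrix_inv (control_weight B R P k)
          ** transpose (B k) ** P (Suc k) ** Ab k + Qb k"
    using assms by (simp add: riccati_solution_def)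
  ultimately show ?thesis
    using assms(3) by (simp add: transpose_add transpose_minus matrix_transpose_mul matrix_mul_assoc)
qed

text \<open>One step of dynamic programming: the stage cost plus the cost-to-go of the successor state exceeds
the cost-to-go of \<open>x\<close> by the weighted squared deviation of the input from the feedback.\<close>

lemma riccati_completes_square:
  assumes ric: "riccati_solution N A B S Q R P" and k: "k < N"
    and sym: "transpose (P (Suc k)) = P (Suc k)" and inv: "invertible (control_weight B R P k)"
    and x': "x' = Ab k *v x + B k *v w"
  shows "x \<bullet> (Qb k *v x) + w \<bullet> (R k *v w) + x' \<bullet> (P (Suc k) *v x')
    = x \<bullet> (P k *v x) + (w + feedback P k *v x) \<bullet> (control_weight B R P k *v (w + feedback P k *v x))"
proof -
  define a where "a = Ab k *v x"
  define b where "b = B k *v w"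
  define c where "c = feedback P k *v x"
  let ?P = "P (Suc k)" and ?W = "control_weight B R P k"
  have Psym: "(?P *v y) \<bullet> z = y \<bullet> (?P *v z)" for y z
    using sym symmetric_matrix_iff by blast
  have Wsym: "(?W *v y) \<bullet> z = y \<bullet> (?W *v z)" for y z
    using control_weight_symmetric[where P=P, OF k sym] symmetric_matrix_iff by blast
  have Bt: "y \<bullet> (transpose (B k) *v z) = (B k *v y) \<bullet> z" for y z
    by (rule inner_matrix_vector_transpose[symmetric])
  have At: "y \<bullet> (transpose (Ab k) *v z) = (Ab k *v y) \<bullet> z" for y z
    by (rule inner_matrix_vector_transpose[symmetric])
  have Wc: "?W *v c = transpose (B k) *v (?P *v a)"
    unfolding c_def a_def by (rule feedback_equation[OF inv])
  have "x \<bullet> (P k *v x) = a \<bullet> (?P *v a) - (B k *v c) \<bullet> (?P *v a) + x \<bullet> (Qb k *v x)"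
    unfolding riccati_mult_vec[OF ric k] inner_add_right At a_def[symmetric] c_def[symmetric]
    by (simp add: matrix_vector_mult_diff_distrib inner_diff_right Psym[of a, symmetric])
      (simp add: inner_commute)
  moreover have "(B k *v c) \<bullet> (?P *v a) = c \<bullet> (?W *v c)" by (simp only: Wc Bt)
  moreover have "w \<bullet> (?W *v c) = b \<bullet> (?P *v a)" by (simp only: Wc Bt b_def)
  moreover have "c \<bullet> (?W *v w) = w \<bullet> (?W *v c)" by (metis Wsym inner_commute)
  moreover have "w \<bullet> (?W *v w) = w \<bullet> (R k *v w) + b \<bullet> (?P *v b)"
    by (simp only: control_weight_mult_vec inner_add_right Bt b_def)
  moreover have "a \<bullet> (?P *v b) = b \<bullet> (?P *v a)" by (metis Psym inner_commute)
  ultimately show ?thesis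
    unfolding x' a_def[symmetric] b_def[symmetric] c_def[symmetric]
    by (simp add: matrix_vector_right_distrib inner_add_left inner_add_right)
qed

text \<open>Once the later weights are known to be positive definite, \<open>v \<bullet> W v\<close>, for \<open>W\<close> the control weight at
time \<open>k\<close>, is the cost from the origin of an explicit nonzero input, so \<open>cost_from_origin_pos\<close> applies.\<close>

lemma riccati_control_weight_pos_def:
  assumes ric: "riccati_solution N A B S Q R P" and PN: "P N = - reach_cost + Y" and Y: "pos_def Y"
    and "k \<le> N"
  shows "(\<forall>j\<in>{k..<N}. pos_def (control_weight B R P j)) \<and> transpose (P k) = P k"
  using \<open>k \<le> N\<close>
proof (induction rule: inc_induct)
  case base
  then show ?case using Y by (simp add: PN transpose_add transpose_minus transpose_uminus reach_cost_symmetric pos_def_def)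
next
  case (step k)
  have k: "k < N" and sym: "transpose (P (Suc k)) = P (Suc k)"
    and later: "\<And>j. Suc k \<le> j \<Longrightarrow> j < N \<Longrightarrow> pos_def (control_weight B R P j)" using step by auto
  have sym': "transpose (P j) = P j" if "Suc k \<le> j" "j \<le> N" for j
    using \<open>j \<le> N\<close> \<open>Suc k \<le> j\<close>
  proof (induction rule: inc_induct)
    case base
    then show ?case using Y by (simp add: PN transpose_add transpose_minus transpose_uminus reach_cost_symmetric pos_def_def)
  next
    case (step i)
    then show ?case
      using riccati_symmetric_step[OF ric, of i] later[of i] pos_def_invertible by auto
  qed
  have "0 < v \<bullet> (control_weight B R P k *v v)" if v: "v \<noteq> 0" for v
  proof -
    \<comment> \<open>the path \<open>x\<close> rests in the origin, is kicked by \<open>v\<close> at time \<open>k\<close> and then follows the feedback\<close>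
    define u where "u j y = (if j < k then 0 else if j = k then v else - (feedback P j *v y))" for j y
    define x where "x = rec_nat 0 (\<lambda>j y. Ab j *v y + B j *v u j y)"
    define w where "w j = u j (x j)" for j
    have x0: "x 0 = 0" and dyn: "x (Suc j) = Ab j *v x j + B j *v w j" for j
      by (simp_all add: x_def w_def)
    have rest: "x j = 0" if "j \<le> k" for j
      using that by (induction j) (simp_all add: x0 dyn w_def u_def)
    have wj: "w j = 0" if "j < k" for j using that by (simp add: w_def u_def)
    have wk: "w k = v" by (simp add: w_def u_def)
    let ?f = "\<lambda>j. x j \<bullet> (Qb j *v x j) + w j \<bullet> (R j *v w j)"
    \<comment> \<open>after time \<open>k\<close> the feedback trades stage cost for cost-to-go without loss\<close>
    have "(\<Sum>j<n. ?f j) + x n \<bullet> (P n *v x n) = v \<bullet> (control_weight B R P k *v v)" if "Suc k \<le> n" "n \<le> N" for n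
      using that
    proof (induction rule: dec_induct)
      case base
      have "(\<Sum>j<k. ?f j) = 0" by (rule sum.neutral) (auto simp: rest wj)
      moreover have "x (Suc k) = B k *v v" by (simp add: dyn rest wk)
      ultimately show ?case
        by (simp add: rest wk control_weight_mult_vec inner_add_right del: transpose_matrix_vector)
          (rule inner_matrix_vector_transpose)
    next
      case (step n)
      then have n: "n < N" "Suc k \<le> n" by auto
      have "w n + feedback P n *v x n = 0" using n by (simp add: w_def u_def)
      then have "?f n + x (Suc n) \<bullet> (P (Suc n) *v x (Suc n)) = x n \<bullet> (P n *v x n)"
        using riccati_completes_square[OF ric n(1) sym'[of "Suc n"] pos_def_invertible[OF later[OF n(2,1)]] dyn] n
        by simp
      then show ?case using step by simp
    qed
    from this[of N] have "(\<Sum>j<N. ?f j) + x N \<bullet> (P N *v x N) = v \<bullet> (control_weight B R P k *v v)"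
      using k by simp
    moreover have "0 < (\<Sum>j<N. ?f j) + x N \<bullet> (P N *v x N)"
      unfolding PN by (rule cost_from_origin_pos[OF x0 dyn Y k]) (simp add: wk v)
    ultimately show ?thesis by simp
  qed
  then have Wk: "pos_def (control_weight B R P k)"
    using control_weight_symmetric[where P=P, OF k sym] by (simp add: pos_def_def)
  moreover have "transpose (P k) = P k"
    by (rule riccati_symmetric_step[OF ric k sym pos_def_invertible[OF Wk]])
  ultimately show ?case using later by (metis Suc_leI atLeastLessThan_iff le_neq_implies_less)
qed

text \<open>In terms of the shifted input \<open>w = u + R\<^sup>-\<^sup>1 S\<^sup>T x\<close>, the law \<open>u = - gain x\<close> reads \<open>w = - feedback x\<close>.\<close>

lemma gain_mult_vec:
  assumes k: "k < N" and inv: "invertible (control_weight B R P k)"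
  shows "gain A B S R P k *v x = feedback P k *v x + Ri k *v (transpose (S k) *v x)"
proof -
  let ?r = "Ri k *v (transpose (S k) *v x)"
  have Ax: "A k *v x = Ab k *v x + B k *v ?r"
    by (simp add: A_bar_def matrix_vector_mult_diff_rdistrib matrix_vector_mul_assoc matrix_mul_assoc
        del: transpose_matrix_vector)
  have "control_weight B R P k *v (feedback P k *v x + ?r)
      = transpose (B k) *v (P (Suc k) *v (A k *v x)) + R k *v ?r"
    unfolding matrix_vector_right_distrib feedback_equation[OF inv] control_weight_mult_vec[of P k ?r] Ax
    by (simp add: matrix_vector_right_distrib del: transpose_matrix_vector)
  also have "R k *v ?r = transpose (S k) *v x"
    by (rule matrix_inv_mult_vec(1)[OF pos_def_invertible[OF R_pos_def[OF k]]])
  finally have "matrix_inv (control_weight B R P k) *v (transpose (B k) *v (P (Suc k) *v (A k *v x)) + transpose (S k) *v x)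
      = feedback P k *v x + ?r"
    by (metis inv matrix_inv_mult_vec(2))
  then show ?thesis
    by (simp add: gain_def matrix_vector_mult_add_rdistrib matrix_vector_mul_assoc[symmetric]
        del: transpose_matrix_vector)
qed

text \<open>Under the Riccati feedback, \<open>P k x k\<close> is a costate: the feedback equation says that the input is the
one that this costate prescribes, and the Riccati equation is the costate equation.\<close>

lemma closed_loop_hamiltonian:
  assumes ric: "riccati_solution N A B S Q R P"
    and inv: "\<And>k. k < N \<Longrightarrow> invertible (control_weight B R P k)"
    and dyn: "\<And>k. k < N \<Longrightarrow> x (Suc k) = Ab k *v x k - B k *v (feedback P k *v x k)"
  shows "hamiltonian_trajectory x (\<lambda>k. P k *v x k)"
  unfolding hamiltonian_trajectory_def
proof (intro allI impI conjI)
  fix k assume k: "k < N"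
  let ?K = "feedback P k *v x k"
  have "transpose (B k) *v (P (Suc k) *v x (Suc k)) = R k *v ?K"
    using feedback_equation[OF inv[OF k], of "x k"]
    unfolding dyn[OF k] matrix_vector_mult_diff_distrib control_weight_mult_vec
    by (metis add_diff_cancel_right')
  then have "optimal_input k (P (Suc k) *v x (Suc k)) = - ?K"
    by (simp add: optimal_input_def matrix_inv_mult_vec pos_def_invertible R_pos_def k
        del: transpose_matrix_vector)
  then show "x (Suc k) = Ab k *v x k + B k *v optimal_input k (P (Suc k) *v x (Suc k))"
    by (simp add: dyn[OF k] matrix_vector_mult_minus_right)
  show "P k *v x k = transpose (Ab k) *v (P (Suc k) *v x (Suc k)) + Qb k *v x k"
    unfolding dyn[OF k] by (rule riccati_mult_vec[OF ric k])
qed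

text \<open>The part \<open>- reach_cost\<close> of the terminal value cancels \<open>\<phi>11\<close> in \<open>x 0 = \<phi>11 x N + \<phi>12 P N x N\<close>.\<close>

lemma closed_loop_initial_state:
  assumes "riccati_solution N A B S Q R P" "P N = - reach_cost + Y"
    and "\<And>k. k < N \<Longrightarrow> invertible (control_weight B R P k)"
    and "\<And>k. k < N \<Longrightarrow> x (Suc k) = Ab k *v x k - B k *v (feedback P k *v x k)"
  shows "x 0 = \<phi>12 *v (Y *v x N)"
proof -
  have "\<phi>12 *v (reach_cost *v x N) = \<phi>11 *v x N"
    by (simp add: reach_cost_def matrix_vector_mul_assoc[symmetric] matrix_inv_mult_vec phi12_invertible)
  then show ?thesis
    using hamiltonian_trajectory_initial[OF closed_loop_hamiltonian[OF assms(1,3,4)]]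
    by (simp add: assms(2) matrix_vector_mult_diff_rdistrib matrix_vector_mult_diff_distrib
        matrix_vector_mult_add_rdistrib matrix_vector_mult_minus_left
        matrix_vector_mult_minus_right matrix_vector_right_distrib)
qed

end

lemma tendsto_matrix_vector_mult:
  fixes F :: "'a \<Rightarrow> real^'n^'m"
  assumes "(F \<longlongrightarrow> A) net"
  shows "((\<lambda>t. F t *v x) \<longlongrightarrow> A *v x) net"
  unfolding matrix_vector_mult_def
  by (intro vec_tendstoI) (auto intro!: tendsto_sum tendsto_mult tendsto_vec_nth assms)

section \<open>The terminal weight\<close>

text \<open>The summand \<open>Y\<close> in the terminal value \<open>- \<Phi>\<^sup>-\<^sup>1 \<phi>11 + Y\<close>.\<close>

definition terminal_weight :: "real^'n^'n \<Rightarrow> real^'n^'n \<Rightarrow> real^'n^'n \<Rightarrow> real \<Rightarrow> real^'n^'n" where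
  "terminal_weight \<Phi> \<Sigma>0 \<Sigma>N \<epsilon> =
     (let H = psd_sqrt \<Sigma>N; Hi = matrix_inv H in
      (\<epsilon> / 2) *\<^sub>R matrix_inv \<Sigma>N
      + Hi ** psd_sqrt ((\<epsilon>\<^sup>2 / 4) *\<^sub>R mat 1
            + H ** matrix_inv \<Phi> ** \<Sigma>0 ** transpose (matrix_inv \<Phi>) ** H) ** Hi)"

lemma psd_sqrt_pos_def_facts:
  fixes X :: "real^'n^'n"
  assumes "pos_def X"
  shows "invertible (psd_sqrt X)" "transpose (psd_sqrt X) = psd_sqrt X" "psd_sqrt X ** psd_sqrt X = X"
    "transpose (matrix_inv (psd_sqrt X)) = matrix_inv (psd_sqrt X)"
  using pos_def_psd_sqrt[OF assms] psd_sqrt_square[OF pos_def_imp_pos_semidef[OF assms]]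
  by (auto simp: pos_def_invertible pos_def_def transpose_matrix_inv)

lemma pos_def_terminal_middle:
  fixes \<Phi> :: "real^'n^'n"
  assumes \<Phi>: "invertible \<Phi>" and \<Sigma>0: "pos_def \<Sigma>0" and \<Sigma>N: "pos_def \<Sigma>N"
  shows "pos_def (psd_sqrt \<Sigma>N ** matrix_inv \<Phi> ** \<Sigma>0 ** transpose (matrix_inv \<Phi>) ** psd_sqrt \<Sigma>N)"
proof -
  have "pos_def (transpose (transpose (matrix_inv \<Phi>) ** psd_sqrt \<Sigma>N) ** \<Sigma>0 ** (transpose (matrix_inv \<Phi>) ** psd_sqrt \<Sigma>N))"
    by (rule pos_def_congruence[OF \<Sigma>0])
      (intro invertible_mult invertible_transpose invertible_matrix_inv \<Phi> psd_sqrt_pos_def_facts \<Sigma>N)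
  then show ?thesis
    by (simp add: matrix_transpose_mul matrix_mul_assoc psd_sqrt_pos_def_facts[OF \<Sigma>N])
qed

lemma pos_def_terminal_weight:
  fixes \<Phi> :: "real^'n^'n"
  assumes \<Phi>: "invertible \<Phi>" and \<Sigma>0: "pos_def \<Sigma>0" and \<Sigma>N: "pos_def \<Sigma>N" and \<epsilon>: "0 \<le> \<epsilon>"
  shows "pos_def (terminal_weight \<Phi> \<Sigma>0 \<Sigma>N \<epsilon>)"
proof -
  let ?H = "psd_sqrt \<Sigma>N" and ?Z = "psd_sqrt \<Sigma>N ** matrix_inv \<Phi> ** \<Sigma>0 ** transpose (matrix_inv \<Phi>) ** psd_sqrt \<Sigma>N"
  have scale: "pos_semidef (c *\<^sub>R X)" if "0 \<le> c" "pos_def X" for c and X :: "real^'n^'n"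
  proof (cases "c = 0")
    case True
    then show ?thesis by (simp add: pos_semidef_def transpose_def vec_eq_iff)
  next
    case False
    then show ?thesis using that by (intro pos_def_imp_pos_semidef pos_def_scaleR) auto
  qed
  have "pos_def (?Z + (\<epsilon>\<^sup>2 / 4) *\<^sub>R mat 1)"
    by (intro pos_def_add pos_def_terminal_middle scale pos_def_mat_1 assms) simp
  then have "pos_def (psd_sqrt ((\<epsilon>\<^sup>2 / 4) *\<^sub>R mat 1 + ?Z))"
    using pos_def_psd_sqrt by (simp add: add.commute)
  from pos_def_congruence[OF this, of "matrix_inv ?H"]
  have "pos_def (matrix_inv ?H ** psd_sqrt ((\<epsilon>\<^sup>2 / 4) *\<^sub>R mat 1 + ?Z) ** matrix_inv ?H)"
    by (simp add: psd_sqrt_pos_def_facts[OF \<Sigma>N] invertible_matrix_inv)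
  moreover have "pos_semidef ((\<epsilon> / 2) *\<^sub>R matrix_inv \<Sigma>N)"
    by (intro scale pos_def_matrix_inv \<Sigma>N) (use \<epsilon> in simp)
  ultimately show ?thesis
    unfolding terminal_weight_def Let_def by (subst add.commute) (rule pos_def_add)
qed

text \<open>Let \<open>H = \<Sigma>N\<^sup>1\<^sup>/\<^sup>2\<close> and let \<open>X\<close> be the inner square root. Then \<open>Y = H\<^sup>-\<^sup>1 X H\<^sup>-\<^sup>1\<close>, and
\<open>Y \<Sigma>N Y = H\<^sup>-\<^sup>1 X\<^sup>2 H\<^sup>-\<^sup>1\<close> is \<open>\<Phi>\<^sup>-\<^sup>1 \<Sigma>0 \<Phi>\<^sup>-\<^sup>T\<close> by the choice of \<open>X\<close>.\<close>

lemma terminal_weight_transports: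
  fixes \<Phi> :: "real^'n^'n"
  assumes \<Phi>: "invertible \<Phi>" and \<Sigma>0: "pos_def \<Sigma>0" and \<Sigma>N: "pos_def \<Sigma>N"
  defines "V \<equiv> \<Phi> ** terminal_weight \<Phi> \<Sigma>0 \<Sigma>N 0"
  shows "V ** \<Sigma>N ** transpose V = \<Sigma>0"
proof -
  let ?H = "psd_sqrt \<Sigma>N" and ?Z = "psd_sqrt \<Sigma>N ** matrix_inv \<Phi> ** \<Sigma>0 ** transpose (matrix_inv \<Phi>) ** psd_sqrt \<Sigma>N"
  let ?Hi = "matrix_inv ?H" and ?Y = "terminal_weight \<Phi> \<Sigma>0 \<Sigma>N 0" and ?X = "psd_sqrt ?Z"
  note H = psd_sqrt_pos_def_facts[OF \<Sigma>N]
  have Y: "?Y = ?Hi ** ?X ** ?Hi" by (simp add: terminal_weight_def Let_def)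
  have "?Y ** \<Sigma>N ** ?Y = ?Y ** (?H ** ?H) ** ?Y" by (simp only: H(3))
  also have "\<dots> = ?Hi ** ?X ** (?Hi ** ?H) ** (?H ** ?Hi) ** ?X ** ?Hi"
    unfolding Y by (simp only: matrix_mul_assoc)
  also have "\<dots> = ?Hi ** (?X ** ?X) ** ?Hi"
    by (simp add: matrix_inv_inverse H(1) matrix_mul_assoc)
  also have "?X ** ?X = ?Z"
    by (intro psd_sqrt_square pos_def_imp_pos_semidef pos_def_terminal_middle assms)
  also have "?Hi ** ?Z ** ?Hi = (?Hi ** ?H) ** matrix_inv \<Phi> ** \<Sigma>0 ** transpose (matrix_inv \<Phi>) ** (?H ** ?Hi)"
    by (simp only: matrix_mul_assoc)
  also have "\<dots> = matrix_inv \<Phi> ** \<Sigma>0 ** transpose (matrix_inv \<Phi>)"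
    by (simp add: matrix_inv_inverse H(1))
  finally have YY: "?Y ** \<Sigma>N ** ?Y = matrix_inv \<Phi> ** \<Sigma>0 ** transpose (matrix_inv \<Phi>)" .
  have "transpose ?Y = ?Y"
    using pos_def_terminal_weight[OF \<Phi> \<Sigma>0 \<Sigma>N, of 0] by (simp add: pos_def_def)
  then have "V ** \<Sigma>N ** transpose V = \<Phi> ** (?Y ** \<Sigma>N ** ?Y) ** transpose \<Phi>"
    by (simp add: V_def matrix_transpose_mul matrix_mul_assoc)
  also have "\<dots> = (\<Phi> ** matrix_inv \<Phi>) ** \<Sigma>0 ** transpose (\<Phi> ** matrix_inv \<Phi>)"
    unfolding YY by (simp only: matrix_transpose_mul matrix_mul_assoc)
  also have "\<dots> = \<Sigma>0" by (simp add: matrix_inv_inverse \<Phi> transpose_mat)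
  finally show ?thesis .
qed

lemma terminal_weight_tendsto:
  fixes \<Phi> :: "real^'n^'n"
  assumes \<Phi>: "invertible \<Phi>" and \<Sigma>0: "pos_def \<Sigma>0" and \<Sigma>N: "pos_def \<Sigma>N"
  shows "(terminal_weight \<Phi> \<Sigma>0 \<Sigma>N \<longlongrightarrow> terminal_weight \<Phi> \<Sigma>0 \<Sigma>N 0) (at_right 0)"
proof -
  let ?Z = "psd_sqrt \<Sigma>N ** matrix_inv \<Phi> ** \<Sigma>0 ** transpose (matrix_inv \<Phi>) ** psd_sqrt \<Sigma>N"
  have id: "((\<lambda>\<epsilon>. \<epsilon>) \<longlongrightarrow> (0::real)) (at_right 0)" by (rule tendsto_ident_at)
  have "((\<lambda>\<epsilon>. \<epsilon>\<^sup>2 / 4) \<longlongrightarrow> 0\<^sup>2 / (4::real)) (at_right 0)" by (intro tendsto_intros id) simp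
  then have "((\<lambda>\<epsilon>. psd_sqrt ((\<epsilon>\<^sup>2 / 4) *\<^sub>R mat 1 + ?Z)) \<longlongrightarrow> psd_sqrt ?Z) (at_right 0)"
    by (intro psd_sqrt_shift_continuous pos_def_imp_pos_semidef pos_def_terminal_middle assms) simp_all
  then have "((\<lambda>\<epsilon>. psd_sqrt ((\<epsilon>\<^sup>2 / 4) *\<^sub>R mat 1 + ?Z))
      \<longlongrightarrow> psd_sqrt ((0\<^sup>2 / 4) *\<^sub>R mat 1 + ?Z)) (at_right 0)"
    by simp
  moreover have "((\<lambda>\<epsilon>. (\<epsilon> / 2) *\<^sub>R matrix_inv \<Sigma>N) \<longlongrightarrow> (0 / 2) *\<^sub>R matrix_inv \<Sigma>N) (at_right 0)"
    by (intro tendsto_intros id) simp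
  ultimately show ?thesis
    unfolding terminal_weight_def Let_def
    by (intro tendsto_add tendsto_matrix_mult tendsto_const)
qed

section \<open>Convergence of the Riccati solutions\<close>

context lq_system
begin

lemma terminal_value_eq: "terminal_value N A B S Q R \<Sigma>0 \<Sigma>N \<epsilon> = - reach_cost + terminal_weight \<phi>12 \<Sigma>0 \<Sigma>N \<epsilon>"
  by (simp add: terminal_value_def terminal_weight_def reach_cost_def Let_def add.assoc)

lemma terminal_value0_eq: "terminal_value0 N A B S Q R \<Sigma>0 \<Sigma>N = - reach_cost + terminal_weight \<phi>12 \<Sigma>0 \<Sigma>N 0"
  by (simp add: terminal_value0_def terminal_weight_def reach_cost_def Let_def)

lemma control_weight_tendsto:
  assumes "((\<lambda>\<epsilon>. P \<epsilon> (Suc k)) \<longlongrightarrow> P0 (Suc k)) F"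
  shows "((\<lambda>\<epsilon>. control_weight B R (P \<epsilon>) k) \<longlongrightarrow> control_weight B R P0 k) F"
  unfolding control_weight_def by (intro tendsto_add tendsto_const tendsto_matrix_mult) (simp add: assms)

lemma control_weight_inv_tendsto:
  assumes "((\<lambda>\<epsilon>. P \<epsilon> (Suc k)) \<longlongrightarrow> P0 (Suc k)) F"
    and "\<forall>\<^sub>F \<epsilon> in F. invertible (control_weight B R (P \<epsilon>) k)" "invertible (control_weight B R P0 k)"
  shows "((\<lambda>\<epsilon>. matrix_inv (control_weight B R (P \<epsilon>) k)) \<longlongrightarrow> matrix_inv (control_weight B R P0 k)) F"
  by (rule tendsto_matrix_inv[OF control_weight_tendsto]) (use assms in auto)

lemma gain_tendsto:
  assumes "((\<lambda>\<epsilon>. P \<epsilon> (Suc k)) \<longlongrightarrow> P0 (Suc k)) F"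
    and "\<forall>\<^sub>F \<epsilon> in F. invertible (control_weight B R (P \<epsilon>) k)" "invertible (control_weight B R P0 k)"
  shows "((\<lambda>\<epsilon>. gain A B S R (P \<epsilon>) k) \<longlongrightarrow> gain A B S R P0 k) F"
  unfolding gain_def
  by (intro tendsto_add tendsto_const tendsto_matrix_mult control_weight_inv_tendsto) (simp_all add: assms)

text \<open>Each backward step of the Riccati recursion is continuous where the control weight is invertible.\<close>

lemma riccati_tendsto:
  assumes ric: "\<forall>\<^sub>F \<epsilon> in F. riccati_solution N A B S Q R (P \<epsilon>)" and ric0: "riccati_solution N A B S Q R P0"
    and inv: "\<And>k. k < N \<Longrightarrow> \<forall>\<^sub>F \<epsilon> in F. invertible (control_weight B R (P \<epsilon>) k)"
    and inv0: "\<And>k. k < N \<Longrightarrow> invertible (control_weight B R P0 k)"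
    and lim: "((\<lambda>\<epsilon>. P \<epsilon> N) \<longlongrightarrow> P0 N) F" and "k \<le> N"
  shows "((\<lambda>\<epsilon>. P \<epsilon> k) \<longlongrightarrow> P0 k) F"
  using \<open>k \<le> N\<close>
proof (induction rule: inc_induct)
  case (step k)
  let ?G = "\<lambda>P :: nat \<Rightarrow> real^'n^'n. transpose (Ab k) ** P (k + 1) ** Ab k
        - transpose (Ab k) ** P (k + 1) ** B k ** matrix_inv (control_weight B R P k)
            ** transpose (B k) ** P (k + 1) ** Ab k + Qb k"
  have P: "((\<lambda>\<epsilon>. P \<epsilon> (k + 1)) \<longlongrightarrow> P0 (k + 1)) F" using step by simp
  have lim: "((\<lambda>\<epsilon>. ?G (P \<epsilon>)) \<longlongrightarrow> ?G P0) F"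
    by (intro tendsto_add tendsto_diff tendsto_const tendsto_matrix_mult control_weight_inv_tendsto P)
      (use step inv inv0 in auto)
  have ev: "\<forall>\<^sub>F \<epsilon> in F. ?G (P \<epsilon>) = P \<epsilon> k"
    using ric by eventually_elim (use step in \<open>simp add: riccati_solution_def\<close>)
  have "?G P0 = P0 k" using ric0 step by (simp add: riccati_solution_def)
  then show ?case using Lim_transform_eventually[OF lim ev] by (simp only:)
qed (fact lim)

end

lemma policy_mean_cov:
  assumes "pos_def (control_weight B R P k)" "0 < \<epsilon>"
  shows "density_mean (policy A B S R P \<epsilon> k x) = - (gain A B S R P k *v x)"
    and "density_cov (policy A B S R P \<epsilon> k x) = \<epsilon> *\<^sub>R matrix_inv (control_weight B R P k)"
  unfolding policy_def
  by (intro gaussian_density_mean gaussian_density_cov pos_def_scaleR pos_def_matrix_inv assms)+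

section \<open>Square-integrable random vectors\<close>

definition sq_integrable :: "'w measure \<Rightarrow> ('w \<Rightarrow> real^'d) \<Rightarrow> bool" where
  "sq_integrable \<Omega> f \<longleftrightarrow> f \<in> borel_measurable \<Omega> \<and> integrable \<Omega> (\<lambda>\<omega>. (norm (f \<omega>))\<^sup>2)"

lemma sq_integrable_measurable: "sq_integrable \<Omega> f \<Longrightarrow> f \<in> borel_measurable \<Omega>"
  by (simp add: sq_integrable_def)

lemma sq_integrable_inner_integrable:
  assumes "sq_integrable \<Omega> f" "sq_integrable \<Omega> g"
  shows "integrable \<Omega> (\<lambda>\<omega>. f \<omega> \<bullet> g \<omega>)"
proof (rule Bochner_Integration.integrable_bound)
  show "integrable \<Omega> (\<lambda>\<omega>. (norm (f \<omega>))\<^sup>2 + (norm (g \<omega>))\<^sup>2)" using assms by (simp add: sq_integrable_def)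
  show "(\<lambda>\<omega>. f \<omega> \<bullet> g \<omega>) \<in> borel_measurable \<Omega>"
    by (intro borel_measurable_inner sq_integrable_measurable assms)
  have "\<bar>x \<bullet> y\<bar> \<le> (norm x)\<^sup>2 + (norm y)\<^sup>2" for x y :: "real^'b"
  proof -
    have "\<bar>x \<bullet> y\<bar> \<le> norm x * norm y" by (rule Cauchy_Schwarz_ineq2)
    also have "\<dots> \<le> (norm x)\<^sup>2 + (norm y)\<^sup>2"
    proof -
      have "0 \<le> norm x * norm y" by simp
      then show ?thesis using sum_squares_bound[of "norm x" "norm y"] by linarith
    qed
    finally show ?thesis .
  qed
  then show "AE \<omega> in \<Omega>. norm (f \<omega> \<bullet> g \<omega>) \<le> norm ((norm (f \<omega>))\<^sup>2 + (norm (g \<omega>))\<^sup>2)"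
    by (intro always_eventually) (simp add: abs_of_nonneg)
qed

lemma sq_integrable_add:
  assumes "sq_integrable \<Omega> f" "sq_integrable \<Omega> g"
  shows "sq_integrable \<Omega> (\<lambda>\<omega>. f \<omega> + g \<omega>)"
proof -
  have "(norm (f \<omega> + g \<omega>))\<^sup>2 = (norm (f \<omega>))\<^sup>2 + 2 * (f \<omega> \<bullet> g \<omega>) + (norm (g \<omega>))\<^sup>2" for \<omega>
    by (simp add: power2_norm_eq_inner inner_add_left inner_add_right inner_commute)
  moreover have "(\<lambda>\<omega>. f \<omega> + g \<omega>) \<in> borel_measurable \<Omega>"
    by (intro borel_measurable_add sq_integrable_measurable assms)
  ultimately show ?thesis using sq_integrable_inner_integrable[OF assms] assms by (simp add: sq_integrable_def)
qed

lemma sq_integrable_mult_vec: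
  fixes C :: "real^'a^'b"
  assumes "sq_integrable \<Omega> f" shows "sq_integrable \<Omega> (\<lambda>\<omega>. C *v f \<omega>)"
  unfolding sq_integrable_def
proof
  show m: "(\<lambda>\<omega>. C *v f \<omega>) \<in> borel_measurable \<Omega>"
    by (rule measurable_compose[OF sq_integrable_measurable[OF assms] matrix_vector_mult_measurable])
  show "integrable \<Omega> (\<lambda>\<omega>. (norm (C *v f \<omega>))\<^sup>2)"
  proof (rule Bochner_Integration.integrable_bound)
    let ?K = "onorm ((*v) C)"
    show "integrable \<Omega> (\<lambda>\<omega>. ?K\<^sup>2 * (norm (f \<omega>))\<^sup>2)" using assms by (simp add: sq_integrable_def)
    have "(norm (C *v x))\<^sup>2 \<le> ?K\<^sup>2 * (norm x)\<^sup>2" for x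
      using onorm[OF matrix_vector_mul_bounded_linear, of C x]
      by (metis norm_ge_zero power_mono power_mult_distrib)
    then show "AE \<omega> in \<Omega>. norm ((norm (C *v f \<omega>))\<^sup>2) \<le> norm (?K\<^sup>2 * (norm (f \<omega>))\<^sup>2)"
      by (intro always_eventually) (simp add: abs_of_nonneg)
  qed (use m in simp)
qed


section \<open>The information available to the controller\<close>

lemma
  shows space_state_sigma: "space (state_sigma \<Omega> x k) = space \<Omega>"
    and sets_state_sigma: "sets (state_sigma \<Omega> x k)
      = sigma_sets (space \<Omega>) (\<Union>i\<le>k. {x i -` E \<inter> space \<Omega> | E. E \<in> sets borel})"
proof -
  have "(\<Union>i\<le>k. {x i -` E \<inter> space \<Omega> | E. E \<in> sets borel}) \<subseteq> Pow (space \<Omega>)" by auto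
  then show "space (state_sigma \<Omega> x k) = space \<Omega>" "sets (state_sigma \<Omega> x k)
      = sigma_sets (space \<Omega>) (\<Union>i\<le>k. {x i -` E \<inter> space \<Omega> | E. E \<in> sets borel})"
    by (simp_all add: state_sigma_def space_measure_of sets_measure_of)
qed

lemma state_sigma_measurable_imp:
  assumes x: "\<And>i. i \<le> k \<Longrightarrow> x i \<in> borel_measurable \<Omega>"
    and f: "f \<in> borel_measurable (state_sigma \<Omega> x k)"
  shows "f \<in> borel_measurable \<Omega>"
proof -
  have "sets (state_sigma \<Omega> x k) \<subseteq> sets \<Omega>"
    unfolding sets_state_sigma
    by (rule sets.sigma_sets_subset) (auto intro!: measurable_sets[OF x])
  then show ?thesis
    using f unfolding measurable_def space_state_sigma by auto
qed

lemma state_sigma_state_measurable: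
  fixes x :: "nat \<Rightarrow> 'w \<Rightarrow> real^'n"
  assumes "i \<le> k"
  shows "x i \<in> borel_measurable (state_sigma \<Omega> x k)"
proof (rule measurableI)
  fix E :: "(real^'n) set" assume "E \<in> sets borel"
  then show "x i -` E \<inter> space (state_sigma \<Omega> x k) \<in> sets (state_sigma \<Omega> x k)"
    unfolding sets_state_sigma space_state_sigma using assms by (intro sigma_sets.Basic) auto
qed simp

text \<open>Admissibility refers to the information generated by the states, and the states in turn are driven by
the control, so measurability and square integrability of both are obtained together by induction
on time.\<close>

lemma admissible_sq_integrable:
  assumes x0: "sq_integrable \<Omega> x0" and adm: "admissible \<Omega> N A B x0 u"
  shows "k \<le> N \<Longrightarrow> sq_integrable \<Omega> (state A B x0 u k)" and "k < N \<Longrightarrow> sq_integrable \<Omega> (u k)"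
proof -
  have u: "sq_integrable \<Omega> (u k)" if "k < N" "\<And>i. i \<le> k \<Longrightarrow> sq_integrable \<Omega> (state A B x0 u i)" for k
    using adm that unfolding admissible_def sq_integrable_def
    by (auto intro!: state_sigma_measurable_imp[of k "state A B x0 u" \<Omega> "u k"])
  have x: "\<forall>i\<le>k. sq_integrable \<Omega> (state A B x0 u i)" if "k \<le> N" for k
    using that
  proof (induction k)
    case (Suc k)
    then have IH: "\<And>i. i \<le> k \<Longrightarrow> sq_integrable \<Omega> (state A B x0 u i)" and k: "k < N" by auto
    have "sq_integrable \<Omega> (state A B x0 u (Suc k))"
      unfolding state.simps by (intro sq_integrable_add sq_integrable_mult_vec IH u k) simp
    then show ?case using IH by (auto simp: le_Suc_eq)
  qed (simp add: x0)
  show "sq_integrable \<Omega> (state A B x0 u k)" if "k \<le> N" using x[OF that] by simp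
  show "sq_integrable \<Omega> (u k)" if "k < N" using u[OF that] x[of k] that by simp
qed

section \<open>The optimal control\<close>

context lq_system
begin

definition stage_cost :: "nat \<Rightarrow> real^'n \<Rightarrow> real^'m \<Rightarrow> real" where
  "stage_cost k x u = block_vec x u \<bullet> (block_mat (Q k) (S k) (transpose (S k)) (R k) *v block_vec x u)"

text \<open>The shift \<open>w = u + R\<^sup>-\<^sup>1 S\<^sup>T x\<close> removes the cross term \<open>S\<close> from the cost.\<close>

lemma stage_cost_eq:
  fixes x :: "real^'n" and u :: "real^'m"
  assumes k: "k < N"
  defines "w \<equiv> u + Ri k *v (transpose (S k) *v x)"
  shows "stage_cost k x u = x \<bullet> (Qb k *v x) + w \<bullet> (R k *v w)"
    and "A k *v x + B k *v u = Ab k *v x + B k *v w"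
proof -
  define s where "s = transpose (S k) *v x"
  have Rr: "R k *v (Ri k *v s) = s"
    by (rule matrix_inv_mult_vec(1)[OF pos_def_invertible[OF R_pos_def[OF k]]])
  have St: "x \<bullet> (S k *v z) = s \<bullet> z" for z
    unfolding s_def using inner_matrix_vector_transpose[of "transpose (S k)" x z] by simp
  have Qbx: "x \<bullet> (Qb k *v x) = x \<bullet> (Q k *v x) - s \<bullet> (Ri k *v s)"
  proof -
    have "Qb k *v x = Q k *v x - S k *v (Ri k *v s)"
      by (simp add: Q_bar_def s_def matrix_vector_mult_diff_rdistrib matrix_vector_mul_assoc matrix_mul_assoc
          del: transpose_matrix_vector)
    then show ?thesis by (simp add: inner_diff_right St)
  qed
  have "(Ri k *v s) \<bullet> (R k *v u) = s \<bullet> u"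
    using R_sym[OF k, of "Ri k *v s" u] by (simp add: Rr)
  then have "w \<bullet> (R k *v w) = u \<bullet> (R k *v u) + 2 * (s \<bullet> u) + s \<bullet> (Ri k *v s)"
    by (simp add: w_def s_def[symmetric] matrix_vector_right_distrib Rr inner_add_left inner_add_right inner_commute
        del: transpose_matrix_vector)
  moreover have "stage_cost k x u = x \<bullet> (Q k *v x) + 2 * (s \<bullet> u) + u \<bullet> (R k *v u)"
    by (simp add: stage_cost_def block_mat_mult_vec block_vec_inner inner_add_right St s_def[symmetric] inner_commute[of u s]
        del: transpose_matrix_vector)
  ultimately show "stage_cost k x u = x \<bullet> (Qb k *v x) + w \<bullet> (R k *v w)"
    unfolding Qbx by simp
  show "A k *v x + B k *v u = Ab k *v x + B k *v w"
    by (simp add: A_bar_def w_def matrix_vector_mult_diff_rdistrib matrix_vector_right_distrib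
        matrix_vector_mul_assoc matrix_mul_assoc del: transpose_matrix_vector)
qed

abbreviation deviation_cost :: "(nat \<Rightarrow> real^'n^'n) \<Rightarrow> nat \<Rightarrow> real^'n \<Rightarrow> real^'m \<Rightarrow> real" where
  "deviation_cost P k x u \<equiv>
     (u + gain A B S R P k *v x) \<bullet> (control_weight B R P k *v (u + gain A B S R P k *v x))"

lemma stage_cost_completes_square:
  assumes ric: "riccati_solution N A B S Q R P" and k: "k < N"
    and sym: "transpose (P (Suc k)) = P (Suc k)" and inv: "invertible (control_weight B R P k)"
    and x': "x' = A k *v x + B k *v u"
  shows "stage_cost k x u = x \<bullet> (P k *v x) - x' \<bullet> (P (Suc k) *v x') + deviation_cost P k x u"
  using riccati_completes_square[OF ric k sym inv x'[unfolded stage_cost_eq(2)[OF k]]]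
  by (simp add: stage_cost_eq(1)[OF k] gain_mult_vec[OF k inv] add_ac del: transpose_matrix_vector)

text \<open>The completed squares telescope. The first two terms depend on the control only through the law of
the terminal state, which is the same for all feasible controls.\<close>

lemma cost_decomposition:
  assumes ric: "riccati_solution N A B S Q R P"
    and W: "\<And>k. k < N \<Longrightarrow> pos_def (control_weight B R P k)"
    and sym: "\<And>k. k \<le> N \<Longrightarrow> transpose (P k) = P k"
    and x: "\<And>k. k \<le> N \<Longrightarrow> sq_integrable \<Omega> (state A B x0 u k)" and u: "\<And>k. k < N \<Longrightarrow> sq_integrable \<Omega> (u k)"
  shows "cost \<Omega> N A B S Q R x0 u =
    1 / 2 * ((LINT \<omega>|\<Omega>. x0 \<omega> \<bullet> (P 0 *v x0 \<omega>))
      - (LINT \<omega>|\<Omega>. state A B x0 u N \<omega> \<bullet> (P N *v state A B x0 u N \<omega>))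
      + (\<Sum>k<N. LINT \<omega>|\<Omega>. deviation_cost P k (state A B x0 u k \<omega>) (u k \<omega>)))"
proof -
  let ?x = "state A B x0 u"
  let ?e = "\<lambda>k \<omega>. ?x k \<omega> \<bullet> (P k *v ?x k \<omega>)"
  let ?d = "\<lambda>k \<omega>. deviation_cost P k (?x k \<omega>) (u k \<omega>)"
  have e: "integrable \<Omega> (?e k)" if "k \<le> N" for k
    by (intro sq_integrable_inner_integrable sq_integrable_mult_vec x that)
  have d: "integrable \<Omega> (?d k)" if "k < N" for k
    by (intro sq_integrable_inner_integrable sq_integrable_mult_vec sq_integrable_add x u) (use that in auto)
  have stage: "stage_cost k (?x k \<omega>) (u k \<omega>) = ?e k \<omega> - ?e (Suc k) \<omega> + ?d k \<omega>" if "k < N" for k \<omega>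
    by (rule stage_cost_completes_square[OF ric that]) (use that sym W pos_def_invertible in auto)
  have "(\<Sum>k<N. stage_cost k (?x k \<omega>) (u k \<omega>)) = ?e 0 \<omega> - ?e N \<omega> + (\<Sum>k<N. ?d k \<omega>)" for \<omega>
  proof -
    have "(\<Sum>k<N. stage_cost k (?x k \<omega>) (u k \<omega>)) = (\<Sum>k<N. (?e k \<omega> - ?e (Suc k) \<omega>) + ?d k \<omega>)"
      by (rule sum.cong) (auto simp: stage)
    also have "\<dots> = (\<Sum>k<N. ?e k \<omega> - ?e (Suc k) \<omega>) + (\<Sum>k<N. ?d k \<omega>)" by (rule sum.distrib)
    also have "(\<Sum>k<N. ?e k \<omega> - ?e (Suc k) \<omega>) = ?e 0 \<omega> - ?e N \<omega>" by (rule sum_lessThan_telescope')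
    finally show ?thesis .
  qed
  then have "cost \<Omega> N A B S Q R x0 u = (LINT \<omega>|\<Omega>. 1 / 2 * (?e 0 \<omega> - ?e N \<omega> + (\<Sum>k<N. ?d k \<omega>)))"
    unfolding cost_def Let_def stage_cost_def[symmetric] sum_distrib_left[symmetric] by (simp only:)
  also have "\<dots> = 1 / 2 * (LINT \<omega>|\<Omega>. (?e 0 \<omega> - ?e N \<omega>) + (\<Sum>k<N. ?d k \<omega>))"
    by (rule integral_mult_right_zero)
  also have "(LINT \<omega>|\<Omega>. (?e 0 \<omega> - ?e N \<omega>) + (\<Sum>k<N. ?d k \<omega>))
      = (LINT \<omega>|\<Omega>. ?e 0 \<omega> - ?e N \<omega>) + (LINT \<omega>|\<Omega>. (\<Sum>k<N. ?d k \<omega>))"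
    by (intro Bochner_Integration.integral_add Bochner_Integration.integrable_diff Bochner_Integration.integrable_sum e d) auto
  also have "(LINT \<omega>|\<Omega>. ?e 0 \<omega> - ?e N \<omega>) = (LINT \<omega>|\<Omega>. ?e 0 \<omega>) - (LINT \<omega>|\<Omega>. ?e N \<omega>)"
    by (intro Bochner_Integration.integral_diff e) auto
  also have "(LINT \<omega>|\<Omega>. (\<Sum>k<N. ?d k \<omega>)) = (\<Sum>k<N. LINT \<omega>|\<Omega>. ?d k \<omega>)"
    by (intro Bochner_Integration.integral_sum d) auto
  finally show ?thesis by simp
qed

lemma deviation_cost_nonneg:
  "pos_def (control_weight B R P k) \<Longrightarrow> 0 \<le> deviation_cost P k x u"
  using pos_def_imp_pos_semidef by (auto simp: pos_semidef_def)

primrec closed_loop :: "(nat \<Rightarrow> real^'n^'n) \<Rightarrow> nat \<Rightarrow> real^'n^'n" where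
  "closed_loop P 0 = mat 1"
| "closed_loop P (Suc k) = (A k - B k ** gain A B S R P k) ** closed_loop P k"

text \<open>Stated through the closed-loop map, since a control is a process on the sample space and not a
function of the state; \<open>state_feedback_control\<close> identifies the two descriptions.\<close>

definition feedback_control :: "(nat \<Rightarrow> real^'n^'n) \<Rightarrow> ('w \<Rightarrow> real^'n) \<Rightarrow> nat \<Rightarrow> 'w \<Rightarrow> real^'m" where
  "feedback_control P x0 k \<omega> = - (gain A B S R P k *v (closed_loop P k *v x0 \<omega>))"

lemma state_feedback_control:
  "state A B x0 (feedback_control P x0) k \<omega> = closed_loop P k *v x0 \<omega>"
  by (induction k arbitrary: \<omega>)
    (simp_all add: feedback_control_def matrix_vector_mult_diff_rdistrib matrix_vector_mult_minus_right
      matrix_vector_mul_assoc[symmetric])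

text \<open>The closed-loop map \<open>T\<close> from \<open>x 0\<close> to \<open>x N\<close> is inverted by \<open>\<phi>12 Y\<close>, and \<open>\<phi>12 Y\<close> transports \<open>\<Sigma>N\<close> to \<open>\<Sigma>0\<close>.\<close>

lemma closed_loop_transports:
  assumes ric: "riccati_solution N A B S Q R P"
    and inv: "\<And>k. k < N \<Longrightarrow> invertible (control_weight B R P k)"
    and PN: "P N = - reach_cost + terminal_weight \<phi>12 \<Sigma>0 \<Sigma>N 0"
    and \<Sigma>: "pos_def \<Sigma>0" "pos_def \<Sigma>N"
  shows "invertible (closed_loop P N)"
    and "closed_loop P N ** \<Sigma>0 ** transpose (closed_loop P N) = \<Sigma>N"
proof -
  let ?T = "closed_loop P N" and ?Y = "terminal_weight \<phi>12 \<Sigma>0 \<Sigma>N 0"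
  let ?V = "\<phi>12 ** ?Y"
  have "?V *v (?T *v \<xi>) = \<xi>" for \<xi>
  proof -
    define x where "x k = closed_loop P k *v \<xi>" for k
    have "x (Suc k) = Ab k *v x k - B k *v (feedback P k *v x k)" if k: "k < N" for k
    proof -
      have "x (Suc k) = A k *v x k + B k *v (- (gain A B S R P k *v x k))"
        by (simp add: x_def matrix_vector_mult_diff_rdistrib matrix_vector_mult_minus_right
            matrix_vector_mul_assoc[symmetric])
      also have "\<dots> = Ab k *v x k - B k *v (feedback P k *v x k)"
        unfolding stage_cost_eq(2)[OF k] gain_mult_vec[OF k inv[OF k]]
        by (simp add: matrix_vector_mult_minus_right del: transpose_matrix_vector)
      finally show ?thesis .
    qed
    from closed_loop_initial_state[OF ric PN inv this]
    show ?thesis by (simp add: x_def matrix_vector_mul_assoc matrix_mul_assoc)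
  qed
  then have VT: "?V ** ?T = mat 1" by (simp add: matrix_eq matrix_vector_mul_assoc)
  then show "invertible ?T" using invertible_left_inverse by blast
  have TV: "?T ** ?V = mat 1" using VT matrix_left_right_inverse by blast
  have "?T ** \<Sigma>0 ** transpose ?T = ?T ** (?V ** \<Sigma>N ** transpose ?V) ** transpose ?T"
    using terminal_weight_transports[OF phi12_invertible \<Sigma>] by simp
  also have "\<dots> = (?T ** ?V) ** \<Sigma>N ** transpose (?T ** ?V)"
    by (simp only: matrix_transpose_mul matrix_mul_assoc)
  also have "\<dots> = \<Sigma>N" by (simp add: TV transpose_mat)
  finally show "?T ** \<Sigma>0 ** transpose ?T = \<Sigma>N" .
qed

text \<open>On feasible controls the cost is a constant plus a nonnegative sum, which vanishes for the feedback
control. A second optimal control has deviation \<open>0\<close> almost surely at each time, and induction on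
time then identifies its states, and hence its values, with those of the feedback control.\<close>

lemma feedback_control_optimal:
  fixes \<Omega> :: "'w measure" and x0 :: "'w \<Rightarrow> real^'n"
  assumes ric: "riccati_solution N A B S Q R P"
    and PN: "P N = - reach_cost + terminal_weight \<phi>12 \<Sigma>0 \<Sigma>N 0"
    and \<Sigma>0: "pos_def \<Sigma>0" and \<Sigma>N: "pos_def \<Sigma>N"
    and x0: "distributed \<Omega> lborel x0 (\<lambda>x. ennreal (gaussian_density 0 \<Sigma>0 x))"
  shows "optimal_control \<Omega> N A B S Q R \<Sigma>N x0 (feedback_control P x0)"
    and "optimal_control \<Omega> N A B S Q R \<Sigma>N x0 v \<Longrightarrow> k < N \<Longrightarrow> AE \<omega> in \<Omega>. v k \<omega> = feedback_control P x0 k \<omega>"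
proof -
  let ?u = "feedback_control P x0"
  have Y: "pos_def (terminal_weight \<phi>12 \<Sigma>0 \<Sigma>N 0)"
    by (rule pos_def_terminal_weight[OF phi12_invertible \<Sigma>0 \<Sigma>N]) simp
  have W: "pos_def (control_weight B R P k)" if "k < N" for k
    using riccati_control_weight_pos_def[OF ric PN Y, of 0] that by simp
  have inv: "invertible (control_weight B R P k)" if "k < N" for k
    by (rule pos_def_invertible[OF W[OF that]])
  have sym: "transpose (P k) = P k" if "k \<le> N" for k
    using riccati_control_weight_pos_def[OF ric PN Y that] by simp
  have x0_sq: "sq_integrable \<Omega> x0"
    using distributed_measurable[OF x0] gaussian_square_integrable[OF \<Sigma>0 x0] by (simp add: sq_integrable_def)
  have feas: "feasible \<Omega> N A B \<Sigma>N x0 ?u"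
    unfolding feasible_def admissible_def
  proof (intro conjI allI impI)
    fix k assume "k < N"
    have "?u k = (\<lambda>\<omega>. - (gain A B S R P k *v state A B x0 ?u k \<omega>))"
      by (simp add: fun_eq_iff state_feedback_control feedback_control_def)
    moreover have "(\<lambda>\<omega>. - (gain A B S R P k *v state A B x0 ?u k \<omega>)) \<in> borel_measurable (state_sigma \<Omega> (state A B x0 ?u) k)"
      by (intro borel_measurable_uminus measurable_compose[OF state_sigma_state_measurable matrix_vector_mult_measurable]) simp
    ultimately show "?u k \<in> borel_measurable (state_sigma \<Omega> (state A B x0 ?u) k)" by simp
    have "sq_integrable \<Omega> (\<lambda>\<omega>. gain A B S R P k *v (closed_loop P k *v x0 \<omega>))"
      by (intro sq_integrable_mult_vec x0_sq)
    then show "integrable \<Omega> (\<lambda>\<omega>. (norm (?u k \<omega>))\<^sup>2)" by (simp add: sq_integrable_def feedback_control_def)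
  next
    have "state A B x0 ?u N = (\<lambda>\<omega>. closed_loop P N *v x0 \<omega>)"
      by (simp add: fun_eq_iff state_feedback_control)
    then show "distributed \<Omega> lborel (state A B x0 ?u N) (\<lambda>x. ennreal (gaussian_density 0 \<Sigma>N x))"
      using gaussian_linear_image[OF pos_def_invertible[OF \<Sigma>0] closed_loop_transports(1)[OF ric inv PN \<Sigma>0 \<Sigma>N] x0]
        closed_loop_transports(2)[OF ric inv PN \<Sigma>0 \<Sigma>N] by simp
  qed
  \<comment> \<open>the constant part of the cost, with the terminal expectation computed from the prescribed law\<close>
  define C where "C = 1 / 2 * ((LINT \<omega>|\<Omega>. x0 \<omega> \<bullet> (P 0 *v x0 \<omega>))
      - (LINT x|lborel. gaussian_density 0 \<Sigma>N x * (x \<bullet> (P N *v x))))"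
  define D where "D v k = (LINT \<omega>|\<Omega>. deviation_cost P k (state A B x0 v k \<omega>) (v k \<omega>))" for v k
  have cost: "cost \<Omega> N A B S Q R x0 v = C + 1 / 2 * (\<Sum>k<N. D v k)" if v: "feasible \<Omega> N A B \<Sigma>N x0 v" for v
  proof -
    have adm: "admissible \<Omega> N A B x0 v"
      and xN: "distributed \<Omega> lborel (state A B x0 v N) (\<lambda>x. ennreal (gaussian_density 0 \<Sigma>N x))"
      using v by (auto simp: feasible_def)
    have "(LINT \<omega>|\<Omega>. state A B x0 v N \<omega> \<bullet> (P N *v state A B x0 v N \<omega>))
        = (LINT x|lborel. gaussian_density 0 \<Sigma>N x * (x \<bullet> (P N *v x)))"
      using pos_def_det_pos[OF \<Sigma>N]
      by (intro distributed_integral[OF xN, symmetric]) (auto intro: gaussian_density_nonneg)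
    then show ?thesis
      using cost_decomposition[OF ric W sym admissible_sq_integrable(1)[OF x0_sq adm] admissible_sq_integrable(2)[OF x0_sq adm]]
      by (simp add: C_def D_def algebra_simps)
  qed
  have Dnn: "0 \<le> D v k" if "k < N" for v k
    unfolding D_def by (intro integral_nonneg_AE always_eventually allI deviation_cost_nonneg W that)
  have Dsum: "0 \<le> (\<Sum>k<N. D v k)" for v
    by (rule sum_nonneg) (simp add: Dnn)
  have "D ?u k = 0" for k
    by (simp add: D_def state_feedback_control feedback_control_def)
  then have cu: "cost \<Omega> N A B S Q R x0 ?u = C" using cost[OF feas] by simp
  show "optimal_control \<Omega> N A B S Q R \<Sigma>N x0 ?u"
    unfolding optimal_control_def
  proof (intro conjI allI impI feas)
    fix v assume "feasible \<Omega> N A B \<Sigma>N x0 v"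
    from cost[OF this] Dsum[of v] show "cost \<Omega> N A B S Q R x0 ?u \<le> cost \<Omega> N A B S Q R x0 v"
      unfolding cu by simp
  qed
  show "AE \<omega> in \<Omega>. v k \<omega> = ?u k \<omega>" if opt: "optimal_control \<Omega> N A B S Q R \<Sigma>N x0 v" and "k < N"
  proof -
    have v: "feasible \<Omega> N A B \<Sigma>N x0 v" and le: "cost \<Omega> N A B S Q R x0 v \<le> cost \<Omega> N A B S Q R x0 ?u"
      using opt feas by (auto simp: optimal_control_def)
    then have adm: "admissible \<Omega> N A B x0 v" by (simp add: feasible_def)
    have "(\<Sum>k<N. D v k) = 0" using le cost[OF v] cu Dsum[of v] by simp
    then have D0: "D v k = 0" if "k < N" for k
      using that by (subst (asm) sum_nonneg_eq_0_iff) (auto simp: Dnn)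
    have fb: "AE \<omega> in \<Omega>. v k \<omega> = - (gain A B S R P k *v state A B x0 v k \<omega>)" if k: "k < N" for k
    proof -
      let ?d = "\<lambda>\<omega>. deviation_cost P k (state A B x0 v k \<omega>) (v k \<omega>)"
      have "integrable \<Omega> ?d"
        by (intro sq_integrable_inner_integrable sq_integrable_mult_vec sq_integrable_add admissible_sq_integrable[OF x0_sq adm]) (use k in auto)
      then have "AE \<omega> in \<Omega>. ?d \<omega> = 0"
        using D0[OF k] deviation_cost_nonneg[where P=P, OF W[OF k]]
        by (subst integral_nonneg_eq_0_iff_AE[symmetric]) (auto simp: D_def)
      then show ?thesis
      proof eventually_elim
        case (elim \<omega>)
        then have "v k \<omega> + gain A B S R P k *v state A B x0 v k \<omega> = 0"
          using W[OF k] unfolding pos_def_def by (metis less_irrefl)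
        then show ?case by (simp add: eq_neg_iff_add_eq_0)
      qed
    qed
    have st: "AE \<omega> in \<Omega>. state A B x0 v j \<omega> = closed_loop P j *v x0 \<omega>" if "j \<le> N" for j
      using that
    proof (induction j)
      case (Suc j)
      then have "AE \<omega> in \<Omega>. state A B x0 v j \<omega> = closed_loop P j *v x0 \<omega>" by simp
      moreover have "AE \<omega> in \<Omega>. v j \<omega> = - (gain A B S R P j *v state A B x0 v j \<omega>)"
        using fb[of j] Suc.prems by simp
      ultimately show ?case
      proof eventually_elim
        case (elim \<omega>)
        then show ?case
          by (simp add: matrix_vector_mult_diff_rdistrib matrix_vector_mult_minus_right
              matrix_vector_mul_assoc[symmetric])
      qed
    qed simp
    have "AE \<omega> in \<Omega>. state A B x0 v k \<omega> = closed_loop P k *v x0 \<omega>" using st \<open>k < N\<close> by simp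
    with fb[OF \<open>k < N\<close>] show ?thesis
      by eventually_elim (simp add: feedback_control_def)
  qed
qed

end

section \<open>The zero-noise limit\<close>

theorem theorem2:
  fixes N :: nat
    and A :: "nat \<Rightarrow> real^'n^'n" and B S :: "nat \<Rightarrow> real^'m^'n"
    and Q :: "nat \<Rightarrow> real^'n^'n" and R :: "nat \<Rightarrow> real^'m^'m"
    and \<Sigma>0 \<Sigma>N :: "real^'n^'n"
    and P :: "real \<Rightarrow> nat \<Rightarrow> real^'n^'n" and P0 :: "nat \<Rightarrow> real^'n^'n"
    and \<Omega> :: "'w measure" and x0 :: "'w \<Rightarrow> real^'n"
  assumes "1 \<le> N"
    and "\<And>k. k < N \<Longrightarrow> transpose (Q k) = Q k"
    and "\<And>k. k < N \<Longrightarrow> pos_def (R k)"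
    and "\<And>k. k < N \<Longrightarrow> pos_semidef (Q_bar S Q R k)"
    and "pos_def \<Sigma>0" and "pos_def \<Sigma>N"
    and A1: "\<And>k. k < N \<Longrightarrow> invertible (A_bar A B S R k)"
    and A2: "\<exists>kr\<in>{1..N}. (\<forall>k\<in>{kr..N}. invertible (reach_gramian A B S R k 0))
                       \<and> (\<forall>k\<in>{0..kr}. invertible (reach_gramian A B S R N k))"
    and "\<And>\<epsilon>. 0 < \<epsilon> \<Longrightarrow> riccati_solution N A B S Q R (P \<epsilon>)
                    \<and> P \<epsilon> N = terminal_value N A B S Q R \<Sigma>0 \<Sigma>N \<epsilon>"
    and "riccati_solution N A B S Q R P0 \<and> P0 N = terminal_value0 N A B S Q R \<Sigma>0 \<Sigma>N"
    and "prob_space \<Omega>"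
    and "distributed \<Omega> lborel x0 (\<lambda>x. ennreal (gaussian_density 0 \<Sigma>0 x))"
  shows "(\<forall>\<epsilon>>0. \<forall>k<N. pos_def (control_weight B R (P \<epsilon>) k))
       \<and> (\<forall>k<N. pos_def (control_weight B R P0 k))
       \<and> (\<exists>u. (\<forall>k<N. \<forall>\<omega>. u k \<omega> = - (gain A B S R P0 k *v state A B x0 u k \<omega>))
            \<and> optimal_control \<Omega> N A B S Q R \<Sigma>N x0 u
            \<and> (\<forall>v. optimal_control \<Omega> N A B S Q R \<Sigma>N x0 v
                   \<longrightarrow> (\<forall>k<N. AE \<omega> in \<Omega>. v k \<omega> = u k \<omega>)))
       \<and> (\<forall>k<N. \<forall>x. ((\<lambda>\<epsilon>. density_mean (policy A B S R (P \<epsilon>) \<epsilon> k x))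
                        \<longlongrightarrow> - (gain A B S R P0 k *v x)) (at_right 0)
                   \<and> ((\<lambda>\<epsilon>. density_cov (policy A B S R (P \<epsilon>) \<epsilon> k x)) \<longlongrightarrow> 0) (at_right 0))"
proof -
  interpret lq_system N A B S Q R
    using assms(1,3,4) A1 A2 by unfold_locales auto
  let ?Y = "terminal_weight \<phi>12 \<Sigma>0 \<Sigma>N"
  note \<Sigma> = \<open>pos_def \<Sigma>0\<close> \<open>pos_def \<Sigma>N\<close>
  have Y: "pos_def (?Y \<epsilon>)" if "0 \<le> \<epsilon>" for \<epsilon>
    by (rule pos_def_terminal_weight[OF phi12_invertible \<Sigma> that])
  have ric: "riccati_solution N A B S Q R (P \<epsilon>)" "P \<epsilon> N = - reach_cost + ?Y \<epsilon>" if "0 < \<epsilon>" for \<epsilon>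
    using assms(9)[OF that] by (simp_all add: terminal_value_eq)
  have ric0: "riccati_solution N A B S Q R P0" "P0 N = - reach_cost + ?Y 0"
    using assms(10) by (simp_all add: terminal_value0_eq)
  have pd: "pos_def (control_weight B R (P \<epsilon>) k)" if "0 < \<epsilon>" "k < N" for \<epsilon> k
    using riccati_control_weight_pos_def[OF ric[OF that(1)] Y, of 0] that by simp
  have pd0: "pos_def (control_weight B R P0 k)" if "k < N" for k
    using riccati_control_weight_pos_def[OF ric0 Y, of 0] that by simp
  have pos: "\<forall>\<^sub>F \<epsilon> in at_right 0. 0 < (\<epsilon>::real)" by (rule eventually_at_right_less)
  have inv: "\<forall>\<^sub>F \<epsilon> in at_right 0. invertible (control_weight B R (P \<epsilon>) k)" if "k < N" for k
    using pos by eventually_elim (rule pos_def_invertible[OF pd[OF _ that]])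
  have inv0: "invertible (control_weight B R P0 k)" if "k < N" for k
    by (rule pos_def_invertible[OF pd0[OF that]])
  have "((\<lambda>\<epsilon>. - reach_cost + ?Y \<epsilon>) \<longlongrightarrow> - reach_cost + ?Y 0) (at_right 0)"
    by (intro tendsto_add tendsto_const terminal_weight_tendsto phi12_invertible \<Sigma>)
  moreover have "\<forall>\<^sub>F \<epsilon> in at_right 0. - reach_cost + ?Y \<epsilon> = P \<epsilon> N"
    using pos by eventually_elim (simp add: ric)
  ultimately have limN: "((\<lambda>\<epsilon>. P \<epsilon> N) \<longlongrightarrow> P0 N) (at_right 0)"
    unfolding ric0 by (rule Lim_transform_eventually)
  have lim: "((\<lambda>\<epsilon>. P \<epsilon> k) \<longlongrightarrow> P0 k) (at_right 0)" if "k \<le> N" for k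
  proof (rule riccati_tendsto[where P = P and ?P0.0 = P0])
    show "\<forall>\<^sub>F \<epsilon> in at_right 0. riccati_solution N A B S Q R (P \<epsilon>)"
      by (rule eventually_mono[OF pos ric(1)])
    show "riccati_solution N A B S Q R P0" by (rule ric0(1))
    show "((\<lambda>\<epsilon>. P \<epsilon> N) \<longlongrightarrow> P0 N) (at_right 0)" by (rule limN)
    show "k \<le> N" by (rule that)
  qed (simp_all only: inv inv0)
  have mean: "((\<lambda>\<epsilon>. density_mean (policy A B S R (P \<epsilon>) \<epsilon> k x)) \<longlongrightarrow> - (gain A B S R P0 k *v x)) (at_right 0)"
    if k: "k < N" for k x
  proof (rule Lim_transform_eventually)
    show "((\<lambda>\<epsilon>. - (gain A B S R (P \<epsilon>) k *v x)) \<longlongrightarrow> - (gain A B S R P0 k *v x)) (at_right 0)"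
      by (intro tendsto_minus tendsto_matrix_vector_mult gain_tendsto lim inv[OF k] inv0[OF k]) (use k in simp)
    show "\<forall>\<^sub>F \<epsilon> in at_right 0. - (gain A B S R (P \<epsilon>) k *v x) = density_mean (policy A B S R (P \<epsilon>) \<epsilon> k x)"
      using pos by eventually_elim (simp add: policy_mean_cov pd k)
  qed
  have cov: "((\<lambda>\<epsilon>. density_cov (policy A B S R (P \<epsilon>) \<epsilon> k x)) \<longlongrightarrow> 0) (at_right 0)"
    if k: "k < N" for k x
  proof (rule Lim_transform_eventually)
    have "((\<lambda>\<epsilon>. \<epsilon> *\<^sub>R matrix_inv (control_weight B R (P \<epsilon>) k)) \<longlongrightarrow> 0 *\<^sub>R matrix_inv (control_weight B R P0 k)) (at_right 0)"
      using k by (intro tendsto_scaleR tendsto_ident_at control_weight_inv_tendsto lim inv inv0) auto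
    then show "((\<lambda>\<epsilon>. \<epsilon> *\<^sub>R matrix_inv (control_weight B R (P \<epsilon>) k)) \<longlongrightarrow> 0) (at_right 0)" by simp
    show "\<forall>\<^sub>F \<epsilon> in at_right 0. \<epsilon> *\<^sub>R matrix_inv (control_weight B R (P \<epsilon>) k) = density_cov (policy A B S R (P \<epsilon>) \<epsilon> k x)"
      using pos by eventually_elim (simp add: policy_mean_cov pd k)
  qed
  let ?u = "feedback_control P0 x0"
  note opt = feedback_control_optimal[OF ric0 \<Sigma> assms(12)]
  have "?u k \<omega> = - (gain A B S R P0 k *v state A B x0 ?u k \<omega>)" for k \<omega>
    by (simp add: state_feedback_control feedback_control_def)
  then show ?thesis
    using pd pd0 mean cov opt by blast
qed

end
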